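(* Let $\Gamma$ be a compact connected metric graph, let $\kappa\in L_\infty(\Gamma)$ satisfy $\operatorname{ess\,inf}_\Gamma\kappa\ge\kappa_0>0$, let $a:\Gamma\to\mathbb R$ be Lipschitz and positive with $a_0=\min_\Gamma a>0$, and let $\alpha\in\mathbb R$. Suppose that either $\alpha\ge0$, or, with $S=|\alpha|/d_0$ and $d_0=\min_vd_v$, one has $\kappa_0^2>4S/\min_el_e$ and $2S\max_el_e\le a_0$. Let $\beta>\frac14$, let $\varrho^\beta$ be the covariance function of the solution of $L_\alpha^\beta u=\mathcal W$ under the generalized Kirchhoff vertex conditions, and let $\varrho_h^\beta$ be the covariance function of its finite element approximation (both defined in the context). Then, for every $\sigma<\min\{4\beta-\frac12,2\}$, $$\|\varrho^\beta-\varrho_h^\beta\|_{L_2(\Gamma\times\Gamma)}\le C\,\hat h^\sigma,$$ where $C$ depends only on $\sigma,\beta,a,\kappa,\Gamma$ (and $\alpha$), not on the mesh.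
   Context: A compact metric graph $\Gamma$ consists of a finite vertex set $\mathcal V$ and a finite edge set $\mathcal E$ (loops and multiple edges allowed); each edge $e$ is identified with $[0,l_e]$, $0<l_e<\infty$; $\Gamma$ carries the shortest-path metric; $\mathcal E_v$ is the set of edges incident to $v$ (a loop at $v$ counted twice) and $d_v=|\mathcal E_v|$. $\partial_eu(v)$ is the derivative of $u$ along $e$ at $v$ in the direction away from $v$. $L_2(\Gamma)=\bigoplus_eL_2(e)$ with inner product $(\cdot,\cdot)$; $\widetilde H^2(\Gamma)=\bigoplus_eH^2(e)$; $H^1(\Gamma)$ is the space of continuous functions on $\Gamma$ in $H^1(e)$ on each edge. $L_\alpha$ acts on each edge by $(L_\alpha u)_e=-(a_eu_e')'+\kappa_e^2u_e$ with domain $\{u\in\widetilde H^2(\Gamma)\cap C(\Gamma): a(v)\sum_{e\in\mathcal E_v}\partial_eu(v)=\alpha u(v)\ \forall v\in\mathcal V\}$; under the hypotheses it is self-adjoint and positive definite with compact inverse; $\{e_j\}$ is an orthonormal eigenbasis of $L_2(\Gamma)$ with eigenvalues $\lambda_j$. Its bilinear form is $\mathfrak h_\alpha(f,g)=(\kappa^2f,g)+\sum_e\int_ea f_e'g_e'\,dx+\sum_v\alpha f(v)g(v)$ on $H^1(\Gamma)$. Finite elements: each edge $e$ is subdivided into $n_e\ge2$ intervals of equal length $h_e=l_e/n_e$; $V_h\subset H^1(\Gamma)$ consists of the continuous functions on $\Gamma$ affine on every subinterval; $N_h=\dim V_h$; $\hat h=\max_eh_e$; $L_h:V_h\to V_h$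 is defined by $(L_hu,w)=\mathfrak h_\alpha(u,w)$ for $u,w\in V_h$, with $L_2(\Gamma)$-orthonormal eigenvectors $e_{j,h}$ and eigenvalues $\lambda_{j,h}>0$, $1\le j\le N_h$. With $\mathcal W=\sum_j\xi_je_j$ ($\xi_j$ i.i.d. standard normal), $u=L_\alpha^{-\beta}\mathcal W$ has covariance operator $L_\alpha^{-2\beta}$ and covariance function $\varrho^\beta(x,y)=\sum_{j=1}^\infty\lambda_j^{-2\beta}e_j(x)e_j(y)$ (series in $L_2(\Gamma\times\Gamma)$). The finite element approximation $u_h=L_h^{-\beta}\mathcal W_h$, $\mathcal W_h=\sum_j\xi_jP_he_j$ ($P_h$ the $L_2(\Gamma)$-orthogonal projection onto $V_h$), has covariance function $\varrho^\beta_h(x,y)=\sum_{j=1}^{N_h}\lambda_{j,h}^{-2\beta}e_{j,h}(x)e_{j,h}(y)$. *)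

theory Defs
  imports "HOL-Analysis.Analysis"
begin

text \<open>
  The edge \<open>e\<close> is identified with the interval \<open>[0, len e]\<close>, oriented from \<open>src e\<close> (at \<open>0\<close>) to
  \<open>tgt e\<close> (at \<open>len e\<close>). Loops and multiple edges are allowed.
\<close>

record ('v, 'e) metric_graph =
  verts :: "'v set"
  edges :: "'e set"
  src :: "'e \<Rightarrow> 'v"
  tgt :: "'e \<Rightarrow> 'v"
  len :: "'e \<Rightarrow> real"

definition compact_metric_graph :: "('v, 'e) metric_graph \<Rightarrow> bool" where
  "compact_metric_graph G \<longleftrightarrow>
     finite (verts G) \<and> finite (edges G) \<and>
     (\<forall>e\<in>edges G. src G e \<in> verts G \<and> tgt G e \<in> verts G \<and> 0 < len G e)"

text \<open>
  The pair \<open>(e, b)\<close> is an end of the edge \<open>e\<close>: the one at \<open>0\<close> if \<open>b\<close> is false, the one at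
  \<open>len e\<close> if \<open>b\<close> is true. Incidence is recorded for ends rather than for edges, so that a loop
  at \<open>v\<close> is counted twice in \<open>inc G v\<close>.
\<close>

definition end_vert :: "('v, 'e) metric_graph \<Rightarrow> 'e \<times> bool \<Rightarrow> 'v" where
  "end_vert G h = (if snd h then tgt G (fst h) else src G (fst h))"

definition end_pos :: "('v, 'e) metric_graph \<Rightarrow> 'e \<times> bool \<Rightarrow> real" where
  "end_pos G h = (if snd h then len G (fst h) else 0)"

definition inc :: "('v, 'e) metric_graph \<Rightarrow> 'v \<Rightarrow> ('e \<times> bool) set" where
  "inc G v = {h. fst h \<in> edges G \<and> end_vert G h = v}"

definition degree :: "('v, 'e) metric_graph \<Rightarrow> 'v \<Rightarrow> nat" where
  "degree G v = card (inc G v)"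

text \<open>A walk is the list of the edge ends through which it leaves the successive vertices.\<close>

fun walk :: "('v, 'e) metric_graph \<Rightarrow> 'v \<Rightarrow> ('e \<times> bool) list \<Rightarrow> 'v \<Rightarrow> bool" where
  "walk G v [] w \<longleftrightarrow> v \<in> verts G \<and> v = w"
| "walk G v (h # hs) w \<longleftrightarrow> h \<in> inc G v \<and> walk G (end_vert G (fst h, \<not> snd h)) hs w"

definition walk_length :: "('v, 'e) metric_graph \<Rightarrow> ('e \<times> bool) list \<Rightarrow> real" where
  "walk_length G hs = (\<Sum>h\<leftarrow>hs. len G (fst h))"

definition connected_graph :: "('v, 'e) metric_graph \<Rightarrow> bool" where
  "connected_graph G \<longleftrightarrow>
     verts G \<noteq> {} \<and> (\<forall>v\<in>verts G. \<forall>w\<in>verts G. \<exists>hs. walk G v hs w)"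

text \<open>
  The pair \<open>(e, x)\<close> stands for the point with coordinate \<open>x\<close> on the edge \<open>e\<close>; different pairs can
  denote the same vertex. Functions on the graph are functions on pairs, and only their values on
  \<open>points G\<close> matter.
\<close>

definition points :: "('v, 'e) metric_graph \<Rightarrow> ('e \<times> real) set" where
  "points G = (SIGMA e:edges G. {0..len G e})"

text \<open>
  Shortest-path metric: a path between \<open>p\<close> and \<open>q\<close> either stays inside their common edge, or leaves
  the edge of \<open>p\<close> at one end, follows a walk, and enters the edge of \<open>q\<close> at one of its ends.
  Pairs denoting the same vertex have distance zero.
\<close>

definition gdist :: "('v, 'e) metric_graph \<Rightarrow> 'e \<times> real \<Rightarrow> 'e \<times> real \<Rightarrow> real" where
  "gdist G p q = Inf
     ({d. fst p = fst q \<and> d = \<bar>snd p - snd q\<bar>} \<union>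
      {\<bar>snd p - end_pos G (fst p, b)\<bar> + walk_length G hs + \<bar>snd q - end_pos G (fst q, c)\<bar> | b c hs.
         walk G (end_vert G (fst p, b)) hs (end_vert G (fst q, c))})"

definition graph_lipschitz :: "('v, 'e) metric_graph \<Rightarrow> ('e \<times> real \<Rightarrow> real) \<Rightarrow> bool" where
  "graph_lipschitz G f \<longleftrightarrow>
     (\<exists>K. \<forall>p\<in>points G. \<forall>q\<in>points G. \<bar>f p - f q\<bar> \<le> K * gdist G p q)"

definition graph_continuous :: "('v, 'e) metric_graph \<Rightarrow> ('e \<times> real \<Rightarrow> real) \<Rightarrow> bool" where
  "graph_continuous G f \<longleftrightarrow>
     (\<forall>e\<in>edges G. continuous_on {0..len G e} (\<lambda>x. f (e, x))) \<and>
     (\<forall>v\<in>verts G. \<forall>h\<in>inc G v. \<forall>h'\<in>inc G v.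
        f (fst h, end_pos G h) = f (fst h', end_pos G h'))"

text \<open>
  The value at a vertex, meaningful for functions whose values at all ends incident to \<open>v\<close> agree.
\<close>

definition vert_val :: "('v, 'e) metric_graph \<Rightarrow> ('e \<times> real \<Rightarrow> real) \<Rightarrow> 'v \<Rightarrow> real" where
  "vert_val G f v = (let h = (SOME h. h \<in> inc G v) in f (fst h, end_pos G h))"

definition graph_measure :: "('v, 'e) metric_graph \<Rightarrow> ('e \<times> real) measure" where
  "graph_measure G = restrict_space (count_space (edges G) \<Otimes>\<^sub>M lborel) (points G)"

definition l2_space :: "'a measure \<Rightarrow> ('a \<Rightarrow> real) set" where
  "l2_space M = {f \<in> borel_measurable M. integrable M (\<lambda>x. (f x)\<^sup>2)}"

definition l2_inner :: "'a measure \<Rightarrow> ('a \<Rightarrow> real) \<Rightarrow> ('a \<Rightarrow> real) \<Rightarrow> real" where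
  "l2_inner M f g = (\<integral>x. f x * g x \<partial>M)"

definition l2_norm :: "'a measure \<Rightarrow> ('a \<Rightarrow> real) \<Rightarrow> real" where
  "l2_norm M f = sqrt (\<integral>x. (f x)\<^sup>2 \<partial>M)"

definition linf_space :: "'a measure \<Rightarrow> ('a \<Rightarrow> real) set" where
  "linf_space M = {f \<in> borel_measurable M. \<exists>K. AE x in M. \<bar>f x\<bar> \<le> K}"

text \<open>
  Sobolev functions on \<open>[0, l]\<close> are represented by their continuous representatives:
  \<open>f\<close> is absolutely continuous with square-integrable derivative \<open>g\<close>.
\<close>

definition has_weak_deriv :: "real \<Rightarrow> (real \<Rightarrow> real) \<Rightarrow> (real \<Rightarrow> real) \<Rightarrow> bool" where
  "has_weak_deriv l f g \<longleftrightarrow>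
     set_borel_measurable lborel {0..l} g \<and>
     set_integrable lborel {0..l} (\<lambda>x. (g x)\<^sup>2) \<and>
     (\<forall>x\<in>{0..l}. f x = f 0 + (LBINT y:{0..x}. g y))"

definition H1_interval :: "real \<Rightarrow> (real \<Rightarrow> real) set" where
  "H1_interval l = {f. \<exists>g. has_weak_deriv l f g}"

definition H2_interval :: "real \<Rightarrow> (real \<Rightarrow> real) set" where
  "H2_interval l = {f. \<exists>g. has_weak_deriv l f g \<and> g \<in> H1_interval l}"

text \<open>The weak derivative of an \<open>H\<^sup>1\<close> function; it is determined almost everywhere.\<close>

definition weak_deriv :: "real \<Rightarrow> (real \<Rightarrow> real) \<Rightarrow> real \<Rightarrow> real" where
  "weak_deriv l f = (SOME g. has_weak_deriv l f g)"

text \<open>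
  The classical derivative along an edge, one-sided at the ends. For \<open>H\<^sup>2\<close> functions it exists
  everywhere and is the continuous representative of the weak derivative.
\<close>

definition edge_deriv ::
    "('v, 'e) metric_graph \<Rightarrow> ('e \<times> real \<Rightarrow> real) \<Rightarrow> 'e \<times> real \<Rightarrow> real" where
  "edge_deriv G u p =
     vector_derivative (\<lambda>x. u (fst p, x)) (at (snd p) within {0..len G (fst p)})"

definition outgoing_deriv ::
    "('v, 'e) metric_graph \<Rightarrow> ('e \<times> real \<Rightarrow> real) \<Rightarrow> 'e \<times> bool \<Rightarrow> real" where
  "outgoing_deriv G u h =
     (if snd h then - edge_deriv G u (fst h, end_pos G h) else edge_deriv G u (fst h, end_pos G h))"

definition op_domain ::
    "('v, 'e) metric_graph \<Rightarrow> ('e \<times> real \<Rightarrow> real) \<Rightarrow> real \<Rightarrow> ('e \<times> real \<Rightarrow> real) set" where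
  "op_domain G a \<alpha> =
     {u. (\<forall>e\<in>edges G. (\<lambda>x. u (e, x)) \<in> H2_interval (len G e)) \<and>
         graph_continuous G u \<and>
         (\<forall>v\<in>verts G. vert_val G a v * (\<Sum>h\<in>inc G v. outgoing_deriv G u h) = \<alpha> * vert_val G u v)}"

definition graph_op ::
    "('v, 'e) metric_graph \<Rightarrow> ('e \<times> real \<Rightarrow> real) \<Rightarrow> ('e \<times> real \<Rightarrow> real) \<Rightarrow>
     ('e \<times> real \<Rightarrow> real) \<Rightarrow> 'e \<times> real \<Rightarrow> real" where
  "graph_op G a \<kappa> u = (\<lambda>(e, x).
     - weak_deriv (len G e) (\<lambda>y. a (e, y) * edge_deriv G u (e, y)) x + (\<kappa> (e, x))\<^sup>2 * u (e, x))"

definition graph_eigenbasis ::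
    "('v, 'e) metric_graph \<Rightarrow> ('e \<times> real \<Rightarrow> real) \<Rightarrow> ('e \<times> real \<Rightarrow> real) \<Rightarrow> real \<Rightarrow>
     (nat \<Rightarrow> 'e \<times> real \<Rightarrow> real) \<Rightarrow> (nat \<Rightarrow> real) \<Rightarrow> bool" where
  "graph_eigenbasis G a \<kappa> \<alpha> \<phi> lam \<longleftrightarrow>
     (\<forall>j. \<phi> j \<in> op_domain G a \<alpha> \<and>
          (AE p in graph_measure G. graph_op G a \<kappa> (\<phi> j) p = lam j * \<phi> j p)) \<and>
     (\<forall>i j. l2_inner (graph_measure G) (\<phi> i) (\<phi> j) = (if i = j then 1 else 0)) \<and>
     (\<forall>f\<in>l2_space (graph_measure G).
        (\<lambda>n. l2_norm (graph_measure G)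
               (\<lambda>p. f p - (\<Sum>j<n. l2_inner (graph_measure G) f (\<phi> j) * \<phi> j p)))
        \<longlonglongrightarrow> 0)"

definition covariance_series_sums ::
    "('v, 'e) metric_graph \<Rightarrow> real \<Rightarrow> (nat \<Rightarrow> 'e \<times> real \<Rightarrow> real) \<Rightarrow> (nat \<Rightarrow> real) \<Rightarrow>
     (('e \<times> real) \<times> ('e \<times> real) \<Rightarrow> real) \<Rightarrow> bool" where
  "covariance_series_sums G \<beta> \<phi> lam \<rho> \<longleftrightarrow>
     \<rho> \<in> l2_space (graph_measure G \<Otimes>\<^sub>M graph_measure G) \<and>
     (\<lambda>n. l2_norm (graph_measure G \<Otimes>\<^sub>M graph_measure G)
            (\<lambda>(p, q). \<rho> (p, q) - (\<Sum>j<n. lam j powr (- 2 * \<beta>) * \<phi> j p * \<phi> j q)))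
     \<longlonglongrightarrow> 0"

definition graph_form ::
    "('v, 'e) metric_graph \<Rightarrow> ('e \<times> real \<Rightarrow> real) \<Rightarrow> ('e \<times> real \<Rightarrow> real) \<Rightarrow> real \<Rightarrow>
     ('e \<times> real \<Rightarrow> real) \<Rightarrow> ('e \<times> real \<Rightarrow> real) \<Rightarrow> real" where
  "graph_form G a \<kappa> \<alpha> f g =
     l2_inner (graph_measure G) (\<lambda>p. (\<kappa> p)\<^sup>2 * f p) g +
     (\<Sum>e\<in>edges G. LBINT x:{0..len G e}.
        a (e, x) * weak_deriv (len G e) (\<lambda>y. f (e, y)) x * weak_deriv (len G e) (\<lambda>y. g (e, y)) x) +
     (\<Sum>v\<in>verts G. \<alpha> * vert_val G f v * vert_val G g v)"

text \<open>A mesh is given by the numbers \<open>n e\<close> of subintervals of the edges.\<close>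

definition is_mesh :: "('v, 'e) metric_graph \<Rightarrow> ('e \<Rightarrow> nat) \<Rightarrow> bool" where
  "is_mesh G n \<longleftrightarrow> (\<forall>e\<in>edges G. 2 \<le> n e)"

definition mesh_width :: "('v, 'e) metric_graph \<Rightarrow> ('e \<Rightarrow> nat) \<Rightarrow> 'e \<Rightarrow> real" where
  "mesh_width G n e = len G e / real (n e)"

definition max_mesh_width :: "('v, 'e) metric_graph \<Rightarrow> ('e \<Rightarrow> nat) \<Rightarrow> real" where
  "max_mesh_width G n = Max (mesh_width G n ` edges G)"

definition fem_space :: "('v, 'e) metric_graph \<Rightarrow> ('e \<Rightarrow> nat) \<Rightarrow> ('e \<times> real \<Rightarrow> real) set" where
  "fem_space G n =
     {u. graph_continuous G u \<and>
         (\<forall>e\<in>edges G. \<forall>i<n e. \<exists>c d.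
            \<forall>x\<in>{real i * mesh_width G n e..real (Suc i) * mesh_width G n e}. u (e, x) = c + d * x)}"

definition fem_op ::
    "('v, 'e) metric_graph \<Rightarrow> ('e \<times> real \<Rightarrow> real) \<Rightarrow> ('e \<times> real \<Rightarrow> real) \<Rightarrow> real \<Rightarrow> ('e \<Rightarrow> nat) \<Rightarrow>
     ('e \<times> real \<Rightarrow> real) \<Rightarrow> 'e \<times> real \<Rightarrow> real" where
  "fem_op G a \<kappa> \<alpha> n u = (SOME f. f \<in> fem_space G n \<and>
     (\<forall>w\<in>fem_space G n. l2_inner (graph_measure G) f w = graph_form G a \<kappa> \<alpha> u w))"

text \<open>
  The eigenfunctions \<open>\<phi> 0, \<dots>, \<phi> (N - 1)\<close> form a basis of the finite element space, which forces
  \<open>N\<close> to be its dimension. Elements of the space are compared on \<open>points G\<close> only.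
\<close>

definition fem_eigenbasis ::
    "('v, 'e) metric_graph \<Rightarrow> ('e \<times> real \<Rightarrow> real) \<Rightarrow> ('e \<times> real \<Rightarrow> real) \<Rightarrow> real \<Rightarrow> ('e \<Rightarrow> nat) \<Rightarrow>
     nat \<Rightarrow> (nat \<Rightarrow> 'e \<times> real \<Rightarrow> real) \<Rightarrow> (nat \<Rightarrow> real) \<Rightarrow> bool" where
  "fem_eigenbasis G a \<kappa> \<alpha> n N \<phi> lam \<longleftrightarrow>
     (\<forall>j<N. \<phi> j \<in> fem_space G n \<and>
            (\<forall>p\<in>points G. fem_op G a \<kappa> \<alpha> n (\<phi> j) p = lam j * \<phi> j p)) \<and>
     (\<forall>i<N. \<forall>j<N. l2_inner (graph_measure G) (\<phi> i) (\<phi> j) = (if i = j then 1 else 0)) \<and>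
     (\<forall>f\<in>fem_space G n. \<exists>c. \<forall>p\<in>points G. f p = (\<Sum>j<N. c j * \<phi> j p))"

definition fem_covariance ::
    "real \<Rightarrow> nat \<Rightarrow> (nat \<Rightarrow> 'e \<times> real \<Rightarrow> real) \<Rightarrow> (nat \<Rightarrow> real) \<Rightarrow>
     ('e \<times> real) \<times> ('e \<times> real) \<Rightarrow> real" where
  "fem_covariance \<beta> N \<phi> lam =
     (\<lambda>(p, q). \<Sum>j<N. lam j powr (- 2 * \<beta>) * \<phi> j p * \<phi> j q)"

end

theory Submission
  imports Defs
begin

text \<open>
  Write \<open>\<mu>\<^sub>j = 1 / \<lambda>\<^sub>j\<close>, \<open>\<mu>h\<^sub>k = 1 / \<lambda>\<^sub>k\<^sub>,\<^sub>h\<close>, \<open>c\<^sub>j\<^sub>k = (e\<^sub>j, e\<^sub>k\<^sub>,\<^sub>h)\<close> and \<open>s = 2 \<beta>\<close>. Expanding in the mixed basis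
  of products, the squared error equals
  \<open>\<Sum>\<^sub>j \<mu>\<^sub>j\<^bsup>2s\<^esup> (1 - \<Sum>\<^sub>k c\<^sub>j\<^sub>k\<^sup>2) + \<Sum>\<^sub>j\<^sub>k (\<mu>\<^sub>j\<^bsup>s\<^esup> - \<mu>h\<^sub>k\<^bsup>s\<^esup>)\<^sup>2 c\<^sub>j\<^sub>k\<^sup>2\<close>,
  so that no fractional power of an operator has to be estimated: a scalar inequality for
  \<open>(x\<^bsup>s\<^esup> - y\<^bsup>s\<^esup>)\<^sup>2\<close>, split according to whether \<open>max x y\<close> exceeds \<open>h\<^sup>2\<close>, reduces
  the bound to two facts. The first is the second-order \<open>L\<^sub>2\<close> error bound
  \<open>\<parallel>(L\<^sup>-\<^sup>1 - L\<^sub>h\<^sup>-\<^sup>1 P\<^sub>h) f\<parallel> \<le> C h\<^sup>2 \<parallel>f\<parallel>\<close>, which controls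
  \<open>\<Sum>\<^sub>k (\<mu>\<^sub>j - \<mu>h\<^sub>k)\<^sup>2 c\<^sub>j\<^sub>k\<^sup>2\<close> for each \<open>j\<close> and the corresponding sums over \<open>j\<close> for each \<open>k\<close>. The second is
  that \<open>\<Sum>\<^sub>j \<mu>\<^sub>j\<^bsup>p\<^esup>\<close> and \<open>\<Sum>\<^sub>k \<mu>h\<^sub>k\<^bsup>p\<^esup>\<close> are bounded uniformly in the mesh for every \<open>p > 1/2\<close>,
  which follows from a one-dimensional trace inequality: it bounds the diagonal of the resolvent
  kernel, for the operator and for its discretisation alike.
\<close>

section \<open>Scalar inequalities and semi-inner products\<close>

text \<open>Since the eigenbases are given, no solvability theory is developed: on finite
  combinations of eigenfunctions the solution operator is explicit, and regularity is only
  established for such combinations. The obstacle is uniformity in the mesh. Eigenvalues are never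
  matched one by one with discrete eigenvalues. Instead each pair (j, k) is weighted by the sum of
  the p-th powers of its two inverse eigenvalues. One weight is summed along rows of the overlap
  matrix and the other along columns, so the operator error must be controlled in both directions.
  For \<sigma> \<ge> 0 the exponent is p = 4\<beta> - \<sigma>, and the summability threshold p >
  1/2 is exactly \<sigma> < 4\<beta> - 1/2. The cap 2 is the order of the L2 error. All sums are
  kept finite by cutting the covariance series after m terms. The cut leaves a third sum, made of
  the parts of the discrete eigenfunctions outside the span of the first m eigenfunctions. It tends
  to 0 by completeness, whereas the bounds on the other two sums do not depend on m.\<close>

lemma powr_diff_le_mult_max:
  fixes x y s :: real
  assumes "0 \<le> x" "0 \<le> y" "0 < s"
  shows "\<bar>x powr s - y powr s\<bar> \<le> max 1 s * \<bar>x - y\<bar> * max x y powr (s - 1)"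
proof -
  \<comment> \<open>For s > 1 this is the mean value theorem, the derivative being largest at
    \<open>v\<close>. For s \<le> 1 the derivative is unbounded near 0, and monotonicity of z^(s-1)
    gives u v^(s-1) \<le> u^s directly.\<close>
  have main: "v powr s - u powr s \<le> max 1 s * (v - u) * v powr (s - 1)"
    if uv: "0 \<le> u" "u < v" for u v :: real
  proof (cases "s \<le> 1")
    case True
    have "v powr (s - 1) * u \<le> u powr s"
    proof (cases "u = 0")
      case False
      then have "v powr (s - 1) \<le> u powr (s - 1)"
        using that True by (intro powr_mono2') auto
      then have "v powr (s - 1) * u \<le> u powr (s - 1) * u"
        using that by (intro mult_right_mono) auto
      also have "\<dots> = u powr s"
        using that False by (simp add: powr_diff)
      finally show ?thesis .
    qed simp
    moreover have "v powr s = v powr (s - 1) * v"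
      using that by (simp add: powr_diff)
    ultimately show ?thesis
      using True by (simp add: algebra_simps)
  next
    case False
    obtain z where z: "u < z" "z < v" "v powr s - u powr s = (\<lambda>d. s * z powr (s - 1) * d) (v - u)"
    proof (rule mvt[OF uv(2), where f = "\<lambda>z. z powr s" and f' = "\<lambda>z d. s * z powr (s - 1) * d"])
      show "continuous_on {u..v} (\<lambda>z. z powr s)"
        using uv assms by (intro continuous_on_powr') (auto intro!: continuous_intros)
      show "((\<lambda>z. z powr s) has_derivative (\<lambda>d. s * z powr (s - 1) * d)) (at z)"
        if "u < z" "z < v" for z
        using that uv(1) has_real_derivative_powr[of z s]
        by (simp add: has_field_derivative_def mult_commute_abs)
    qed auto
    have "z powr (s - 1) \<le> v powr (s - 1)"
      using z uv False by (intro powr_mono2) auto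
    then show ?thesis
      using z uv False by (simp add: mult.assoc mult.commute mult_left_mono)
  qed
  show ?thesis
  proof (cases "x = y")
    case False
    then consider "y < x" | "x < y" by linarith
    then show ?thesis
    proof cases
      case 1
      then show ?thesis using main[of y x] assms powr_mono2[of s y x] by (simp add: max_def)
    next
      case 2
      then show ?thesis using main[of x y] assms powr_mono2[of s x y] by (simp add: max_def)
    qed
  qed simp
qed

text \<open>The weight \<open>x powr p + y powr p\<close> dominates m^p for m = max x y, whichever
  of the two is larger. Once it is factored out, m^(2s-p) remains when both numbers are small, and
  (x-y)^2 m^(2s-2-p) otherwise.\<close>

lemma powr_diff_sq_rate:
  fixes s p \<sigma> H X :: real
  assumes "0 < s" "0 \<le> p" "p \<le> 2 * s" "\<sigma> \<le> 2 * s - p" "\<sigma> \<le> 2" "0 < H" "0 < X"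
  obtains C where "0 \<le> C"
    "\<And>h x y. \<lbrakk>0 < h; h \<le> H; 0 < x; x \<le> X; 0 \<le> y; y \<le> X\<rbrakk> \<Longrightarrow>
       (x powr s - y powr s)\<^sup>2 \<le>
         C * (((x - y)\<^sup>2 * h powr (2 * \<sigma> - 4) + h powr (2 * \<sigma>)) * (x powr p + y powr p))"
proof -
  \<comment> \<open>The surplus power of h: (h^2)^(2s-p) = h^(2\<sigma>) h^r and (h^2)^(2s-2-p) =
    h^(2\<sigma>-4) h^r. It is nonnegative, so h^r is absorbed into the constant as H^r.\<close>
  define r where "r = 4 * s - 2 * p - 2 * \<sigma>"
  define q where "q = 2 * s - 2 - p"
  define K where "K = max 1 s"
  define C where "C = H powr r + K\<^sup>2 * (X powr q * H powr (4 - 2 * \<sigma>) + H powr r)"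
  have r: "0 \<le> r" using assms unfolding r_def by simp
  have C0: "0 \<le> C" unfolding C_def by simp
  have "(x powr s - y powr s)\<^sup>2 \<le>
         C * (((x - y)\<^sup>2 * h powr (2 * \<sigma> - 4) + h powr (2 * \<sigma>)) * (x powr p + y powr p))"
    if h: "0 < h" "h \<le> H" and x: "0 < x" "x \<le> X" and y: "0 \<le> y" "y \<le> X" for h x y :: real
  proof -
    define m where "m = max x y"
    have m: "0 < m" "m \<le> X" using x y unfolding m_def by auto
    have mp: "m powr p \<le> x powr p + y powr p" unfolding m_def max_def by auto
    have hr: "h powr r \<le> H powr r" using h r by (intro powr_mono2) auto
    show ?thesis
    proof (cases "m < h\<^sup>2")
      case True
      have "\<bar>x powr s - y powr s\<bar> \<le> m powr s"
      proof -
        have "x powr s \<le> m powr s" "y powr s \<le> m powr s"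
          using x y assms unfolding m_def by (auto intro!: powr_mono2)
        then show ?thesis using powr_ge_zero[of x s] powr_ge_zero[of y s] by linarith
      qed
      then have "(x powr s - y powr s)\<^sup>2 \<le> (m powr s)\<^sup>2"
        by (metis abs_ge_zero power2_abs power_mono)
      also have "\<dots> = m powr (2 * s - p) * m powr p"
        by (simp add: powr_add[symmetric] power2_eq_square)
      also have "m powr (2 * s - p) \<le> (h\<^sup>2) powr (2 * s - p)"
        using m True assms by (intro powr_mono2) auto
      also have "(h\<^sup>2) powr (2 * s - p) = h powr (2 * \<sigma>) * h powr r"
        using h by (simp add: powr_powr powr_add[symmetric] r_def algebra_simps flip: powr_numeral)
      also have "h powr (2 * \<sigma>) * h powr r * m powr p
          \<le> h powr (2 * \<sigma>) * H powr r * (x powr p + y powr p)"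
        using hr mp by (intro mult_mono) auto
      also have "\<dots> = H powr r * (h powr (2 * \<sigma>) * (x powr p + y powr p))" by simp
      also have "\<dots> \<le> C * (((x - y)\<^sup>2 * h powr (2 * \<sigma> - 4) + h powr (2 * \<sigma>)) * (x powr p + y powr p))"
        unfolding C_def by (intro mult_mono mult_right_mono) auto
      finally show ?thesis by (simp add: mult_right_mono)
    next
      case False
      \<comment> \<open>If q \<ge> 0, the power is merely bounded, and h^(2\<sigma>-4) can be
        inserted because \<sigma> \<le> 2 keeps it away from 0. If q < 0, the lower bound m \<ge>
        h^2 is what helps.\<close>
      have mq: "m powr q \<le> (X powr q * H powr (4 - 2 * \<sigma>) + H powr r) * h powr (2 * \<sigma> - 4)"
      proof (cases "0 \<le> q")
        case True
        have "1 = h powr (4 - 2 * \<sigma>) * h powr (2 * \<sigma> - 4)"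
          using h by (simp add: powr_add[symmetric])
        also have "\<dots> \<le> H powr (4 - 2 * \<sigma>) * h powr (2 * \<sigma> - 4)"
          using h assms by (intro mult_right_mono powr_mono2) auto
        finally have 1: "1 \<le> H powr (4 - 2 * \<sigma>) * h powr (2 * \<sigma> - 4)" .
        have "m powr q \<le> X powr q" using m True by (intro powr_mono2) auto
        also have "\<dots> \<le> X powr q * (H powr (4 - 2 * \<sigma>) * h powr (2 * \<sigma> - 4))"
          using mult_left_mono[OF 1, of "X powr q"] by simp
        also have "\<dots> \<le> (X powr q * H powr (4 - 2 * \<sigma>) + H powr r) * h powr (2 * \<sigma> - 4)"
          by (simp add: algebra_simps)
        finally show ?thesis .
      next
        case neg: False
        have "m powr q \<le> (h\<^sup>2) powr q"
          using h False neg by (intro powr_mono2') auto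
        also have "\<dots> = h powr r * h powr (2 * \<sigma> - 4)"
          using h by (simp add: powr_powr powr_add[symmetric] r_def q_def algebra_simps flip: powr_numeral)
        also have "\<dots> \<le> H powr r * h powr (2 * \<sigma> - 4)"
          using hr by (intro mult_right_mono) auto
        also have "\<dots> \<le> (X powr q * H powr (4 - 2 * \<sigma>) + H powr r) * h powr (2 * \<sigma> - 4)"
          by (simp add: algebra_simps)
        finally show ?thesis .
      qed
      have "(x powr s - y powr s)\<^sup>2 \<le> (K * \<bar>x - y\<bar> * m powr (s - 1))\<^sup>2"
        using powr_diff_le_mult_max[of x y s] x y assms unfolding K_def m_def
        by (metis abs_ge_zero less_imp_le power2_abs power_mono)
      also have "\<dots> = K\<^sup>2 * (x - y)\<^sup>2 * (m powr q * m powr p)"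
      proof -
        have "(m powr (s - 1))\<^sup>2 = m powr q * m powr p"
          by (simp add: powr_add[symmetric] power2_eq_square q_def)
        then show ?thesis by (simp add: power_mult_distrib)
      qed
      also have "\<dots> \<le> K\<^sup>2 * (x - y)\<^sup>2 *
          (((X powr q * H powr (4 - 2 * \<sigma>) + H powr r) * h powr (2 * \<sigma> - 4)) * (x powr p + y powr p))"
        using mq mp by (intro mult_left_mono mult_mono) auto
      also have "\<dots> = K\<^sup>2 * (X powr q * H powr (4 - 2 * \<sigma>) + H powr r) *
          (((x - y)\<^sup>2 * h powr (2 * \<sigma> - 4)) * (x powr p + y powr p))"
        by simp
      also have "\<dots> \<le> C * (((x - y)\<^sup>2 * h powr (2 * \<sigma> - 4) + h powr (2 * \<sigma>)) * (x powr p + y powr p))"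
        unfolding C_def by (intro mult_mono mult_right_mono) auto
      finally show ?thesis .
    qed
  qed
  with C0 that show ?thesis by blast
qed

text \<open>
  \<open>x\<close> and \<open>y\<close> are the inverse eigenvalues of two operators and \<open>c j k\<close> are the inner products of
  their eigenfunctions; the sums weighted by \<open>(x j - y k)\<^sup>2\<close> say that the operators differ by at most \<open>\<delta>\<close> on
  each eigenfunction.
\<close>

definition spectrally_close ::
    "real \<Rightarrow> real \<Rightarrow> real \<Rightarrow> real \<Rightarrow> nat \<Rightarrow> nat \<Rightarrow> (nat \<Rightarrow> real) \<Rightarrow> (nat \<Rightarrow> real) \<Rightarrow> (nat \<Rightarrow> nat \<Rightarrow> real) \<Rightarrow> bool" where
  "spectrally_close \<delta> X p Q n N x y c \<longleftrightarrow>
     (\<forall>j<n. 0 < x j \<and> x j \<le> X \<and> (\<Sum>k<N. (c j k)\<^sup>2) \<le> 1 \<and>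
        (\<Sum>k<N. (x j - y k)\<^sup>2 * (c j k)\<^sup>2) + (x j)\<^sup>2 * (1 - (\<Sum>k<N. (c j k)\<^sup>2)) \<le> \<delta>\<^sup>2) \<and>
     (\<forall>k<N. 0 < y k \<and> y k \<le> X \<and> (\<Sum>j<n. (c j k)\<^sup>2) \<le> 1 \<and> (\<Sum>j<n. (x j - y k)\<^sup>2 * (c j k)\<^sup>2) \<le> \<delta>\<^sup>2) \<and>
     (\<Sum>j<n. x j powr p) \<le> Q \<and> (\<Sum>k<N. y k powr p) \<le> Q"

text \<open>The scalar inequality is multiplied by \<open>(c j k)\<^sup>2\<close> and summed. Terms
  with weight \<open>x j powr p\<close> are summed over k first and use the row bounds; terms with
  weight \<open>y k powr p\<close> are summed over j first and use the column bounds. In both cases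
  h^(2\<sigma>-4) meets an error of order h^4.\<close>

lemma spectral_sum_rate:
  fixes s p \<sigma> H X A Q :: real
  assumes "0 < s" "0 \<le> p" "p \<le> 2 * s" "\<sigma> \<le> 2 * s - p" "\<sigma> \<le> 2" "0 < H" "0 < X"
  obtains C where
    "\<And>h n N x y c. \<lbrakk>0 < h; h \<le> H; spectrally_close (A * h\<^sup>2) X p Q n N x y c\<rbrakk> \<Longrightarrow>
      (\<Sum>j<n. x j powr (2 * s) * (1 - (\<Sum>k<N. (c j k)\<^sup>2))) +
      (\<Sum>j<n. \<Sum>k<N. (x j powr s - y k powr s)\<^sup>2 * (c j k)\<^sup>2) \<le> C * h powr (2 * \<sigma>)"
proof -
  obtain C where C0: "0 \<le> C" and C: "\<And>h x y. \<lbrakk>0 < h; h \<le> H; 0 < x; x \<le> X; 0 \<le> y; y \<le> X\<rbrakk> \<Longrightarrow>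
       (x powr s - y powr s)\<^sup>2 \<le>
         C * (((x - y)\<^sup>2 * h powr (2 * \<sigma> - 4) + h powr (2 * \<sigma>)) * (x powr p + y powr p))"
    using powr_diff_sq_rate[OF assms] by metis
  show ?thesis
  proof (rule that[of "2 * C * (A\<^sup>2 + 1) * Q"])
    fix h :: real and n N :: nat and x y :: "nat \<Rightarrow> real" and c :: "nat \<Rightarrow> nat \<Rightarrow> real"
    assume h: "0 < h" "h \<le> H" and close: "spectrally_close (A * h\<^sup>2) X p Q n N x y c"
    have \<delta>: "(A * h\<^sup>2)\<^sup>2 = A\<^sup>2 * h ^ 4" by (simp add: power_mult_distrib flip: power_mult)
    from close have x: "\<And>j. j < n \<Longrightarrow> 0 < x j \<and> x j \<le> X" and y: "\<And>k. k < N \<Longrightarrow> 0 < y k \<and> y k \<le> X"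
      and c1: "\<And>j. j < n \<Longrightarrow> (\<Sum>k<N. (c j k)\<^sup>2) \<le> 1"
      and A1: "\<And>j. j < n \<Longrightarrow> (\<Sum>k<N. (x j - y k)\<^sup>2 * (c j k)\<^sup>2) + (x j)\<^sup>2 * (1 - (\<Sum>k<N. (c j k)\<^sup>2)) \<le> A\<^sup>2 * h ^ 4"
      and c2: "\<And>k. k < N \<Longrightarrow> (\<Sum>j<n. (c j k)\<^sup>2) \<le> 1"
      and A2: "\<And>k. k < N \<Longrightarrow> (\<Sum>j<n. (x j - y k)\<^sup>2 * (c j k)\<^sup>2) \<le> A\<^sup>2 * h ^ 4"
      and Q1: "(\<Sum>j<n. x j powr p) \<le> Q" and Q2: "(\<Sum>k<N. y k powr p) \<le> Q"
      unfolding spectrally_close_def \<delta> by auto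
    define d where "d = h powr (2 * \<sigma> - 4)"
    define e where "e = h powr (2 * \<sigma>)"
    have de: "d * h ^ 4 = e"
      using h unfolding d_def e_def by (simp add: powr_add[symmetric] flip: powr_numeral)
    have d0: "0 \<le> d" unfolding d_def by simp
    have Ae: "d * (A\<^sup>2 * h ^ 4) + e = (A\<^sup>2 + 1) * e" using de by (simp add: algebra_simps)
    define R where "R j = 1 - (\<Sum>k<N. (c j k)\<^sup>2)" for j
    have R0: "0 \<le> R j" if "j < n" for j using c1[OF that] unfolding R_def by simp
    \<comment> \<open>The part of the j-th eigenfunction outside the discrete space is treated as if
      paired with the inverse eigenvalue 0; this is why the scalar inequality admits y = 0.\<close>
    have t1: "x j powr (2 * s) \<le> C * (((x j)\<^sup>2 * d + e) * x j powr p)" if "j < n" for j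
    proof -
      have "x j powr (2 * s) = (x j powr s - 0 powr s)\<^sup>2"
        by (simp add: power2_eq_square powr_add[symmetric])
      also have "\<dots> \<le> C * (((x j)\<^sup>2 * d + e) * x j powr p)"
        using C[OF h, of "x j" 0] x[OF that] assms by (simp add: d_def e_def)
      finally show ?thesis .
    qed
    have t2: "(x j powr s - y k powr s)\<^sup>2 \<le> C * (((x j - y k)\<^sup>2 * d + e) * (x j powr p + y k powr p))"
      if "j < n" "k < N" for j k
      using C[OF h, of "x j" "y k"] x[OF that(1)] y[OF that(2)] unfolding d_def e_def by simp
    have "(\<Sum>j<n. x j powr (2 * s) * R j) + (\<Sum>j<n. \<Sum>k<N. (x j powr s - y k powr s)\<^sup>2 * (c j k)\<^sup>2)
      \<le> (\<Sum>j<n. C * (((x j)\<^sup>2 * d + e) * x j powr p) * R j) +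
        (\<Sum>j<n. \<Sum>k<N. C * (((x j - y k)\<^sup>2 * d + e) * (x j powr p + y k powr p)) * (c j k)\<^sup>2)"
      using t1 t2 R0 by (intro add_mono sum_mono mult_right_mono) auto
    also have "\<dots> = C * ((\<Sum>j<n. x j powr p * (d * ((\<Sum>k<N. (x j - y k)\<^sup>2 * (c j k)\<^sup>2) + (x j)\<^sup>2 * R j)
                          + e * ((\<Sum>k<N. (c j k)\<^sup>2) + R j))) +
        (\<Sum>j<n. \<Sum>k<N. y k powr p * (d * ((x j - y k)\<^sup>2 * (c j k)\<^sup>2) + e * (c j k)\<^sup>2)))"
      by (simp add: algebra_simps sum.distrib sum_distrib_left)
    also have "(\<Sum>j<n. \<Sum>k<N. y k powr p * (d * ((x j - y k)\<^sup>2 * (c j k)\<^sup>2) + e * (c j k)\<^sup>2)) =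
        (\<Sum>k<N. y k powr p * (d * (\<Sum>j<n. (x j - y k)\<^sup>2 * (c j k)\<^sup>2) + e * (\<Sum>j<n. (c j k)\<^sup>2)))"
      by (subst sum.swap) (simp add: algebra_simps sum.distrib sum_distrib_left)
    also have "C * ((\<Sum>j<n. x j powr p * (d * ((\<Sum>k<N. (x j - y k)\<^sup>2 * (c j k)\<^sup>2) + (x j)\<^sup>2 * R j)
                          + e * ((\<Sum>k<N. (c j k)\<^sup>2) + R j))) + \<dots>)
       \<le> C * ((\<Sum>j<n. x j powr p * (d * (A\<^sup>2 * h ^ 4) + e * 1)) + (\<Sum>k<N. y k powr p * (d * (A\<^sup>2 * h ^ 4) + e * 1)))"
      using A1 A2 c2 C0 d0 by (intro mult_left_mono add_mono sum_mono) (auto simp: R_def e_def)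
    also have "\<dots> = C * (((\<Sum>j<n. x j powr p) + (\<Sum>k<N. y k powr p)) * ((A\<^sup>2 + 1) * e))"
      by (simp only: mult_1_right Ae sum_distrib_right[symmetric] distrib_right[symmetric])
    also have "\<dots> \<le> C * ((2 * Q) * ((A\<^sup>2 + 1) * e))"
      using Q1 Q2 C0 assms by (intro mult_left_mono mult_right_mono) (auto simp: e_def)
    finally show "(\<Sum>j<n. x j powr (2 * s) * (1 - (\<Sum>k<N. (c j k)\<^sup>2))) +
      (\<Sum>j<n. \<Sum>k<N. (x j powr s - y k powr s)\<^sup>2 * (c j k)\<^sup>2) \<le> 2 * C * (A\<^sup>2 + 1) * Q * h powr (2 * \<sigma>)"
      by (simp only: R_def e_def mult_ac)
  qed
qed

text \<open>A dyadic version of the formula that writes \<nu>^(-p) as an integral of \<tau>^(-p) /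
  (\<tau> + \<nu>). Up to a constant, \<nu>^(-p) is at most the term at the node \<tau> comparable
  to \<nu>, hence at most the sum over all nodes. Exchanging the sums leaves resolvent traces at the
  nodes, and these form a geometric series.\<close>

lemma sum_powr_bound:
  fixes p c\<^sub>0 t\<^sub>0 C :: real
  assumes "1 / 2 < p" "0 < c\<^sub>0" "0 < t\<^sub>0" "0 \<le> C"
  obtains Q where "\<And>(J :: 'i set) \<nu>. \<lbrakk>finite J; \<And>j. j \<in> J \<Longrightarrow> c\<^sub>0 \<le> \<nu> j;
      \<And>t. t\<^sub>0 \<le> t \<Longrightarrow> (\<Sum>j\<in>J. 1 / (t\<^sup>2 + \<nu> j)) \<le> C / t\<rbrakk> \<Longrightarrow> (\<Sum>j\<in>J. \<nu> j powr (- p)) \<le> Q"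
proof -
  define T where "T = max t\<^sub>0 (2 * sqrt c\<^sub>0)"
  have T0: "0 < T" "t\<^sub>0 \<le> T" using assms unfolding T_def by auto
  have "(2 * sqrt c\<^sub>0)\<^sup>2 \<le> T\<^sup>2"
    unfolding T_def using assms by (intro power_mono) auto
  then have T2: "4 * c\<^sub>0 \<le> T\<^sup>2" using assms by (simp add: power_mult_distrib)
  define \<tau> where "\<tau> m = T\<^sup>2 * 4 ^ m" for m :: nat
  have four: "(4::real) ^ i = 2 ^ i * 2 ^ i" for i by (simp flip: power_mult_distrib)
  have \<tau>0: "0 < \<tau> m" for m using T0 unfolding \<tau>_def by simp
  define K where "K = 2 * (T\<^sup>2 / c\<^sub>0) powr p"
  \<comment> \<open>The ratio of the geometric series: doubling t multiplies t^(2(1-p)) / t by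
    2^(1-2p), which is below 1 because p > 1/2.\<close>
  define w where "w = (2::real) powr (1 - 2 * p)"
  have w: "0 < w" "w < 1" using assms unfolding w_def using powr_less_mono[of "1 - 2 * p" 0 2] by auto
  define Q where "Q = K * (C * (T powr (1 - 2 * p) / (1 - w)))"
  show ?thesis
  proof (rule that[of Q])
    fix J :: "'i set" and \<nu> :: "'i \<Rightarrow> real"
    assume J: "finite J" and \<nu>: "\<And>j. j \<in> J \<Longrightarrow> c\<^sub>0 \<le> \<nu> j"
      and res: "\<And>t. t\<^sub>0 \<le> t \<Longrightarrow> (\<Sum>j\<in>J. 1 / (t\<^sup>2 + \<nu> j)) \<le> C / t"
    have ex: "\<exists>m. c\<^sub>0 * 4 ^ m \<le> \<nu> j \<and> \<nu> j < c\<^sub>0 * 4 ^ Suc m" if j: "j \<in> J" for j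
    proof -
      obtain M where M: "\<nu> j / c\<^sub>0 < 4 ^ M" using real_arch_pow[of 4 "\<nu> j / c\<^sub>0"] by auto
      define M' where "M' = (LEAST M. \<nu> j < c\<^sub>0 * 4 ^ M)"
      have M1: "\<nu> j < c\<^sub>0 * 4 ^ M'"
        unfolding M'_def by (rule LeastI[of _ M]) (use M assms in \<open>simp add: field_simps\<close>)
      have "M' \<noteq> 0" using M1 \<nu>[OF j] by (intro notI) simp
      then obtain m where m: "M' = Suc m" using not0_implies_Suc by blast
      have "\<not> \<nu> j < c\<^sub>0 * 4 ^ m" using not_less_Least[of m "\<lambda>M. \<nu> j < c\<^sub>0 * 4 ^ M"] m M'_def by simp
      with M1 m show ?thesis by (intro exI[of _ m]) (simp add: not_less)
    qed
    then obtain m where m: "\<And>j. j \<in> J \<Longrightarrow> c\<^sub>0 * 4 ^ m j \<le> \<nu> j \<and> \<nu> j < c\<^sub>0 * 4 ^ Suc (m j)"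
      by metis
    define M where "M = Suc (Max (insert 0 (m ` J)))"
    have mM: "m j < M" if "j \<in> J" for j
      using that J unfolding M_def by (simp add: less_Suc_eq_le)
    have "\<nu> j powr (- p) \<le> K * (\<Sum>i<M. \<tau> i powr (1 - p) / (\<tau> i + \<nu> j))" if j: "j \<in> J" for j
    proof -
      let ?t = "\<tau> (m j)"
      have n0: "0 < \<nu> j" using \<nu>[OF j] assms by linarith
      have "?t * c\<^sub>0 \<le> T\<^sup>2 * \<nu> j" using m[OF j] T0 unfolding \<tau>_def by (simp add: mult_ac)
      then have up: "?t \<le> (T\<^sup>2 / c\<^sub>0) * \<nu> j" using assms by (simp add: field_simps)
      have "\<nu> j \<le> 4 * c\<^sub>0 * 4 ^ m j" using m[OF j] by simp
      also have "\<dots> \<le> ?t" using T2 unfolding \<tau>_def by (intro mult_right_mono) auto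
      finally have lo: "\<nu> j \<le> ?t" .
      have "((T\<^sup>2 / c\<^sub>0) * \<nu> j) powr (- p) \<le> ?t powr (- p)"
        using up assms \<tau>0 by (intro powr_mono2') auto
      then have nu: "\<nu> j powr (- p) \<le> (T\<^sup>2 / c\<^sub>0) powr p * ?t powr (- p)"
        using assms T0 n0
        by (subst (asm) powr_mult) (auto simp: powr_minus divide_simps zero_less_divide_iff mult_ac)
      have "?t powr (- p) = 2 * (?t powr (1 - p) / (?t + ?t))"
        using \<tau>0[of "m j"] by (simp add: powr_diff powr_minus field_simps)
      also have "\<dots> \<le> 2 * (?t powr (1 - p) / (?t + \<nu> j))"
        using lo n0 \<tau>0[of "m j"] by (intro mult_left_mono divide_left_mono) auto
      also have "\<dots> \<le> 2 * (\<Sum>i<M. \<tau> i powr (1 - p) / (\<tau> i + \<nu> j))"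
        using mM[OF j] n0 \<tau>0
        by (intro mult_left_mono member_le_sum[of "m j" "{..<M}" "\<lambda>i. \<tau> i powr (1 - p) / (\<tau> i + \<nu> j)"])
          (auto intro!: divide_nonneg_pos add_pos_pos)
      finally have "?t powr (- p) \<le> 2 * (\<Sum>i<M. \<tau> i powr (1 - p) / (\<tau> i + \<nu> j))" .
      from order_trans[OF nu mult_left_mono[OF this]] show ?thesis
        unfolding K_def by (simp add: mult_ac)
    qed
    then have "(\<Sum>j\<in>J. \<nu> j powr (- p)) \<le> (\<Sum>j\<in>J. K * (\<Sum>i<M. \<tau> i powr (1 - p) / (\<tau> i + \<nu> j)))"
      by (rule sum_mono)
    also have "\<dots> = K * (\<Sum>i<M. \<tau> i powr (1 - p) * (\<Sum>j\<in>J. 1 / (\<tau> i + \<nu> j)))"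
      by (simp add: sum_distrib_left sum.swap[of _ _ J])
    also have "\<dots> \<le> K * (\<Sum>i<M. \<tau> i powr (1 - p) * (C / (T * 2 ^ i)))"
    proof -
      have "(\<Sum>j\<in>J. 1 / (\<tau> i + \<nu> j)) \<le> C / (T * 2 ^ i)" for i
      proof -
        have "T * 1 \<le> T * 2 ^ i" using T0 by (intro mult_left_mono) auto
        then have "t\<^sub>0 \<le> T * 2 ^ i" using T0(2) by linarith
        moreover have "(T * 2 ^ i)\<^sup>2 = \<tau> i"
          unfolding \<tau>_def by (simp add: four power2_eq_square)
        ultimately show ?thesis using res[of "T * 2 ^ i"] by simp
      qed
      then show ?thesis unfolding K_def by (intro mult_left_mono sum_mono) auto
    qed
    also have "\<dots> = K * (C * (T powr (1 - 2 * p) * (\<Sum>i<M. w ^ i)))"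
    proof -
      have "\<tau> i powr (1 - p) * (C / (T * 2 ^ i)) = C * (T powr (1 - 2 * p) * w ^ i)" for i
      proof -
        have e: "\<tau> i = (T * 2 ^ i) powr 2"
          using T0 unfolding \<tau>_def by (simp add: four power2_eq_square)
        have "\<tau> i powr (1 - p) / (T * 2 ^ i) = (T * 2 ^ i) powr (2 * (1 - p)) / (T * 2 ^ i) powr 1"
          unfolding e powr_powr using T0 by simp
        also have "\<dots> = (T * 2 ^ i) powr (2 * (1 - p) - 1)" by (simp only: powr_diff)
        also have "\<dots> = (T * 2 ^ i) powr (1 - 2 * p)" by (simp add: algebra_simps)
        also have "\<dots> = T powr (1 - 2 * p) * w ^ i"
          using T0 unfolding w_def
          by (simp add: powr_mult powr_power powr_realpow[symmetric] powr_powr mult.commute)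
        finally have eq: "\<tau> i powr (1 - p) / (T * 2 ^ i) = T powr (1 - 2 * p) * w ^ i" .
        show ?thesis by (simp add: eq[symmetric])
      qed
      then show ?thesis by (simp add: sum_distrib_left)
    qed
    also have "\<dots> \<le> Q"
    proof -
      have "(\<Sum>i<M. w ^ i) \<le> 1 / (1 - w)"
        using w by (simp add: sum_gp_strict field_simps)
      then have "T powr (1 - 2 * p) * (\<Sum>i<M. w ^ i) \<le> T powr (1 - 2 * p) * (1 / (1 - w))"
        by (intro mult_left_mono) auto
      moreover have "0 \<le> K" unfolding K_def by simp
      ultimately show ?thesis
        unfolding Q_def using assms(4) by (intro mult_left_mono) simp_all
    qed
    finally show "(\<Sum>j\<in>J. \<nu> j powr (- p)) \<le> Q" .
  qed
qed

text \<open>Functions are not identified when they agree almost everywhere or on the points of the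
  graph only, so \<open>B f f = 0\<close> does not force \<open>f\<close> to vanish. The locale
  serves the L2 products on an interval, on the graph and on its square, as well as the energy
  form.\<close>

locale semi_inner =
  fixes V :: "('a \<Rightarrow> real) set" and B :: "('a \<Rightarrow> real) \<Rightarrow> ('a \<Rightarrow> real) \<Rightarrow> real"
  assumes zero_mem: "(\<lambda>_. 0) \<in> V"
    and add_mem: "\<lbrakk>f \<in> V; g \<in> V\<rbrakk> \<Longrightarrow> (\<lambda>x. f x + g x) \<in> V"
    and scale_mem: "f \<in> V \<Longrightarrow> (\<lambda>x. c * f x) \<in> V"
    and sym: "\<lbrakk>f \<in> V; g \<in> V\<rbrakk> \<Longrightarrow> B f g = B g f"
    and add_left: "\<lbrakk>f \<in> V; g \<in> V; k \<in> V\<rbrakk> \<Longrightarrow> B (\<lambda>x. f x + g x) k = B f k + B g k"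
    and scale_left: "\<lbrakk>f \<in> V; k \<in> V\<rbrakk> \<Longrightarrow> B (\<lambda>x. c * f x) k = c * B f k"
    and nonneg: "f \<in> V \<Longrightarrow> 0 \<le> B f f"
begin

lemma sum_mem:
  assumes "finite J" "\<And>j. j \<in> J \<Longrightarrow> f j \<in> V"
  shows "(\<lambda>x. \<Sum>j\<in>J. c j * f j x) \<in> V"
  using assms by (induction J rule: finite_induct) (auto simp: zero_mem add_mem scale_mem)

lemma zero_left: "k \<in> V \<Longrightarrow> B (\<lambda>_. 0) k = 0"
  using scale_left[OF zero_mem, of k 0] by simp

lemma sum_left:
  assumes "finite J" "\<And>j. j \<in> J \<Longrightarrow> f j \<in> V" "k \<in> V"
  shows "B (\<lambda>x. \<Sum>j\<in>J. c j * f j x) k = (\<Sum>j\<in>J. c j * B (f j) k)"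
  using assms
  by (induction J rule: finite_induct)
    (auto simp: zero_left add_left scale_left scale_mem sum_mem)

lemma sum_right:
  assumes "finite J" "\<And>j. j \<in> J \<Longrightarrow> f j \<in> V" "k \<in> V"
  shows "B k (\<lambda>x. \<Sum>j\<in>J. c j * f j x) = (\<Sum>j\<in>J. c j * B k (f j))"
  using sum_left[OF assms] assms sym[of k] sum_mem[OF assms(1,2)] by simp

lemma diff_mem: "\<lbrakk>f \<in> V; g \<in> V\<rbrakk> \<Longrightarrow> (\<lambda>x. f x - g x) \<in> V"
  using add_mem[of f "\<lambda>x. (-1) * g x"] scale_mem[of g "-1"] by simp

lemma diff_left: "\<lbrakk>f \<in> V; g \<in> V; k \<in> V\<rbrakk> \<Longrightarrow> B (\<lambda>x. f x - g x) k = B f k - B g k"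
  using add_left[of f "\<lambda>x. (-1) * g x" k] scale_left[of g k "-1"] scale_mem[of g "-1"] by simp

lemma diff_right: "\<lbrakk>f \<in> V; g \<in> V; k \<in> V\<rbrakk> \<Longrightarrow> B k (\<lambda>x. f x - g x) = B k f - B k g"
  using diff_left[of f g k] sym[of k] diff_mem[of f g] by simp

lemma cauchy_schwarz:
  assumes "f \<in> V" "g \<in> V"
  shows "(B f g)\<^sup>2 \<le> B f f * B g g"
proof -
  have q: "0 \<le> B f f - 2 * t * B f g + t\<^sup>2 * B g g" for t
  proof -
    have "0 \<le> B (\<lambda>x. f x - t * g x) (\<lambda>x. f x - t * g x)"
      using assms by (intro nonneg diff_mem scale_mem)
    also have "\<dots> = B f f - 2 * t * B f g + t\<^sup>2 * B g g"
      using assms sym[OF assms(1) scale_mem[OF assms(2), of t]]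
        sym[OF assms(2) scale_mem[OF assms(2), of t]] sym[OF assms(2,1)]
      by (simp add: diff_left diff_right diff_mem scale_mem scale_left power2_eq_square algebra_simps)
    finally show ?thesis .
  qed
  show ?thesis
  \<comment> \<open>In the degenerate case the nonnegative quadratic is affine in t; a nonzero slope
    would allow a t at which its value is -1.\<close>
  proof (cases "B g g = 0")
    case True
    have "B f g = 0"
    proof (rule ccontr)
      assume "B f g \<noteq> 0"
      then have "B f f - 2 * ((B f f + 1) / (2 * B f g)) * B f g = - 1" by (simp add: field_simps)
      with q[of "(B f f + 1) / (2 * B f g)"] True show False by simp
    qed
    then show ?thesis by (simp add: True)
  next
    case False
    then have "0 < B g g" using nonneg[OF assms(2)] by simp
    with q[of "B f g / B g g"] show ?thesis by (simp add: field_simps power2_eq_square)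
  qed
qed

lemma cauchy_schwarz_abs:
  assumes "f \<in> V" "g \<in> V"
  shows "\<bar>B f g\<bar> \<le> sqrt (B f f) * sqrt (B g g)"
  using cauchy_schwarz[OF assms]
  by (metis real_sqrt_abs real_sqrt_le_mono real_sqrt_mult)

lemma triangle:
  assumes "f \<in> V" "g \<in> V"
  shows "sqrt (B (\<lambda>x. f x + g x) (\<lambda>x. f x + g x)) \<le> sqrt (B f f) + sqrt (B g g)"
proof (rule real_le_lsqrt)
  have "B (\<lambda>x. f x + g x) (\<lambda>x. f x + g x) = B f f + 2 * B f g + B g g"
    using assms sym[OF assms(1) add_mem[OF assms]] sym[OF assms(2) add_mem[OF assms]] sym[OF assms(2,1)]
    by (simp add: add_left add_mem)
  also have "\<dots> \<le> (sqrt (B f f) + sqrt (B g g))\<^sup>2"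
    using cauchy_schwarz_abs[OF assms] nonneg[OF assms(1)] nonneg[OF assms(2)]
    by (simp add: power2_sum)
  finally show "B (\<lambda>x. f x + g x) (\<lambda>x. f x + g x) \<le> (sqrt (B f f) + sqrt (B g g))\<^sup>2" .
qed (use nonneg assms in auto)

end

section \<open>Sobolev functions on an interval\<close>

lemma mult_integrable_of_squares:
  fixes f g :: "'a \<Rightarrow> real"
  assumes "f \<in> l2_space M" "g \<in> l2_space M"
  shows "integrable M (\<lambda>x. f x * g x)"
proof (rule Bochner_Integration.integrable_bound)
  show "integrable M (\<lambda>x. (f x)\<^sup>2 + (g x)\<^sup>2)"
    using assms unfolding l2_space_def by auto
  show "(\<lambda>x. f x * g x) \<in> borel_measurable M"
    using assms unfolding l2_space_def by auto
  show "AE x in M. norm (f x * g x) \<le> norm ((f x)\<^sup>2 + (g x)\<^sup>2)"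
  proof (rule AE_I2)
    fix x
    have "2 * \<bar>f x * g x\<bar> \<le> (f x)\<^sup>2 + (g x)\<^sup>2"
      using sum_squares_bound[of "\<bar>f x\<bar>" "\<bar>g x\<bar>"] by (simp add: abs_mult)
    then show "norm (f x * g x) \<le> norm ((f x)\<^sup>2 + (g x)\<^sup>2)" by simp
  qed
qed

lemma l2_semi_inner: "semi_inner (l2_space M) (l2_inner M)"
proof
  fix f g k :: "'a \<Rightarrow> real" and c :: real
  show "(\<lambda>_. 0) \<in> l2_space M" unfolding l2_space_def by simp
  show "(\<lambda>x. f x + g x) \<in> l2_space M" if "f \<in> l2_space M" "g \<in> l2_space M"
    using that mult_integrable_of_squares[OF that] unfolding l2_space_def
    by (auto simp: power2_sum mult.assoc)
  show "(\<lambda>x. c * f x) \<in> l2_space M" if "f \<in> l2_space M"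
    using that unfolding l2_space_def by (auto simp: power_mult_distrib)
  show "l2_inner M f g = l2_inner M g f" unfolding l2_inner_def by (simp add: mult.commute)
  show "l2_inner M (\<lambda>x. f x + g x) k = l2_inner M f k + l2_inner M g k"
    if "f \<in> l2_space M" "g \<in> l2_space M" "k \<in> l2_space M"
    using mult_integrable_of_squares[OF that(1,3)] mult_integrable_of_squares[OF that(2,3)]
    unfolding l2_inner_def by (simp add: distrib_right)
  show "l2_inner M (\<lambda>x. c * f x) k = c * l2_inner M f k"
    unfolding l2_inner_def by (simp add: mult.assoc)
  show "0 \<le> l2_inner M f f" unfolding l2_inner_def by (intro integral_nonneg_AE) auto
qed

lemma l2_norm_eq: "l2_norm M f = sqrt (l2_inner M f f)"
  unfolding l2_norm_def l2_inner_def by (simp add: power2_eq_square)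

lemma (in finite_measure) l2_space_integrable:
  assumes "f \<in> l2_space M"
  shows "integrable M f"
proof -
  have "(\<lambda>_. 1 :: real) \<in> l2_space M" unfolding l2_space_def by simp
  from mult_integrable_of_squares[OF assms this] show ?thesis by simp
qed

lemma (in finite_measure) bounded_l2_space:
  fixes f :: "'a \<Rightarrow> real"
  assumes "f \<in> borel_measurable M" "AE x in M. \<bar>f x\<bar> \<le> K"
  shows "f \<in> l2_space M"
proof -
  have "integrable M (\<lambda>x. (f x)\<^sup>2)"
  proof (rule integrable_const_bound[of _ "K\<^sup>2"])
    show "AE x in M. norm ((f x)\<^sup>2) \<le> K\<^sup>2"
      using assms(2) by eventually_elim (simp add: abs_le_square_iff[symmetric])
  qed (use assms in measurable)
  with assms show ?thesis unfolding l2_space_def by simp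
qed

lemma l2_space_mult_bounded:
  fixes f g :: "'a \<Rightarrow> real"
  assumes "f \<in> borel_measurable M" "AE x in M. \<bar>f x\<bar> \<le> K" "g \<in> l2_space M"
  shows "(\<lambda>x. f x * g x) \<in> l2_space M"
proof -
  have "integrable M (\<lambda>x. (f x * g x)\<^sup>2)"
  proof (rule Bochner_Integration.integrable_bound)
    show "integrable M (\<lambda>x. K\<^sup>2 * (g x)\<^sup>2)" using assms unfolding l2_space_def by auto
    show "(\<lambda>x. (f x * g x)\<^sup>2) \<in> borel_measurable M"
      using assms unfolding l2_space_def by auto
    show "AE x in M. norm ((f x * g x)\<^sup>2) \<le> norm (K\<^sup>2 * (g x)\<^sup>2)"
      using assms(2)
    proof eventually_elim
      case (elim x)
      then have "(f x)\<^sup>2 \<le> K\<^sup>2" by (simp add: abs_le_square_iff[symmetric])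
      then show ?case by (simp add: power_mult_distrib mult_right_mono)
    qed
  qed
  with assms show ?thesis unfolding l2_space_def by auto
qed

section \<open>Lebesgue measure on a compact interval\<close>

abbreviation ivl :: "real \<Rightarrow> real \<Rightarrow> real measure" where
  "ivl c d \<equiv> restrict_space lborel {c..d}"

lemma set_borel_measurable_ivl:
  "set_borel_measurable lborel {c..d} g \<longleftrightarrow> g \<in> borel_measurable (ivl c d)"
  for g :: "real \<Rightarrow> real"
  unfolding set_borel_measurable_def
  by (subst borel_measurable_restrict_space_iff) (auto simp: mult.commute)

lemma set_integrable_ivl: "set_integrable lborel {c..d} g \<longleftrightarrow> integrable (ivl c d) g"
  for g :: "real \<Rightarrow> real"
  unfolding set_integrable_def by (subst integrable_restrict_space) auto

lemma set_integral_ivl: "(LBINT x:{c..d}. g x) = (\<integral>x. g x \<partial>ivl c d)"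
  for g :: "real \<Rightarrow> real"
  unfolding set_lebesgue_integral_def by (subst integral_restrict_space) auto

lemma finite_measure_ivl: "finite_measure (ivl c d)"
  by (rule finite_measureI) (simp add: emeasure_restrict_space space_restrict_space emeasure_lborel_Icc_eq)

lemma space_ivl [simp]: "space (ivl c d) = {c..d}"
  by (simp add: space_restrict_space)

lemma AE_ivl: "(AE x in ivl c d. P x) \<longleftrightarrow> (AE x in lborel. x \<in> {c..d} \<longrightarrow> P x)"
  by (rule AE_restrict_space_iff) auto

lemma measure_ivl: "c \<le> d \<Longrightarrow> measure (ivl c d) {c..d} = d - c"
  by (simp add: measure_restrict_space)

lemma integrable_ivl_sub:
  fixes f :: "real \<Rightarrow> real"
  assumes "integrable (ivl c d) f" "c \<le> c'" "d' \<le> d"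
  shows "integrable (ivl c' d') f"
  using set_integrable_subset[of lborel "{c..d}" f "{c'..d'}"] assms
  by (simp add: set_integrable_ivl)

lemma measurable_ivl_sub:
  fixes f :: "real \<Rightarrow> real"
  assumes "f \<in> borel_measurable (ivl c d)" "c \<le> c'" "d' \<le> d"
  shows "f \<in> borel_measurable (ivl c' d')"
  using set_borel_measurable_subset[of lborel "{c..d}" f "{c'..d'}"] assms
  by (simp add: set_borel_measurable_ivl)

lemma l2_space_ivl_sub:
  assumes "f \<in> l2_space (ivl c d)" "c \<le> c'" "d' \<le> d"
  shows "f \<in> l2_space (ivl c' d')"
proof -
  have "f \<in> borel_measurable (ivl c d)" "integrable (ivl c d) (\<lambda>x. (f x)\<^sup>2)"
    using assms(1) unfolding l2_space_def by auto
  from measurable_ivl_sub[OF this(1) assms(2,3)] integrable_ivl_sub[OF this(2) assms(2,3)]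
  show ?thesis unfolding l2_space_def by blast
qed

lemma AE_ivl_sub:
  assumes "AE x in ivl c d. P x" "c \<le> c'" "d' \<le> d"
  shows "AE x in ivl c' d'. P x"
  using assms unfolding AE_ivl by (auto elim!: eventually_mono)

lemma integral_ivl_sub:
  fixes f :: "real \<Rightarrow> real"
  assumes "c \<le> c'" "d' \<le> d"
  shows "(\<integral>x. f x \<partial>ivl c' d') = (\<integral>x. indicator {c'..d'} x * f x \<partial>ivl c d)"
proof -
  have "(indicator {c..d} x *\<^sub>R (indicator {c'..d'} x * f x) :: real) = indicator {c'..d'} x *\<^sub>R f x" for x
    using assms by (auto simp: indicator_def)
  then have "(\<integral>x. indicator {c..d} x *\<^sub>R (indicator {c'..d'} x * f x) \<partial>lborel) =
      (\<integral>x. indicator {c'..d'} x *\<^sub>R f x \<partial>lborel)"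
    by (intro Bochner_Integration.integral_cong refl)
  then show ?thesis by (simp add: integral_restrict_space)
qed

lemma integral_ivl_split:
  fixes f :: "real \<Rightarrow> real"
  assumes "integrable (ivl a c) f" "a \<le> b" "b \<le> c"
  shows "(\<integral>x. f x \<partial>ivl a c) = (\<integral>x. f x \<partial>ivl a b) + (\<integral>x. f x \<partial>ivl b c)"
proof -
  have "(LBINT x:{a..b} \<union> {b..c}. f x) = (LBINT x:{a..b}. f x) + (LBINT x:{b..c}. f x)"
  proof (rule set_integral_Un_AE)
    show "AE x in lborel. \<not> (x \<in> {a..b} \<and> x \<in> {b..c})"
      using AE_lborel_singleton[of b] by eventually_elim auto
  qed (use assms integrable_ivl_sub in \<open>auto simp: set_integrable_ivl\<close>)
  moreover have "{a..b} \<union> {b..c} = {a..c}" using assms by auto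
  ultimately show ?thesis by (simp add: set_integral_ivl)
qed

lemma integral_ivl_mono_set:
  fixes f :: "real \<Rightarrow> real"
  assumes "integrable (ivl c d) f" "c \<le> c'" "d' \<le> d" "\<And>x. 0 \<le> f x"
  shows "(\<integral>x. f x \<partial>ivl c' d') \<le> (\<integral>x. f x \<partial>ivl c d)"
  unfolding integral_ivl_sub[OF assms(2,3)]
proof (rule integral_mono_AE)
  show "integrable (ivl c d) (\<lambda>x. indicator {c'..d'} x * f x)"
    using integrable_mult_indicator[of "{c'..d'}" "ivl c d" f] assms
    by (simp add: sets_restrict_space_iff)
  show "AE x in ivl c d. indicator {c'..d'} x * f x \<le> f x"
    using assms(4) by (intro AE_I2) (auto simp: indicator_def)
qed fact

lemma integral_ivl_singleton: "(\<integral>x. f x \<partial>ivl c c) = (0 :: real)"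
proof (rule integral_eq_zero_AE)
  show "AE x in ivl c c. f x = 0"
    unfolding AE_ivl using AE_lborel_singleton[of c] by eventually_elim auto
qed

text \<open>A vanishing primitive makes the integral vanish over all intervals, hence over all Borel
  sets, which form the generated sigma-algebra. This is the source of the uniqueness of weak
  derivatives.\<close>

lemma integral_ivl_eq_zero_imp_AE:
  fixes f :: "real \<Rightarrow> real"
  assumes f: "integrable (ivl c d) f"
    and zero: "\<And>x. x \<in> {c..d} \<Longrightarrow> (\<integral>y. f y \<partial>ivl c x) = 0"
  shows "AE x in ivl c d. f x = 0"
proof -
  define g where "g x = indicator {c..d} x * f x" for x
  have g: "integrable lborel g"
    using f unfolding g_def by (simp add: integrable_restrict_space)
  have sub: "(LBINT x:{a..b}. g x) = 0" for a b
  proof (cases "max a c \<le> min b d")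
    case True
    let ?a = "max a c" and ?b = "min b d"
    have "(LBINT x:{a..b}. g x) = (\<integral>x. f x \<partial>ivl ?a ?b)"
      unfolding g_def set_integral_ivl[symmetric] set_lebesgue_integral_def
      by (intro Bochner_Integration.integral_cong) (auto simp: indicator_def)
    also have "\<dots> = 0"
      using integral_ivl_split[of c ?b f ?a] integrable_ivl_sub[OF f, of c ?b] True zero[of ?a] zero[of ?b]
      by simp
    finally show ?thesis .
  next
    case False
    then have "indicator {a..b} x *\<^sub>R g x = 0" for x
      unfolding g_def by (auto simp: indicator_def)
    then show ?thesis unfolding set_lebesgue_integral_def by (simp only: integral_zero)
  qed
  have cg: "integrable lborel (\<lambda>x. indicator A x *\<^sub>R g x)" if "A \<in> sets borel" for A
    using integrable_mult_indicator[OF _ g, of A] that by simp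
  have "(\<integral>x. g x \<partial>lborel) = (LBINT x:{c..d}. g x)"
    unfolding set_lebesgue_integral_def g_def
    by (intro Bochner_Integration.integral_cong) (auto simp: indicator_def)
  then have tot: "(\<integral>x. g x \<partial>lborel) = 0" using sub by simp
  have "(LBINT x:A. g x) = 0" if "A \<in> sets borel" for A
    using that
  proof (induction rule: borel_set_induct)
    case empty
    then show ?case by (simp add: set_lebesgue_integral_def)
  next
    case (interval a b)
    then show ?case using sub by simp
  next
    case (compl A)
    have "(\<integral>x. g x \<partial>lborel) = (\<integral>x. indicator A x *\<^sub>R g x + indicator (- A) x *\<^sub>R g x \<partial>lborel)"
      by (intro Bochner_Integration.integral_cong) (auto simp: indicator_def)
    also have "\<dots> = (LBINT x:A. g x) + (LBINT x:- A. g x)"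
      unfolding set_lebesgue_integral_def
      using cg compl.hyps by (intro Bochner_Integration.integral_add) auto
    finally show ?case using tot compl.IH by simp
  next
    case (union A)
    have "(LBINT x:(\<Union>i. A i). g x) = (\<Sum>i. (LBINT x:A i. g x))"
    proof (rule lebesgue_integral_countable_add)
      show "set_integrable lborel (\<Union>i. A i) g"
        unfolding set_integrable_def using union by (intro cg) auto
      show "A i \<inter> A j = {}" if "i \<noteq> j" for i j
        using union.hyps(1) that by (auto simp: disjoint_family_on_def)
    qed (use union in auto)
    then show ?case using union.IH by simp
  qed
  then have "AE x in lborel. g x = 0" by (intro sigma_finite_measure.density_zero[OF lborel.sigma_finite_measure_axioms g]) auto
  then show ?thesis unfolding AE_ivl by eventually_elim (auto simp: g_def)
qed

section \<open>Weak derivatives and their calculus\<close>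

lemma has_weak_deriv_iff:
  "has_weak_deriv l f g \<longleftrightarrow>
     g \<in> l2_space (ivl 0 l) \<and> (\<forall>x\<in>{0..l}. f x = f 0 + (\<integral>y. g y \<partial>ivl 0 x))"
  unfolding has_weak_deriv_def l2_space_def set_borel_measurable_ivl set_integrable_ivl
    set_integral_ivl by auto

lemma has_weak_deriv_l2: "has_weak_deriv l f g \<Longrightarrow> g \<in> l2_space (ivl 0 l)"
  by (simp add: has_weak_deriv_iff)

lemma has_weak_deriv_eq:
  "has_weak_deriv l f g \<Longrightarrow> x \<in> {0..l} \<Longrightarrow> f x = f 0 + (\<integral>y. g y \<partial>ivl 0 x)"
  unfolding has_weak_deriv_iff by blast

lemma has_weak_deriv_integrable:
  assumes "has_weak_deriv l f g" "0 \<le> c" "d \<le> l"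
  shows "integrable (ivl c d) g"
  by (rule finite_measure.l2_space_integrable[OF finite_measure_ivl
        l2_space_ivl_sub[OF has_weak_deriv_l2[OF assms(1)] assms(2,3)]])

lemma has_weak_deriv_diff_eq:
  assumes "has_weak_deriv l f g" "0 \<le> c" "c \<le> d" "d \<le> l"
  shows "f d - f c = (\<integral>y. g y \<partial>ivl c d)"
proof -
  have "f d = f 0 + (\<integral>y. g y \<partial>ivl 0 d)" "f c = f 0 + (\<integral>y. g y \<partial>ivl 0 c)"
    using assms by (auto intro: has_weak_deriv_eq[OF assms(1)])
  then show ?thesis
    using integral_ivl_split[of 0 d g c] has_weak_deriv_integrable[OF assms(1)] assms by simp
qed

lemma has_weak_deriv_lincomb:
  assumes "has_weak_deriv l f f'" "has_weak_deriv l g g'"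
  shows "has_weak_deriv l (\<lambda>x. r * f x + s * g x) (\<lambda>x. r * f' x + s * g' x)"
proof -
  interpret semi_inner "l2_space (ivl 0 l)" "l2_inner (ivl 0 l)" by (rule l2_semi_inner)
  have "r * f x + s * g x = r * f 0 + s * g 0 + (\<integral>y. r * f' y + s * g' y \<partial>ivl 0 x)"
    if "x \<in> {0..l}" for x
  proof -
    have "(\<integral>y. r * f' y + s * g' y \<partial>ivl 0 x) = r * (\<integral>y. f' y \<partial>ivl 0 x) + s * (\<integral>y. g' y \<partial>ivl 0 x)"
      using has_weak_deriv_integrable[OF assms(1), of 0 x] has_weak_deriv_integrable[OF assms(2), of 0 x] that
      by simp
    moreover have "f x = f 0 + (\<integral>y. f' y \<partial>ivl 0 x)" "g x = g 0 + (\<integral>y. g' y \<partial>ivl 0 x)"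
      using that by (auto intro: has_weak_deriv_eq[OF assms(1)] has_weak_deriv_eq[OF assms(2)])
    ultimately show ?thesis by (simp add: algebra_simps)
  qed
  moreover have "(\<lambda>x. r * f' x + s * g' x) \<in> l2_space (ivl 0 l)"
    using has_weak_deriv_l2[OF assms(1)] has_weak_deriv_l2[OF assms(2)]
    by (intro add_mem scale_mem)
  ultimately show ?thesis unfolding has_weak_deriv_iff by blast
qed

lemma has_weak_deriv_const: "has_weak_deriv l (\<lambda>_. c) (\<lambda>_. 0)"
  unfolding has_weak_deriv_iff l2_space_def by simp

lemma has_weak_deriv_cong:
  assumes "has_weak_deriv l f g" "0 \<le> l" "\<And>x. x \<in> {0..l} \<Longrightarrow> f x = f' x"
  shows "has_weak_deriv l f' g"
  using assms unfolding has_weak_deriv_iff by (metis atLeastAtMost_iff order_refl)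

lemma has_weak_deriv_unique:
  assumes "has_weak_deriv l f g" "has_weak_deriv l f g'"
  shows "AE x in ivl 0 l. g x = g' x"
proof -
  have "AE x in ivl 0 l. g x - g' x = 0"
  proof (rule integral_ivl_eq_zero_imp_AE)
    show "integrable (ivl 0 l) (\<lambda>x. g x - g' x)"
      using has_weak_deriv_integrable[OF assms(1), of 0 l] has_weak_deriv_integrable[OF assms(2), of 0 l]
      by simp
    show "(\<integral>y. g y - g' y \<partial>ivl 0 x) = 0" if "x \<in> {0..l}" for x
      using has_weak_deriv_integrable[OF assms(1), of 0 x] has_weak_deriv_integrable[OF assms(2), of 0 x]
        has_weak_deriv_diff_eq[OF assms(1), of 0 x] has_weak_deriv_diff_eq[OF assms(2), of 0 x] that
      by simp
  qed
  then show ?thesis by eventually_elim simp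
qed

lemma weak_deriv_AE:
  assumes "has_weak_deriv l f g"
  shows "has_weak_deriv l f (weak_deriv l f)" "AE x in ivl 0 l. weak_deriv l f x = g x"
proof -
  show 1: "has_weak_deriv l f (weak_deriv l f)"
    unfolding weak_deriv_def by (rule someI[where P = "has_weak_deriv l f", OF assms])
  show "AE x in ivl 0 l. weak_deriv l f x = g x"
    by (rule has_weak_deriv_unique[OF 1 assms])
qed

lemma integral_square_diff_bound:
  assumes "has_weak_deriv l f g" "0 \<le> c" "c \<le> d" "d \<le> l"
  shows "(f d - f c)\<^sup>2 \<le> (d - c) * (\<integral>x. (g x)\<^sup>2 \<partial>ivl c d)"
proof -
  interpret semi_inner "l2_space (ivl c d)" "l2_inner (ivl c d)" by (rule l2_semi_inner)
  interpret finite_measure "ivl c d" by (rule finite_measure_ivl)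
  have "g \<in> l2_space (ivl c d)" using assms has_weak_deriv_l2 l2_space_ivl_sub by blast
  moreover have "(\<lambda>_. 1) \<in> l2_space (ivl c d)" unfolding l2_space_def by simp
  ultimately have "(l2_inner (ivl c d) (\<lambda>_. 1) g)\<^sup>2 \<le>
      l2_inner (ivl c d) (\<lambda>_. 1) (\<lambda>_. 1) * l2_inner (ivl c d) g g"
    by (intro cauchy_schwarz)
  then show ?thesis
    unfolding l2_inner_def has_weak_deriv_diff_eq[OF assms]
    using assms by (simp add: measure_ivl power2_eq_square)
qed

text \<open>Hoelder continuity of order 1/2. The energy is taken over an arbitrary window [c, d] so
  that the estimates derived from it can be used on single mesh cells and on short pieces of an
  edge.\<close>

lemma abs_diff_bound:
  assumes "has_weak_deriv l f g" "0 \<le> c" "d \<le> l" "x \<in> {c..d}" "y \<in> {c..d}"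
  shows "(f x - f y)\<^sup>2 \<le> \<bar>x - y\<bar> * (\<integral>x. (g x)\<^sup>2 \<partial>ivl c d)"
proof -
  have *: "(f x - f y)\<^sup>2 \<le> \<bar>x - y\<bar> * (\<integral>x. (g x)\<^sup>2 \<partial>ivl c d)"
    if "x \<in> {c..d}" "y \<in> {c..d}" "y \<le> x" for x y
  proof -
    have i: "integrable (ivl c d) (\<lambda>x. (g x)\<^sup>2)"
      using has_weak_deriv_l2[OF assms(1)] assms integrable_ivl_sub unfolding l2_space_def by blast
    have "(f x - f y)\<^sup>2 \<le> (x - y) * (\<integral>x. (g x)\<^sup>2 \<partial>ivl y x)"
      using that assms by (intro integral_square_diff_bound[OF assms(1)]) auto
    also have "\<dots> \<le> (x - y) * (\<integral>x. (g x)\<^sup>2 \<partial>ivl c d)"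
      using that i by (intro mult_left_mono integral_ivl_mono_set) auto
    finally show ?thesis using that by simp
  qed
  show ?thesis
    using *[of x y] *[of y x] assms by (cases "y \<le> x") (auto simp: power2_commute abs_minus_commute)
qed

lemma has_weak_deriv_continuous:
  assumes "has_weak_deriv l f g"
  shows "continuous_on {0..l} f"
proof -
  define B where "B = (\<integral>x. (g x)\<^sup>2 \<partial>ivl 0 l)"
  have B: "0 \<le> B" unfolding B_def by (intro integral_nonneg_AE) auto
  show ?thesis
  proof (subst continuous_on_iff, intro ballI allI impI)
    fix x \<epsilon> :: real
    assume x: "x \<in> {0..l}" and \<epsilon>: "0 < \<epsilon>"
    show "\<exists>\<delta>>0. \<forall>y\<in>{0..l}. dist y x < \<delta> \<longrightarrow> dist (f y) (f x) < \<epsilon>"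
    proof (intro exI[of _ "\<epsilon>\<^sup>2 / (B + 1)"] conjI ballI impI)
      show "0 < \<epsilon>\<^sup>2 / (B + 1)" using \<epsilon> B by simp
      fix y assume y: "y \<in> {0..l}" "dist y x < \<epsilon>\<^sup>2 / (B + 1)"
      have "(f y - f x)\<^sup>2 \<le> \<bar>y - x\<bar> * B"
        using abs_diff_bound[OF assms, of 0 l y x] x y unfolding B_def by simp
      also have "\<dots> \<le> \<bar>y - x\<bar> * (B + 1)" by (intro mult_left_mono) auto
      also have "\<dots> < \<epsilon>\<^sup>2" using y B by (simp add: dist_real_def field_simps)
      finally have "\<bar>f y - f x\<bar>\<^sup>2 < \<epsilon>\<^sup>2" by simp
      then show "dist (f y) (f x) < \<epsilon>"
        using power_less_imp_less_base[of "\<bar>f y - f x\<bar>" 2 \<epsilon>] \<epsilon> by (simp add: dist_real_def)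
    qed
  qed
qed


lemma has_weak_deriv_vector_derivative:
  assumes "has_weak_deriv l f g" "continuous_on {0..l} g" "x \<in> {0..l}"
  shows "(f has_vector_derivative g x) (at x within {0..l})"
proof -
  have "((\<lambda>u. integral {0..u} g) has_vector_derivative g x) (at x within {0..l})"
    using assms by (intro integral_has_vector_derivative) auto
  then have "((\<lambda>u. f 0 + integral {0..u} g) has_vector_derivative g x) (at x within {0..l})"
    by (auto intro!: derivative_eq_intros)
  then show ?thesis
  proof (rule has_vector_derivative_transform[rotated 2])
    fix u assume u: "u \<in> {0..l}"
    have "set_integrable lborel {0..u} g"
      using has_weak_deriv_integrable[OF assms(1), of 0 u] u by (simp add: set_integrable_ivl)
    from set_borel_integral_eq_integral(2)[OF this]
    have "(\<integral>y. g y \<partial>ivl 0 u) = integral {0..u} g" by (simp add: set_integral_ivl)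
    with has_weak_deriv_eq[OF assms(1) u] show "f u = f 0 + integral {0..u} g" by (rule subst[rotated])
  qed (use assms in auto)
qed

lemma continuous_ivl_bounded_measurable:
  fixes f :: "real \<Rightarrow> real"
  assumes "continuous_on {0..l} f"
  obtains K where "f \<in> borel_measurable (ivl 0 l)" "\<And>x. x \<in> {0..l} \<Longrightarrow> \<bar>f x\<bar> \<le> K"
proof -
  have "bounded (f ` {0..l})"
    by (intro compact_imp_bounded compact_continuous_image assms) auto
  then obtain K where "\<And>x. x \<in> {0..l} \<Longrightarrow> \<bar>f x\<bar> \<le> K"
    unfolding bounded_iff by (metis imageI real_norm_def)
  moreover have "f \<in> borel_measurable (ivl 0 l)"
    using borel_measurable_continuous_on_restrict[OF assms]
    by (simp add: measurable_def space_restrict_space sets_restrict_space)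
  ultimately show ?thesis using that by blast
qed

lemma continuous_ivl_l2:
  fixes f :: "real \<Rightarrow> real"
  assumes "continuous_on {0..l} f"
  shows "f \<in> l2_space (ivl 0 l)"
proof -
  obtain K where "f \<in> borel_measurable (ivl 0 l)" "\<And>x. x \<in> {0..l} \<Longrightarrow> \<bar>f x\<bar> \<le> K"
    using continuous_ivl_bounded_measurable[OF assms] by blast
  then show ?thesis
    by (intro finite_measure.bounded_l2_space[OF finite_measure_ivl, of _ _ _ K]) auto
qed

lemma continuous_ivl_mult_l2:
  fixes f :: "real \<Rightarrow> real"
  assumes "continuous_on {0..l} f" "g \<in> l2_space (ivl 0 l)"
  shows "(\<lambda>x. f x * g x) \<in> l2_space (ivl 0 l)"
proof -
  obtain K where "f \<in> borel_measurable (ivl 0 l)" "\<And>x. x \<in> {0..l} \<Longrightarrow> \<bar>f x\<bar> \<le> K"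
    using continuous_ivl_bounded_measurable[OF assms(1)] by blast
  then show ?thesis
    by (intro l2_space_mult_bounded[of _ _ K] assms(2)) auto
qed

text \<open>Fubini on the triangle y \<le> x applied to F(y) G(x): integrating over y first gives
  (f(x) - f(0)) G(x), over x first gives F(y) (g(l) - g(y)).\<close>

lemma integration_by_parts_ivl:
  assumes F: "has_weak_deriv l f F" and G: "has_weak_deriv l g G" and l: "0 \<le> l"
  shows "(\<integral>x. f x * G x + F x * g x \<partial>ivl 0 l) = f l * g l - f 0 * g 0"
proof -
  let ?M = "ivl 0 l"
  interpret finite_measure ?M by (rule finite_measure_ivl)
  interpret pair_sigma_finite ?M ?M ..
  have iF: "integrable ?M F" and iG: "integrable ?M G"
    using has_weak_deriv_integrable F G by auto
  have [measurable]: "F \<in> borel_measurable ?M" "G \<in> borel_measurable ?M"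
    using iF iG by auto
  have fG: "integrable ?M (\<lambda>x. f x * G x)" and Fg: "integrable ?M (\<lambda>x. F x * g x)"
    using mult_integrable_of_squares continuous_ivl_l2 has_weak_deriv_continuous has_weak_deriv_l2 F G
    by blast+
  define K where "K x y = indicator {y..} x * F y * G x" for x y :: real
  have "integrable (?M \<Otimes>\<^sub>M ?M) (case_prod K)"
  proof (rule Bochner_Integration.integrable_bound)
    show "integrable (?M \<Otimes>\<^sub>M ?M) (\<lambda>(x, y). G x * F y)"
      using iF iG by (intro Fubini_integrable) (auto simp: abs_mult)
    have id: "(\<lambda>x. x) \<in> borel_measurable ?M" by (rule measurable_restrict_space1) simp
    note fst' = measurable_compose[OF measurable_fst] and snd' = measurable_compose[OF measurable_snd]
    have "(\<lambda>z. if snd z \<le> fst z then F (snd z) * G (fst z) else 0) \<in> borel_measurable (?M \<Otimes>\<^sub>M ?M)"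
      by (intro measurable_If borel_measurable_times borel_measurable_const
          fst'[OF borel_measurable_integrable[OF iG]] snd'[OF borel_measurable_integrable[OF iF]]
          borel_measurable_le[OF snd'[OF id] fst'[OF id]])
    moreover have "case_prod K = (\<lambda>z. if snd z \<le> fst z then F (snd z) * G (fst z) else 0)"
      by (auto simp: K_def indicator_def)
    ultimately show "case_prod K \<in> borel_measurable (?M \<Otimes>\<^sub>M ?M)" by simp
    show "AE z in ?M \<Otimes>\<^sub>M ?M. norm (case_prod K z) \<le> norm (case z of (x, y) \<Rightarrow> G x * F y)"
      by (intro AE_I2) (auto simp: K_def indicator_def abs_mult)
  qed
  then have swap: "(\<integral>y. (\<integral>x. K x y \<partial>?M) \<partial>?M) = (\<integral>x. (\<integral>y. K x y \<partial>?M) \<partial>?M)"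
    by (rule Fubini_integral)
  have "(\<integral>y. K x y \<partial>?M) = (f x - f 0) * G x" if x: "x \<in> {0..l}" for x
  proof -
    have "(\<integral>y. K x y \<partial>?M) = (\<integral>y. indicator {0..x} y * F y \<partial>?M) * G x"
    proof -
      have "(\<integral>y. K x y \<partial>?M) = (\<integral>y. (indicator {0..x} y * F y) * G x \<partial>?M)"
        by (intro Bochner_Integration.integral_cong) (auto simp: K_def indicator_def)
      then show ?thesis by (simp only: integral_mult_left_zero)
    qed
    also have "(\<integral>y. indicator {0..x} y * F y \<partial>?M) = f x - f 0"
      using has_weak_deriv_diff_eq[OF F, of 0 x] x by (simp add: integral_ivl_sub[of 0 0 x l])
    finally show ?thesis .
  qed
  then have 1: "(\<integral>x. (\<integral>y. K x y \<partial>?M) \<partial>?M) = (\<integral>x. (f x - f 0) * G x \<partial>?M)"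
    by (intro Bochner_Integration.integral_cong) auto
  have "(\<integral>x. K x y \<partial>?M) = F y * (g l - g y)" if y: "y \<in> {0..l}" for y
  proof -
    have "(\<integral>x. K x y \<partial>?M) = F y * (\<integral>x. indicator {y..l} x * G x \<partial>?M)"
    proof -
      have "(\<integral>x. K x y \<partial>?M) = (\<integral>x. F y * (indicator {y..l} x * G x) \<partial>?M)"
        by (intro Bochner_Integration.integral_cong) (auto simp: K_def indicator_def)
      then show ?thesis by (simp only: integral_mult_right_zero)
    qed
    also have "(\<integral>x. indicator {y..l} x * G x \<partial>?M) = g l - g y"
      using has_weak_deriv_diff_eq[OF G, of y l] y by (simp add: integral_ivl_sub[of 0 y l l])
    finally show ?thesis .
  qed
  then have 2: "(\<integral>y. (\<integral>x. K x y \<partial>?M) \<partial>?M) = (\<integral>y. F y * (g l - g y) \<partial>?M)"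
    by (intro Bochner_Integration.integral_cong) auto
  define P Q where "P = (\<integral>x. f x * G x \<partial>?M)" and "Q = (\<integral>x. F x * g x \<partial>?M)"
  have "(\<integral>x. (f x - f 0) * G x \<partial>?M) = P - f 0 * (\<integral>x. G x \<partial>?M)"
    using fG iG by (simp add: left_diff_distrib P_def)
  moreover have "(\<integral>y. F y * (g l - g y) \<partial>?M) = (\<integral>x. F x \<partial>?M) * g l - Q"
    using Fg iF by (simp add: right_diff_distrib Q_def)
  moreover have I: "(\<integral>x. F x \<partial>?M) = f l - f 0" "(\<integral>x. G x \<partial>?M) = g l - g 0"
    using has_weak_deriv_diff_eq[OF F, of 0 l] has_weak_deriv_diff_eq[OF G, of 0 l] l by auto
  ultimately have "P - f 0 * (g l - g 0) = (f l - f 0) * g l - Q"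
    using swap 1 2 by simp
  then have "P + Q = f l * g l - f 0 * g 0" by (simp add: algebra_simps)
  moreover have "(\<integral>x. f x * G x + F x * g x \<partial>?M) = P + Q"
    using fG Fg unfolding P_def Q_def by (rule Bochner_Integration.integral_add)
  ultimately show ?thesis by simp
qed

lemma has_weak_deriv_restrict:
  assumes "has_weak_deriv l f g" "m \<le> l"
  shows "has_weak_deriv m f g"
  unfolding has_weak_deriv_iff
proof (intro conjI ballI)
  show "g \<in> l2_space (ivl 0 m)"
    using assms by (intro l2_space_ivl_sub[OF has_weak_deriv_l2[OF assms(1)]]) auto
  show "f x = f 0 + (\<integral>y. g y \<partial>ivl 0 x)" if "x \<in> {0..m}" for x
    using assms(2) that by (intro has_weak_deriv_eq[OF assms(1)]) auto
qed

lemma has_weak_deriv_mult: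
  assumes "has_weak_deriv l f F" "has_weak_deriv l g G"
  shows "has_weak_deriv l (\<lambda>x. f x * g x) (\<lambda>x. f x * G x + F x * g x)"
  unfolding has_weak_deriv_iff
proof (intro conjI ballI)
  interpret semi_inner "l2_space (ivl 0 l)" "l2_inner (ivl 0 l)" by (rule l2_semi_inner)
  show "(\<lambda>x. f x * G x + F x * g x) \<in> l2_space (ivl 0 l)"
    using continuous_ivl_mult_l2[OF has_weak_deriv_continuous[OF assms(1)] has_weak_deriv_l2[OF assms(2)]]
      continuous_ivl_mult_l2[OF has_weak_deriv_continuous[OF assms(2)] has_weak_deriv_l2[OF assms(1)]]
    by (intro add_mem) (simp_all add: mult.commute)
  fix x assume x: "x \<in> {0..l}"
  have "(\<integral>y. f y * G y + F y * g y \<partial>ivl 0 x) = f x * g x - f 0 * g 0"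
    using x by (intro integration_by_parts_ivl has_weak_deriv_restrict[OF assms(1)]
        has_weak_deriv_restrict[OF assms(2)]) auto
  then show "f x * g x = f 0 * g 0 + (\<integral>y. f y * G y + F y * g y \<partial>ivl 0 x)" by simp
qed

text \<open>The inequality f(x)^2 \<le> 2 f(y)^2 + 2 (f(x) - f(y))^2 is averaged over y. At an
  endpoint the integral of |x - y| is half the squared length, and it is evaluated exactly: the
  cruder bound by the length would double the energy constant, which must match the smallness
  condition imposed on a negative \<alpha>. The free window length balances mass against
  energy.\<close>

lemma trace_bound:
  assumes F: "has_weak_deriv l f F" and c: "0 \<le> c" "c < d" "d \<le> l" and x: "x = c \<or> x = d"
  shows "(f x)\<^sup>2 \<le> 2 / (d - c) * (\<integral>y. (f y)\<^sup>2 \<partial>ivl c d) + (d - c) * (\<integral>y. (F y)\<^sup>2 \<partial>ivl c d)"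
proof -
  interpret finite_measure "ivl c d" by (rule finite_measure_ivl)
  define B where "B = (\<integral>y. (F y)\<^sup>2 \<partial>ivl c d)"
  have f2: "integrable (ivl c d) (\<lambda>y. (f y)\<^sup>2)"
    using continuous_ivl_l2[OF has_weak_deriv_continuous[OF F]] l2_space_ivl_sub c
    unfolding l2_space_def by blast
  have co: "continuous_on {c..d} (\<lambda>y. \<bar>x - y\<bar>)" by (intro continuous_intros)
  have ci: "set_integrable lborel {c..d} (\<lambda>y. \<bar>x - y\<bar>)"
    by (rule borel_integrable_atLeastAtMost') (rule co)
  have "(\<integral>y. \<bar>x - y\<bar> \<partial>ivl c d) = (d - c)\<^sup>2 / 2"
  proof -
    have "((\<lambda>y. \<bar>x - y\<bar>) has_integral (d - c)\<^sup>2 / 2) {c..d}"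
    proof (cases "x = c")
      case True
      have "((\<lambda>y. y - c) has_integral ((d - c)\<^sup>2 / 2 - (c - c)\<^sup>2 / 2)) {c..d}"
        using c by (intro fundamental_theorem_of_calculus)
          (auto intro!: derivative_eq_intros simp flip: has_real_derivative_iff_has_vector_derivative)
      then have "((\<lambda>y. \<bar>x - y\<bar>) has_integral ((d - c)\<^sup>2 / 2 - (c - c)\<^sup>2 / 2)) {c..d}"
        by (rule has_integral_eq[rotated]) (use True in auto)
      then show ?thesis by simp
    next
      case False
      then have xd: "x = d" using x by simp
      have "((\<lambda>y. d - y) has_integral (- (d - d)\<^sup>2 / 2 - (- (d - c)\<^sup>2 / 2))) {c..d}"
        using c by (intro fundamental_theorem_of_calculus)
          (auto intro!: derivative_eq_intros simp: field_simps
            simp flip: has_real_derivative_iff_has_vector_derivative)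
      then have "((\<lambda>y. \<bar>x - y\<bar>) has_integral (- (d - d)\<^sup>2 / 2 - (- (d - c)\<^sup>2 / 2))) {c..d}"
        by (rule has_integral_eq[rotated]) (use xd in auto)
      then show ?thesis by simp
    qed
    then show ?thesis
      using set_borel_integral_eq_integral(2)[OF ci] by (simp add: set_integral_ivl integral_unique)
  qed
  note ab = this
  have iab: "integrable (ivl c d) (\<lambda>y. \<bar>x - y\<bar>)" using ci by (simp add: set_integrable_ivl)
  have "(\<integral>y. (f x)\<^sup>2 \<partial>ivl c d) \<le> (\<integral>y. 2 * (f y)\<^sup>2 + 2 * B * \<bar>x - y\<bar> \<partial>ivl c d)"
  proof (rule integral_mono)
    fix y assume "y \<in> space (ivl c d)"
    then have "(f x - f y)\<^sup>2 \<le> \<bar>x - y\<bar> * B"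
      unfolding B_def using c x by (intro abs_diff_bound[OF F]) auto
    moreover have "(f x)\<^sup>2 \<le> 2 * (f y)\<^sup>2 + 2 * (f x - f y)\<^sup>2"
      using zero_le_power2[of "f x - 2 * f y"] by (simp add: power2_eq_square algebra_simps)
    ultimately show "(f x)\<^sup>2 \<le> 2 * (f y)\<^sup>2 + 2 * B * \<bar>x - y\<bar>" by (simp add: mult_ac)
  qed (use f2 iab in auto)
  also have "\<dots> = 2 * (\<integral>y. (f y)\<^sup>2 \<partial>ivl c d) + B * (d - c)\<^sup>2"
    using f2 iab ab by simp
  finally have "(d - c) * (f x)\<^sup>2 \<le> 2 * (\<integral>y. (f y)\<^sup>2 \<partial>ivl c d) + B * (d - c)\<^sup>2"
    using c by (simp add: measure_ivl)
  then show ?thesis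
    using c unfolding B_def[symmetric] by (simp add: field_simps power2_eq_square)
qed

lemma vanishing_endpoint_bound:
  assumes F: "has_weak_deriv l f F" and c: "0 \<le> c" "c \<le> d" "d \<le> l" and "f c = 0"
  shows "(\<integral>x. (f x)\<^sup>2 \<partial>ivl c d) \<le> (d - c)\<^sup>2 * (\<integral>x. (F x)\<^sup>2 \<partial>ivl c d)"
proof -
  interpret finite_measure "ivl c d" by (rule finite_measure_ivl)
  define B where "B = (\<integral>y. (F y)\<^sup>2 \<partial>ivl c d)"
  have B: "0 \<le> B" unfolding B_def by (intro integral_nonneg_AE) auto
  have "(\<integral>x. (f x)\<^sup>2 \<partial>ivl c d) \<le> (\<integral>x. (d - c) * B \<partial>ivl c d)"
  proof (rule integral_mono)
    show "integrable (ivl c d) (\<lambda>y. (f y)\<^sup>2)"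
      using continuous_ivl_l2[OF has_weak_deriv_continuous[OF F]] l2_space_ivl_sub c
      unfolding l2_space_def by blast
    fix x assume x: "x \<in> space (ivl c d)"
    then have "(f x - f c)\<^sup>2 \<le> \<bar>x - c\<bar> * B"
      unfolding B_def using c by (intro abs_diff_bound[OF F]) auto
    also have "\<dots> \<le> (d - c) * B" using x B by (intro mult_right_mono) auto
    finally show "(f x)\<^sup>2 \<le> (d - c) * B" using assms by simp
  qed simp
  then show ?thesis using c unfolding B_def by (simp add: measure_ivl power2_eq_square mult_ac)
qed

text \<open>The slope of the chord is the mean of v, so v(x) minus it is the average of v(x) - v(y),
  and Hoelder continuity of v bounds that. On a mesh cell the chord is the interpolant.\<close>

lemma mean_slope_bound:
  assumes u: "has_weak_deriv l u v" and v: "has_weak_deriv l v w" and c: "0 \<le> c" "c < d" "d \<le> l"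
  shows "(\<integral>x. (v x - (u d - u c) / (d - c))\<^sup>2 \<partial>ivl c d) \<le> (d - c)\<^sup>2 * (\<integral>x. (w x)\<^sup>2 \<partial>ivl c d)"
proof -
  interpret finite_measure "ivl c d" by (rule finite_measure_ivl)
  define B where "B = (\<integral>y. (w y)\<^sup>2 \<partial>ivl c d)"
  define m where "m = (u d - u c) / (d - c)"
  have B: "0 \<le> B" unfolding B_def by (intro integral_nonneg_AE) auto
  have iv: "integrable (ivl c d) v" using has_weak_deriv_integrable[OF u] c by auto
  have bd: "(v x - m)\<^sup>2 \<le> (d - c) * B" if x: "x \<in> {c..d}" for x
  proof -
    have d1: "\<bar>v x - v y\<bar> \<le> sqrt ((d - c) * B)" if y: "y \<in> {c..d}" for y
    proof (rule real_le_rsqrt)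
      have "(v x - v y)\<^sup>2 \<le> \<bar>x - y\<bar> * B"
        unfolding B_def using c x y by (intro abs_diff_bound[OF v]) auto
      also have "\<dots> \<le> (d - c) * B" using x y B by (intro mult_right_mono) auto
      finally show "\<bar>v x - v y\<bar>\<^sup>2 \<le> (d - c) * B" by simp
    qed
    have "(d - c) * (v x - m) = (\<integral>y. v x - v y \<partial>ivl c d)"
      using c iv has_weak_deriv_diff_eq[OF u, of c d]
      by (simp add: measure_ivl m_def field_simps)
    also have "\<bar>\<dots>\<bar> \<le> (\<integral>y. \<bar>v x - v y\<bar> \<partial>ivl c d)" by (rule integral_abs_bound)
    also have "\<dots> \<le> (\<integral>y. sqrt ((d - c) * B) \<partial>ivl c d)"
      using d1 iv by (intro integral_mono) auto
    finally have "(d - c) * \<bar>v x - m\<bar> \<le> (d - c) * sqrt ((d - c) * B)"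
      using c by (simp add: measure_ivl abs_mult)
    then have "\<bar>v x - m\<bar> \<le> sqrt ((d - c) * B)" using c by simp
    then have "\<bar>v x - m\<bar>\<^sup>2 \<le> (sqrt ((d - c) * B))\<^sup>2" by (intro power_mono) auto
    then show ?thesis using c B by simp
  qed
  have "(\<integral>x. (v x - m)\<^sup>2 \<partial>ivl c d) \<le> (\<integral>x. (d - c) * B \<partial>ivl c d)"
  proof (rule integral_mono)
    have "(\<lambda>x. v x - m) \<in> borel_measurable (ivl c d)" using iv by auto
    moreover have "AE x in ivl c d. \<bar>v x - m\<bar> \<le> sqrt ((d - c) * B)"
      using bd by (intro AE_I2) (auto intro: real_le_rsqrt)
    ultimately show "integrable (ivl c d) (\<lambda>x. (v x - m)\<^sup>2)"
      using bounded_l2_space unfolding l2_space_def by blast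
  qed (use bd in auto)
  then show ?thesis using c unfolding B_def m_def by (simp add: measure_ivl power2_eq_square mult_ac)
qed

text \<open>The density is the Radon-Nikodym derivative of the measure that assigns to A the
  Lebesgue measure of F(A). The upper bound makes it absolutely continuous, since Lipschitz maps
  preserve null sets; the lower bound makes F a bijection of the line.\<close>

lemma increasing_bilipschitz_density:
  fixes F :: "real \<Rightarrow> real"
  assumes lo: "\<And>x y. x \<le> y \<Longrightarrow> y - x \<le> F y - F x"
    and up: "\<And>x y. x \<le> y \<Longrightarrow> F y - F x \<le> L * (y - x)"
  obtains D where "D \<in> borel_measurable lborel" "\<And>x. 0 \<le> D x"
    "\<And>c d. c \<le> d \<Longrightarrow> integrable (ivl c d) D \<and> (\<integral>x. D x \<partial>ivl c d) = F d - F c"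
proof -
  have mono: "strict_mono F" using lo by (intro strict_monoI) (smt (verit))
  have inj: "inj F" using mono by (rule strict_mono_imp_inj_on)
  have L: "\<bar>F y - F x\<bar> \<le> L * \<bar>y - x\<bar>" for x y
    using up[of x y] up[of y x] lo[of x y] lo[of y x] by (cases "x \<le> y") auto
  have cont: "continuous_on UNIV F"
  proof (rule lipschitz_on_continuous_on)
    have "0 \<le> L" using lo[of 0 1] up[of 0 1] by simp
    then show "L-lipschitz_on UNIV F"
      by (intro lipschitz_onI) (use L in \<open>auto simp: dist_real_def\<close>)
  qed
  have surj: "\<exists>x. F x = y" for y
  proof -
    define R where "R = \<bar>y - F 0\<bar>"
    have "F (- R) \<le> y" "y \<le> F R" using lo[of "-R" 0] lo[of 0 R] unfolding R_def by linarith+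
    then show ?thesis
      using IVT'[of F "-R" y R] continuous_on_subset[OF cont] unfolding R_def by auto
  qed
  define Fi where "Fi = inv F"
  have FFi: "F (Fi y) = y" and FiF: "Fi (F x) = x" for x y
    unfolding Fi_def using surj[of y] inj by (auto simp: inv_f_f)
  have "mono Fi"
  proof (rule monoI)
    fix x y :: real assume "x \<le> y"
    then show "Fi x \<le> Fi y" using mono FFi by (metis strict_mono_less_eq)
  qed
  then have [measurable]: "Fi \<in> borel_measurable borel" by (rule borel_measurable_mono)
  \<comment> \<open>Pushing Lebesgue measure forward by the inverse of F turns preimages into images
    under F; the inverse is measurable because it is monotone.\<close>
  define \<nu> where "\<nu> = distr lborel borel Fi"
  have em: "emeasure \<nu> A = emeasure lborel (F ` A)" if "A \<in> sets borel" for A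
  proof -
    have "Fi -` A = F ` A" using FFi FiF by (auto simp: image_iff) (metis FFi)
    then show ?thesis unfolding \<nu>_def using that by (subst emeasure_distr) auto
  qed
  have "absolutely_continuous lborel \<nu>"
    unfolding absolutely_continuous_def
  proof
    fix A :: "real set" assume A: "A \<in> null_sets lborel"
    then have Ab: "A \<in> sets borel" by auto
    have "negligible A" using A by (simp add: negligible_iff_null_sets null_sets_completionI)
    then have "negligible (F ` A)"
    proof (rule negligible_locally_Lipschitz_image[rotated])
      show "\<exists>T B. open T \<and> x \<in> T \<and> (\<forall>y\<in>A \<inter> T. norm (F y - F x) \<le> B * norm (y - x))"
        if "x \<in> A" for x
        by (rule exI[of _ UNIV], rule exI[of _ L]) (use L in auto)
    qed simp
    moreover have "F ` A \<in> sets borel"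
    proof -
      have "F ` A = Fi -` A \<inter> space borel" using FFi FiF by (auto simp: image_iff) (metis FFi)
      then show ?thesis using measurable_sets[OF \<open>Fi \<in> borel_measurable borel\<close> Ab] by simp
    qed
    ultimately have "emeasure lborel (F ` A) = 0"
      by (simp add: negligible_iff_null_sets null_sets_completion_iff null_setsD1)
    with em[OF Ab] Ab show "A \<in> null_sets \<nu>" by (auto simp: \<nu>_def null_sets_def)
  qed
  moreover have "sets \<nu> = sets lborel" unfolding \<nu>_def by simp
  ultimately obtain f where f[measurable]: "f \<in> borel_measurable lborel" and dens: "density lborel f = \<nu>"
    using sigma_finite_measure.Radon_Nikodym[OF lborel.sigma_finite_measure_axioms] by blast
  have nn: "(\<integral>\<^sup>+ x. f x \<partial>ivl c d) = ennreal (F d - F c)" if "c \<le> d" for c d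
  proof -
    have "F ` {c..d} = {F c..F d}"
    proof
      show "F ` {c..d} \<subseteq> {F c..F d}" using mono by (auto simp: strict_mono_less_eq)
      show "{F c..F d} \<subseteq> F ` {c..d}"
      proof
        fix y assume "y \<in> {F c..F d}"
        then have "Fi y \<in> {c..d}" using mono FFi by (metis atLeastAtMost_iff strict_mono_less_eq)
        then show "y \<in> F ` {c..d}" using FFi by (metis imageI)
      qed
    qed
    then have "emeasure \<nu> {c..d} = ennreal (F d - F c)"
      using em[of "{c..d}"] that mono by (simp add: strict_mono_less_eq)
    moreover have "emeasure \<nu> {c..d} = (\<integral>\<^sup>+ x. f x * indicator {c..d} x \<partial>lborel)"
      unfolding dens[symmetric] by (rule emeasure_density) auto
    ultimately show ?thesis by (simp add: nn_integral_restrict_space)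
  qed
  have fm: "f \<in> borel_measurable (ivl c d)" for c d
    by (rule measurable_restrict_space1) (rule f)
  show ?thesis
  proof (rule that[of "\<lambda>x. enn2real (f x)"])
    fix c d :: real assume cd: "c \<le> d"
    have "AE x in ivl c d. f x \<noteq> \<infinity>"
      using nn[OF cd] fm by (intro nn_integral_noteq_infinite) auto
    then have AE: "AE x in ivl c d. ennreal (enn2real (f x)) = f x"
      by eventually_elim (simp add: less_top)
    have 1: "(\<integral>\<^sup>+ x. ennreal (enn2real (f x)) \<partial>ivl c d) = ennreal (F d - F c)"
      using nn[OF cd] nn_integral_cong_AE[OF AE] by simp
    have 2: "0 \<le> F d - F c" using mono cd by (simp add: strict_mono_less_eq)
    have m: "(\<lambda>x. enn2real (f x)) \<in> borel_measurable (ivl c d)"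
      using fm by measurable
    have "integrable (ivl c d) (\<lambda>x. enn2real (f x))"
      using m 1 by (intro integrableI_nonneg) auto
    moreover have "(\<integral>x. enn2real (f x) \<partial>ivl c d) = F d - F c"
      using m 1 2 by (intro integral_eq_nn_integral[THEN trans]) auto
    ultimately show "integrable (ivl c d) (\<lambda>x. enn2real (f x)) \<and>
        (\<integral>x. enn2real (f x) \<partial>ivl c d) = F d - F c" by simp
  qed auto
qed

text \<open>
  Rademacher's theorem on the line: \<open>f\<close> is half the difference of the increasing bi-Lipschitz
  functions \<open>(K + 1) x \<plusminus> f x\<close>, whose densities add up to a constant and are therefore bounded.
\<close>

lemma lipschitz_has_weak_deriv:
  fixes f :: "real \<Rightarrow> real"
  assumes "K-lipschitz_on {0..l} f"
  obtains g where "has_weak_deriv l f g" "\<And>x. \<bar>g x\<bar> \<le> K + 1"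
proof (cases "0 \<le> l")
  case False
  then have "has_weak_deriv l f (\<lambda>_. 0)" unfolding has_weak_deriv_iff l2_space_def by auto
  with that show ?thesis using lipschitz_on_nonneg[OF assms] by fastforce
next
  case True
  have K: "0 \<le> K" using lipschitz_on_nonneg[OF assms] .
  \<comment> \<open>Clamping extends f to the whole line by its end values without enlarging the
    Lipschitz constant.\<close>
  define p where "p x = max 0 (min l x)" for x
  define h where "h x = f (p x)" for x
  have h: "\<bar>h x - h y\<bar> \<le> K * \<bar>x - y\<bar>" for x y
  proof -
    have "\<bar>h x - h y\<bar> \<le> K * \<bar>p x - p y\<bar>"
      using lipschitz_onD[OF assms, of "p x" "p y"] True
      unfolding h_def p_def dist_real_def by auto
    also have "\<dots> \<le> K * \<bar>x - y\<bar>" using K unfolding p_def by (intro mult_left_mono) auto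
    finally show ?thesis .
  qed
  have "\<exists>D. D \<in> borel_measurable lborel \<and> (\<forall>x. 0 \<le> D x) \<and>
      (\<forall>c d. c \<le> d \<longrightarrow> integrable (ivl c d) D \<and>
         (\<integral>x. D x \<partial>ivl c d) = ((K + 1) * d + s * h d) - ((K + 1) * c + s * h c))"
    if s: "s = 1 \<or> s = -1" for s
  proof -
    have b: "\<bar>s * h y - s * h x\<bar> \<le> K * (y - x)" if "x \<le> y" for x y
      using h[of y x] s that by (auto simp: abs_minus_commute)
    obtain D where "D \<in> borel_measurable lborel" "\<And>x. 0 \<le> D x"
      "\<And>c d. c \<le> d \<Longrightarrow> integrable (ivl c d) D \<and>
         (\<integral>x. D x \<partial>ivl c d) = ((K + 1) * d + s * h d) - ((K + 1) * c + s * h c)"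
    proof (rule increasing_bilipschitz_density[of "\<lambda>x. (K + 1) * x + s * h x" "2 * K + 1"])
      show "y - x \<le> (K + 1) * y + s * h y - ((K + 1) * x + s * h x)" if "x \<le> y" for x y
        using b[OF that] by (simp add: algebra_simps abs_le_iff)
      show "(K + 1) * y + s * h y - ((K + 1) * x + s * h x) \<le> (2 * K + 1) * (y - x)" if "x \<le> y" for x y
        using b[OF that] by (simp add: algebra_simps abs_le_iff)
    qed blast
    then show ?thesis by blast
  qed
  from this[of 1] this[of "-1"] obtain D E
    where D: "D \<in> borel_measurable lborel" "\<And>x. 0 \<le> D x"
        "\<And>c d. c \<le> d \<Longrightarrow> integrable (ivl c d) D \<and>
           (\<integral>x. D x \<partial>ivl c d) = ((K + 1) * d + h d) - ((K + 1) * c + h c)"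
      and E: "E \<in> borel_measurable lborel" "\<And>x. 0 \<le> E x"
        "\<And>c d. c \<le> d \<Longrightarrow> integrable (ivl c d) E \<and>
           (\<integral>x. E x \<partial>ivl c d) = ((K + 1) * d - h d) - ((K + 1) * c - h c)"
    by auto
  interpret finite_measure "ivl 0 l" by (rule finite_measure_ivl)
  have "AE x in ivl 0 l. D x + E x - 2 * (K + 1) = 0"
  proof (rule integral_ivl_eq_zero_imp_AE)
    show "integrable (ivl 0 l) (\<lambda>x. D x + E x - 2 * (K + 1))"
      using D(3)[OF True] E(3)[OF True] by simp
    fix x assume x: "x \<in> {0..l}"
    interpret x: finite_measure "ivl 0 x" by (rule finite_measure_ivl)
    show "(\<integral>x. D x + E x - 2 * (K + 1) \<partial>ivl 0 x) = 0"
      using D(3)[of 0 x] E(3)[of 0 x] x by (simp add: measure_ivl algebra_simps)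
  qed
  then have AE: "AE x in ivl 0 l. \<bar>(D x - E x) / 2\<bar> \<le> K + 1"
  proof eventually_elim
    case (elim x)
    then show ?case using D(2)[of x] E(2)[of x] by (simp add: abs_le_iff)
  qed
  \<comment> \<open>The half difference of the densities satisfies the bound almost everywhere;
    resetting it to 0 elsewhere makes the bound hold at every point.\<close>
  define g where "g x = (if \<bar>(D x - E x) / 2\<bar> \<le> K + 1 then (D x - E x) / 2 else 0)" for x
  have gm: "g \<in> borel_measurable lborel" unfolding g_def using D(1) E(1) by measurable
  have gm': "g \<in> borel_measurable (ivl c d)" for c d
    using gm by (rule measurable_restrict_space1)
  have gb: "\<bar>g x\<bar> \<le> K + 1" for x using K unfolding g_def by auto
  have "has_weak_deriv l f g"
    unfolding has_weak_deriv_iff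
  proof (intro conjI ballI)
    show "g \<in> l2_space (ivl 0 l)"
      using gm' gb by (intro bounded_l2_space[of _ "K + 1"]) auto
    fix x assume x: "x \<in> {0..l}"
    have "(\<integral>y. g y \<partial>ivl 0 x) = (\<integral>y. (D y - E y) / 2 \<partial>ivl 0 x)"
    proof (rule integral_cong_AE)
      show "AE y in ivl 0 x. g y = (D y - E y) / 2"
        using AE_ivl_sub[OF AE, of 0 x] x by (auto simp: g_def elim!: eventually_mono)
      show "(\<lambda>y. (D y - E y) / 2) \<in> borel_measurable (ivl 0 x)"
        using D(3)[of 0 x] E(3)[of 0 x] x by auto
    qed (rule gm')
    also have "\<dots> = h x - h 0"
      using D(3)[of 0 x] E(3)[of 0 x] x by simp
    also have "\<dots> = f x - f 0" using x unfolding h_def p_def by auto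
    finally show "f x = f 0 + (\<integral>y. g y \<partial>ivl 0 x)" by simp
  qed
  with gb that show ?thesis by blast
qed

section \<open>The energy form on a metric graph\<close>

lemma points_sets:
  assumes "finite (edges G)"
  shows "points G \<inter> space (count_space (edges G) \<Otimes>\<^sub>M lborel) \<in> sets (count_space (edges G) \<Otimes>\<^sub>M lborel)"
proof -
  have "points G \<inter> space (count_space (edges G) \<Otimes>\<^sub>M lborel) = (\<Union>e\<in>edges G. {e} \<times> {0..len G e})"
    by (auto simp: points_def space_pair_measure)
  also have "\<dots> \<in> sets (count_space (edges G) \<Otimes>\<^sub>M lborel)"
    using assms by (intro sets.finite_UN) auto
  finally show ?thesis .
qed

lemma space_graph_measure: "space (graph_measure G) = points G"
  by (auto simp: graph_measure_def space_restrict_space space_pair_measure points_def)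

lemma graph_measurable_iff:
  fixes f :: "'e \<times> real \<Rightarrow> real"
  assumes "finite (edges G)"
  shows "f \<in> borel_measurable (graph_measure G) \<longleftrightarrow>
    (\<forall>e\<in>edges G. (\<lambda>x. f (e, x)) \<in> borel_measurable (ivl 0 (len G e)))"
proof -
  let ?N = "count_space (edges G) \<Otimes>\<^sub>M lborel"
  let ?f = "\<lambda>p. indicator (points G) p *\<^sub>R f p"
  have sl: "?f (e, x) = indicator {0..len G e} x *\<^sub>R f (e, x)" if "e \<in> edges G" for e x
    using that by (auto simp: points_def indicator_def)
  have "f \<in> borel_measurable (graph_measure G) \<longleftrightarrow> ?f \<in> borel_measurable ?N"
    unfolding graph_measure_def using points_sets[OF assms]
    by (subst borel_measurable_restrict_space_iff) (auto simp: mult.commute)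
  also have "\<dots> \<longleftrightarrow> (\<forall>e\<in>edges G. (\<lambda>x. ?f (e, x)) \<in> borel_measurable lborel)"
  proof
    assume "?f \<in> borel_measurable ?N"
    then show "\<forall>e\<in>edges G. (\<lambda>x. ?f (e, x)) \<in> borel_measurable lborel"
      by (intro ballI measurable_Pair2[where ?M1.0 = "count_space (edges G)"]) auto
  next
    assume "\<forall>e\<in>edges G. (\<lambda>x. ?f (e, x)) \<in> borel_measurable lborel"
    then show "?f \<in> borel_measurable ?N"
      using assms by (intro measurable_pair_measure_countable1) (auto intro: countable_finite)
  qed
  also have "\<dots> \<longleftrightarrow> (\<forall>e\<in>edges G. (\<lambda>x. f (e, x)) \<in> borel_measurable (ivl 0 (len G e)))"
  proof (intro ball_cong refl)
    fix e assume "e \<in> edges G"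
    then show "(\<lambda>x. ?f (e, x)) \<in> borel_measurable lborel \<longleftrightarrow>
        (\<lambda>x. f (e, x)) \<in> borel_measurable (ivl 0 (len G e))"
      unfolding set_borel_measurable_ivl[symmetric] set_borel_measurable_def by (simp only: sl)
  qed
  finally show ?thesis .
qed

lemma sigma_finite_count_lborel:
  "finite A \<Longrightarrow> pair_sigma_finite (count_space A) (lborel :: real measure)"
  by (intro pair_sigma_finite.intro sigma_finite_measure_count_space_finite lborel.sigma_finite_measure_axioms)

lemma graph_integral:
  fixes f :: "'e \<times> real \<Rightarrow> real"
  assumes fin: "finite (edges G)" and f: "\<And>e. e \<in> edges G \<Longrightarrow> integrable (ivl 0 (len G e)) (\<lambda>x. f (e, x))"
  shows "integrable (graph_measure G) f"
    and "(\<integral>p. f p \<partial>graph_measure G) = (\<Sum>e\<in>edges G. \<integral>x. f (e, x) \<partial>ivl 0 (len G e))"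
proof -
  let ?N = "count_space (edges G) \<Otimes>\<^sub>M lborel"
  interpret pair_sigma_finite "count_space (edges G)" "lborel :: real measure"
    by (rule sigma_finite_count_lborel[OF fin])
  let ?f = "\<lambda>p. indicator (points G) p *\<^sub>R f p"
  have sl: "?f (e, x) = indicator {0..len G e} x *\<^sub>R f (e, x)" if "e \<in> edges G" for e x
    using that by (auto simp: points_def indicator_def)
  have int_e: "integrable lborel (\<lambda>x. ?f (e, x))" if "e \<in> edges G" for e
    unfolding sl[OF that] using f[OF that] set_integrable_ivl[of 0 "len G e" "\<lambda>x. f (e, x)"]
    by (simp add: set_integrable_def)
  have "f \<in> borel_measurable (graph_measure G)"
    using f by (auto simp: graph_measurable_iff[OF fin])
  then have fm: "?f \<in> borel_measurable ?N"
    unfolding graph_measure_def using points_sets[OF fin]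
    by (subst (asm) borel_measurable_restrict_space_iff) (auto simp: mult.commute)
  have int: "integrable ?N ?f"
  proof (rule Fubini_integrable[OF fm])
    show "integrable (count_space (edges G)) (\<lambda>x. \<integral>y. norm (?f (x, y)) \<partial>lborel)"
      using fin by (rule integrable_count_space)
    show "AE x in count_space (edges G). integrable lborel (\<lambda>y. ?f (x, y))"
      using int_e by (auto simp: AE_count_space)
  qed
  then show "integrable (graph_measure G) f"
    unfolding graph_measure_def using points_sets[OF fin]
    by (subst integrable_restrict_space) (auto simp: mult.commute)
  have "(\<integral>p. f p \<partial>graph_measure G) = (\<integral>p. ?f p \<partial>?N)"
    unfolding graph_measure_def using points_sets[OF fin] by (rule integral_restrict_space)
  also have "\<dots> = (\<integral>e. (\<integral>x. ?f (e, x) \<partial>lborel) \<partial>count_space (edges G))"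
    using integral_fst'[OF int] by simp
  also have "\<dots> = (\<Sum>e\<in>edges G. \<integral>x. ?f (e, x) \<partial>lborel)"
    using fin by (rule lebesgue_integral_count_space_finite)
  also have "\<dots> = (\<Sum>e\<in>edges G. \<integral>x. f (e, x) \<partial>ivl 0 (len G e))"
  proof (intro sum.cong refl)
    fix e assume e: "e \<in> edges G"
    show "(\<integral>x. ?f (e, x) \<partial>lborel) = (\<integral>x. f (e, x) \<partial>ivl 0 (len G e))"
      unfolding sl[OF e] by (simp add: integral_restrict_space)
  qed
  finally show "(\<integral>p. f p \<partial>graph_measure G) = (\<Sum>e\<in>edges G. \<integral>x. f (e, x) \<partial>ivl 0 (len G e))" .
qed

lemma graph_AE:
  assumes fin: "finite (edges G)" and AE: "AE p in graph_measure G. P p" and e: "e \<in> edges G"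
  shows "AE x in ivl 0 (len G e). P (e, x)"
proof -
  have "AE p in count_space (edges G) \<Otimes>\<^sub>M lborel. p \<in> points G \<longrightarrow> P p"
    using AE unfolding graph_measure_def by (subst (asm) AE_restrict_space_iff[OF points_sets[OF fin]])
  then have "AE e in count_space (edges G). AE x in lborel. (e, x) \<in> points G \<longrightarrow> P (e, x)"
    by (rule pair_sigma_finite.AE_pair[OF sigma_finite_count_lborel[OF fin]])
  then show ?thesis using e by (auto simp: AE_count_space AE_ivl points_def)
qed

lemma graph_l2I:
  assumes fin: "finite (edges G)"
    and f: "\<And>e. e \<in> edges G \<Longrightarrow> (\<lambda>x. f (e, x)) \<in> l2_space (ivl 0 (len G e))"
  shows "f \<in> l2_space (graph_measure G)"
  using graph_integral(1)[OF fin, of "\<lambda>p. (f p)\<^sup>2"] graph_measurable_iff[OF fin, of f] f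
  unfolding l2_space_def by auto

lemma graph_l2_inner:
  assumes fin: "finite (edges G)"
    and f: "\<And>e. e \<in> edges G \<Longrightarrow> (\<lambda>x. f (e, x)) \<in> l2_space (ivl 0 (len G e))"
    and g: "\<And>e. e \<in> edges G \<Longrightarrow> (\<lambda>x. g (e, x)) \<in> l2_space (ivl 0 (len G e))"
  shows "l2_inner (graph_measure G) f g = (\<Sum>e\<in>edges G. \<integral>x. f (e, x) * g (e, x) \<partial>ivl 0 (len G e))"
  unfolding l2_inner_def using mult_integrable_of_squares[OF f g]
  by (rule graph_integral(2)[OF fin])

lemma finite_measure_graph:
  assumes "finite (edges G)"
  shows "finite_measure (graph_measure G)"
proof (rule finite_measureI)
  have "integrable (graph_measure G) (\<lambda>_. 1 :: real)"
    using assms finite_measure.integrable_const[OF finite_measure_ivl] by (intro graph_integral) auto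
  then have "(\<integral>\<^sup>+ x. ennreal (norm (1::real)) \<partial>graph_measure G) < \<infinity>"
    unfolding integrable_iff_bounded by blast
  then show "emeasure (graph_measure G) (space (graph_measure G)) \<noteq> \<infinity>" by simp
qed

definition H1_graph :: "('v, 'e) metric_graph \<Rightarrow> ('e \<times> real \<Rightarrow> real) set" where
  "H1_graph G = {f. graph_continuous G f \<and> (\<forall>e\<in>edges G. (\<lambda>x. f (e, x)) \<in> H1_interval (len G e))}"

abbreviation wder :: "('v, 'e) metric_graph \<Rightarrow> ('e \<times> real \<Rightarrow> real) \<Rightarrow> 'e \<Rightarrow> real \<Rightarrow> real" where
  "wder G f e \<equiv> weak_deriv (len G e) (\<lambda>y. f (e, y))"

lemma H1_graph_wder:
  assumes "f \<in> H1_graph G" "e \<in> edges G"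
  shows "has_weak_deriv (len G e) (\<lambda>x. f (e, x)) (wder G f e)"
  using assms weak_deriv_AE(1) unfolding H1_graph_def H1_interval_def by blast

lemma H1_graph_slice_l2:
  assumes "f \<in> H1_graph G" "e \<in> edges G"
  shows "(\<lambda>x. f (e, x)) \<in> l2_space (ivl 0 (len G e))"
  using continuous_ivl_l2[OF has_weak_deriv_continuous[OF H1_graph_wder[OF assms]]] .

lemma H1_graph_lincomb:
  assumes "f \<in> H1_graph G" "g \<in> H1_graph G"
  shows "(\<lambda>p. r * f p + s * g p) \<in> H1_graph G"
proof -
  have "graph_continuous G (\<lambda>p. r * f p + s * g p)"
    unfolding graph_continuous_def
  proof (intro conjI ballI)
    fix e assume "e \<in> edges G"
    then show "continuous_on {0..len G e} (\<lambda>x. r * f (e, x) + s * g (e, x))"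
      using assms unfolding H1_graph_def graph_continuous_def by (auto intro!: continuous_intros)
  next
    fix v h h' assume "v \<in> verts G" "h \<in> inc G v" "h' \<in> inc G v"
    then have "f (fst h, end_pos G h) = f (fst h', end_pos G h')"
      "g (fst h, end_pos G h) = g (fst h', end_pos G h')"
      using assms unfolding H1_graph_def graph_continuous_def by blast+
    then show "r * f (fst h, end_pos G h) + s * g (fst h, end_pos G h) =
        r * f (fst h', end_pos G h') + s * g (fst h', end_pos G h')" by simp
  qed
  moreover have "(\<lambda>x. r * f (e, x) + s * g (e, x)) \<in> H1_interval (len G e)" if "e \<in> edges G" for e
    using has_weak_deriv_lincomb[OF H1_graph_wder[OF assms(1) that] H1_graph_wder[OF assms(2) that]]
    unfolding H1_interval_def by blast
  ultimately show ?thesis unfolding H1_graph_def by simp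
qed

lemma vert_val_eq:
  assumes "graph_continuous G f" "v \<in> verts G" "h \<in> inc G v"
  shows "vert_val G f v = f (fst h, end_pos G h)"
proof -
  have "(SOME h. h \<in> inc G v) \<in> inc G v" using assms(3) by (rule someI)
  with assms show ?thesis unfolding vert_val_def graph_continuous_def Let_def by blast
qed

text \<open>Every edge end is incident to exactly one vertex. With ends in place of edges a loop
  contributes both of its ends to the same vertex, so it requires no separate treatment. This is the
  passage between vertex sums and boundary terms on edges.\<close>

lemma sum_inc:
  fixes F :: "'e \<times> bool \<Rightarrow> real"
  assumes "compact_metric_graph G"
  shows "(\<Sum>v\<in>verts G. \<Sum>h\<in>inc G v. F h) = (\<Sum>e\<in>edges G. F (e, False) + F (e, True))"
proof -
  have fin: "finite (verts G)" "finite (edges G)"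
    using assms unfolding compact_metric_graph_def by auto
  have "(\<Sum>v\<in>verts G. \<Sum>h\<in>inc G v. F h) =
      (\<Sum>v\<in>verts G. sum F {h \<in> edges G \<times> UNIV. end_vert G h = v})"
    by (intro sum.cong) (auto simp: inc_def)
  also have "\<dots> = sum F (edges G \<times> UNIV)"
    using fin assms by (intro sum.group) (auto simp: compact_metric_graph_def end_vert_def)
  also have "\<dots> = (\<Sum>e\<in>edges G. \<Sum>b\<in>UNIV. F (e, b))"
    by (simp add: sum.cartesian_product)
  finally show ?thesis by (simp add: UNIV_bool add.commute)
qed

text \<open>The hypotheses of the theorem that concern the graph and the coefficients, together with
  \<open>edges_ne\<close>. Without edges the graph carries no eigenbasis, so that case is settled
  separately.\<close>

locale graph_problem =
  fixes G :: "('v, 'e) metric_graph"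
    and a \<kappa> :: "'e \<times> real \<Rightarrow> real"
    and \<alpha> \<kappa>\<^sub>0 a\<^sub>0 S :: real
    and d\<^sub>0 :: nat
  assumes graph: "compact_metric_graph G" and conn: "connected_graph G"
    and edges_ne: "edges G \<noteq> {}"
    and kappa_linf: "\<kappa> \<in> linf_space (graph_measure G)"
    and kappa0: "0 < \<kappa>\<^sub>0" and kappa_ge: "AE p in graph_measure G. \<kappa>\<^sub>0 \<le> \<kappa> p"
    and a_lip: "graph_lipschitz G a" and a_pos: "\<forall>p\<in>points G. 0 < a p"
    and a0: "a\<^sub>0 = (INF p\<in>points G. a p)" and a0_pos: "0 < a\<^sub>0"
    and d0: "d\<^sub>0 = Min (degree G ` verts G)"
    and S: "S = \<bar>\<alpha>\<bar> / real d\<^sub>0"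
    and alpha: "0 \<le> \<alpha> \<or>
         (4 * S / Min (len G ` edges G) < \<kappa>\<^sub>0\<^sup>2 \<and> 2 * S * Max (len G ` edges G) \<le> a\<^sub>0)"
begin

abbreviation "E \<equiv> edges G"
abbreviation "M \<equiv> graph_measure G"
abbreviation "H \<equiv> H1_graph G"
abbreviation "form \<equiv> graph_form G a \<kappa> \<alpha>"
abbreviation "I e \<equiv> ivl 0 (len G e)"

lemma fin_E: "finite E" and fin_V: "finite (verts G)" and len_pos: "e \<in> E \<Longrightarrow> 0 < len G e"
  using graph unfolding compact_metric_graph_def by auto

lemma a_ge: "p \<in> points G \<Longrightarrow> a\<^sub>0 \<le> a p"
  unfolding a0 using a_pos by (intro cINF_lower bdd_belowI[of _ 0]) (auto intro: less_imp_le)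

abbreviation path_lengths :: "'e \<times> real \<Rightarrow> 'e \<times> real \<Rightarrow> real set" where
  "path_lengths p q \<equiv> {d. fst p = fst q \<and> d = \<bar>snd p - snd q\<bar>} \<union>
      {\<bar>snd p - end_pos G (fst p, b)\<bar> + walk_length G hs + \<bar>snd q - end_pos G (fst q, c)\<bar> | b c hs.
         walk G (end_vert G (fst p, b)) hs (end_vert G (fst q, c))}"

lemma path_lengths_nonneg:
  assumes "d \<in> path_lengths p q"
  shows "0 \<le> d"
proof -
  have "0 \<le> walk_length G hs" if "walk G v hs w" for v hs w
    using that
  proof (induction hs arbitrary: v)
    case (Cons h hs)
    then have "fst h \<in> E" by (auto simp: inc_def)
    with Cons show ?case using len_pos[of "fst h"] by (auto simp: walk_length_def)
  qed (simp add: walk_length_def)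
  with assms show ?thesis by auto
qed

lemma gdist_le:
  assumes "d \<in> path_lengths p q"
  shows "gdist G p q \<le> d \<and> 0 \<le> gdist G p q"
  unfolding gdist_def
proof
  show "Inf (path_lengths p q) \<le> d"
    by (rule cInf_lower[OF assms]) (rule bdd_belowI[of _ 0], erule path_lengths_nonneg)
  show "0 \<le> Inf (path_lengths p q)"
    by (rule cInf_greatest) (use assms in blast, erule path_lengths_nonneg)
qed

lemma end_pos_mem: "fst h \<in> E \<Longrightarrow> end_pos G h \<in> {0..len G (fst h)}"
  using len_pos[of "fst h"] unfolding end_pos_def by auto

lemma a_edge_lipschitz:
  obtains K where "0 \<le> K" "\<And>e. e \<in> E \<Longrightarrow> K-lipschitz_on {0..len G e} (\<lambda>x. a (e, x))"
proof -
  obtain K where K: "\<And>p q. p \<in> points G \<Longrightarrow> q \<in> points G \<Longrightarrow> \<bar>a p - a q\<bar> \<le> K * gdist G p q"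
    using a_lip unfolding graph_lipschitz_def by blast
  \<comment> \<open>The constant in \<open>graph_lipschitz\<close> carries no sign, hence the
    absolute value.\<close>
  show ?thesis
  proof (rule that[of "\<bar>K\<bar>"])
    fix e assume e: "e \<in> E"
    show "\<bar>K\<bar>-lipschitz_on {0..len G e} (\<lambda>x. a (e, x))"
    proof (rule lipschitz_onI)
      fix x y assume xy: "x \<in> {0..len G e}" "y \<in> {0..len G e}"
      have g: "gdist G (e, x) (e, y) \<le> \<bar>x - y\<bar>" "0 \<le> gdist G (e, x) (e, y)"
        using gdist_le[of "\<bar>x - y\<bar>" "(e, x)" "(e, y)"] by auto
      have "\<bar>a (e, x) - a (e, y)\<bar> \<le> K * gdist G (e, x) (e, y)"
        using K[of "(e, x)" "(e, y)"] e xy by (simp add: points_def)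
      also have "\<dots> \<le> \<bar>K\<bar> * \<bar>x - y\<bar>" using g by (intro mult_mono) auto
      finally show "dist (a (e, x)) (a (e, y)) \<le> \<bar>K\<bar> * dist x y" by (simp add: dist_real_def)
    qed simp
  qed simp
qed

lemma a_continuous: "graph_continuous G a"
  unfolding graph_continuous_def
proof (intro conjI ballI)
  fix e assume "e \<in> E"
  then show "continuous_on {0..len G e} (\<lambda>x. a (e, x))"
    by (metis a_edge_lipschitz lipschitz_on_continuous_on)
next
  obtain K where K: "\<And>p q. p \<in> points G \<Longrightarrow> q \<in> points G \<Longrightarrow> \<bar>a p - a q\<bar> \<le> K * gdist G p q"
    using a_lip unfolding graph_lipschitz_def by blast
  fix v h h' assume v: "v \<in> verts G" "h \<in> inc G v" "h' \<in> inc G v"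
  let ?p = "(fst h, end_pos G h)" and ?q = "(fst h', end_pos G h')"
  have pts: "?p \<in> points G" "?q \<in> points G"
    using v end_pos_mem[of h] end_pos_mem[of h'] by (auto simp: points_def inc_def)
  \<comment> \<open>Two ends at the same vertex are joined by the empty walk, of length 0. They are
    therefore at distance 0, and a Lipschitz function cannot separate them.\<close>
  have m: "0 \<in> path_lengths ?p ?q"
    using v by (intro UnI2 CollectI exI[of _ "snd h"] exI[of _ "snd h'"] exI[of _ "[]"] conjI)
      (auto simp: inc_def walk_length_def)
  have "gdist G ?p ?q = 0" using gdist_le[OF m] by simp
  with K[OF pts] show "a ?p = a ?q" by simp
qed

lemma kappa_bounded:
  obtains K where "0 \<le> K" "AE p in M. \<bar>\<kappa> p\<bar> \<le> K"
proof -
  obtain K where "AE p in M. \<bar>\<kappa> p\<bar> \<le> K" using kappa_linf unfolding linf_space_def by blast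
  then have "AE p in M. \<bar>\<kappa> p\<bar> \<le> max K 0" by eventually_elim auto
  then show ?thesis by (intro that[of "max K 0"]) auto
qed

lemma kappa_measurable: "e \<in> E \<Longrightarrow> (\<lambda>x. \<kappa> (e, x)) \<in> borel_measurable (I e)"
  using kappa_linf graph_measurable_iff[OF fin_E] unfolding linf_space_def by blast

lemma kappa_mult_l2:
  assumes "e \<in> E" "f \<in> l2_space (I e)"
  shows "(\<lambda>x. (\<kappa> (e, x))\<^sup>2 * f x) \<in> l2_space (I e)"
proof -
  obtain K where K: "0 \<le> K" "AE p in M. \<bar>\<kappa> p\<bar> \<le> K" by (rule kappa_bounded)
  have "AE x in I e. \<bar>\<kappa> (e, x)\<bar> \<le> K" using graph_AE[OF fin_E K(2) assms(1)] .
  then have "AE x in I e. \<bar>(\<kappa> (e, x))\<^sup>2\<bar> \<le> K\<^sup>2"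
    by eventually_elim (metis abs_ge_zero abs_power2 power2_abs power_mono)
  then show ?thesis
    using kappa_measurable[OF assms(1)] assms(2) by (intro l2_space_mult_bounded) auto
qed

lemma a_mult_l2:
  assumes "e \<in> E" "f \<in> l2_space (I e)"
  shows "(\<lambda>x. a (e, x) * f x) \<in> l2_space (I e)"
  using a_continuous assms by (intro continuous_ivl_mult_l2) (auto simp: graph_continuous_def)

text \<open>\<open>graph_form\<close> is built from weak derivatives picked by choice. They are
  unique almost everywhere, so the form may be computed with whichever derivatives are at
  hand.\<close>

lemma form_eq:
  assumes "f \<in> H" "g \<in> H"
    and F: "\<And>e. e \<in> E \<Longrightarrow> has_weak_deriv (len G e) (\<lambda>x. f (e, x)) (F e)"
    and K: "\<And>e. e \<in> E \<Longrightarrow> has_weak_deriv (len G e) (\<lambda>x. g (e, x)) (K e)"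
  shows "form f g = (\<Sum>e\<in>E. \<integral>x. (\<kappa> (e, x))\<^sup>2 * f (e, x) * g (e, x) \<partial>I e) +
     (\<Sum>e\<in>E. \<integral>x. a (e, x) * F e x * K e x \<partial>I e) + (\<Sum>v\<in>verts G. \<alpha> * vert_val G f v * vert_val G g v)"
proof -
  have "l2_inner M (\<lambda>p. (\<kappa> p)\<^sup>2 * f p) g = (\<Sum>e\<in>E. \<integral>x. (\<kappa> (e, x))\<^sup>2 * f (e, x) * g (e, x) \<partial>I e)"
    using assms(1,2) by (intro graph_l2_inner fin_E kappa_mult_l2 H1_graph_slice_l2)
  moreover have "(\<integral>x. a (e, x) * wder G f e x * wder G g e x \<partial>I e) = (\<integral>x. a (e, x) * F e x * K e x \<partial>I e)"
    if e: "e \<in> E" for e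
  proof (rule integral_cong_AE)
    have m: "(\<lambda>x. a (e, x) * p x * q x) \<in> borel_measurable (I e)"
      if "p \<in> l2_space (I e)" "q \<in> l2_space (I e)" for p q
      using mult_integrable_of_squares[OF a_mult_l2[OF e that(1)] that(2)] by auto
    show "(\<lambda>x. a (e, x) * wder G f e x * wder G g e x) \<in> borel_measurable (I e)"
      "(\<lambda>x. a (e, x) * F e x * K e x) \<in> borel_measurable (I e)"
      using F K H1_graph_wder[OF assms(1)] H1_graph_wder[OF assms(2)] e
      by (auto intro!: m has_weak_deriv_l2)
    show "AE x in I e. a (e, x) * wder G f e x * wder G g e x = a (e, x) * F e x * K e x"
      using weak_deriv_AE(2)[OF F[OF e]] weak_deriv_AE(2)[OF K[OF e]] by eventually_elim simp
  qed
  ultimately show ?thesis unfolding graph_form_def set_integral_ivl by simp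
qed

lemma form_wder:
  assumes "f \<in> H" "g \<in> H"
  shows "form f g = (\<Sum>e\<in>E. \<integral>x. (\<kappa> (e, x))\<^sup>2 * f (e, x) * g (e, x) \<partial>I e) +
     (\<Sum>e\<in>E. \<integral>x. a (e, x) * wder G f e x * wder G g e x \<partial>I e) + (\<Sum>v\<in>verts G. \<alpha> * vert_val G f v * vert_val G g v)"
  using assms by (intro form_eq H1_graph_wder)

lemma form_sym: "f \<in> H \<Longrightarrow> g \<in> H \<Longrightarrow> form f g = form g f"
  by (simp add: form_wder mult_ac)

text \<open>The chosen weak derivative of a combination need not be the combination of the chosen
  ones at every point, so linearity goes through \<open>form_eq\<close> with the combined derivative
  as representative.\<close>

lemma form_lincomb:
  assumes f: "f \<in> H" and g: "g \<in> H" and w: "w \<in> H"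
  shows "form (\<lambda>p. r * f p + s * g p) w = r * form f w + s * form g w"
proof -
  have L: "has_weak_deriv (len G e) (\<lambda>x. r * f (e, x) + s * g (e, x)) (\<lambda>x. r * wder G f e x + s * wder G g e x)"
    if "e \<in> E" for e
    using that by (intro has_weak_deriv_lincomb H1_graph_wder f g)
  have 1: "(\<integral>x. (\<kappa> (e, x))\<^sup>2 * (r * f (e, x) + s * g (e, x)) * w (e, x) \<partial>I e) =
      r * (\<integral>x. (\<kappa> (e, x))\<^sup>2 * f (e, x) * w (e, x) \<partial>I e) + s * (\<integral>x. (\<kappa> (e, x))\<^sup>2 * g (e, x) * w (e, x) \<partial>I e)"
    if e: "e \<in> E" for e
  proof -
    have i: "integrable (I e) (\<lambda>x. (\<kappa> (e, x))\<^sup>2 * f (e, x) * w (e, x))" if "f \<in> H" for f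
      using that by (intro mult_integrable_of_squares kappa_mult_l2 H1_graph_slice_l2 w e)
    have "(\<integral>x. (\<kappa> (e, x))\<^sup>2 * (r * f (e, x) + s * g (e, x)) * w (e, x) \<partial>I e) =
      (\<integral>x. r * ((\<kappa> (e, x))\<^sup>2 * f (e, x) * w (e, x)) + s * ((\<kappa> (e, x))\<^sup>2 * g (e, x) * w (e, x)) \<partial>I e)"
      by (simp add: algebra_simps)
    then show ?thesis using i[OF f] i[OF g] by simp
  qed
  have 2: "(\<integral>x. a (e, x) * (r * wder G f e x + s * wder G g e x) * wder G w e x \<partial>I e) =
      r * (\<integral>x. a (e, x) * wder G f e x * wder G w e x \<partial>I e) + s * (\<integral>x. a (e, x) * wder G g e x * wder G w e x \<partial>I e)"
    if e: "e \<in> E" for e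
  proof -
    have i: "integrable (I e) (\<lambda>x. a (e, x) * wder G f e x * wder G w e x)" if "f \<in> H" for f
      by (intro mult_integrable_of_squares a_mult_l2 e has_weak_deriv_l2[OF H1_graph_wder[OF that e]]
          has_weak_deriv_l2[OF H1_graph_wder[OF w e]])
    have "(\<integral>x. a (e, x) * (r * wder G f e x + s * wder G g e x) * wder G w e x \<partial>I e) =
      (\<integral>x. r * (a (e, x) * wder G f e x * wder G w e x) + s * (a (e, x) * wder G g e x * wder G w e x) \<partial>I e)"
      by (simp add: algebra_simps)
    then show ?thesis using i[OF f] i[OF g] by simp
  qed
  have 3: "vert_val G (\<lambda>p. r * f p + s * g p) v = r * vert_val G f v + s * vert_val G g v" for v
    by (simp add: vert_val_def Let_def)
  have "form (\<lambda>p. r * f p + s * g p) w = (\<Sum>e\<in>E. \<integral>x. (\<kappa> (e, x))\<^sup>2 * (r * f (e, x) + s * g (e, x)) * w (e, x) \<partial>I e) +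
     (\<Sum>e\<in>E. \<integral>x. a (e, x) * (r * wder G f e x + s * wder G g e x) * wder G w e x \<partial>I e) +
     (\<Sum>v\<in>verts G. \<alpha> * vert_val G (\<lambda>p. r * f p + s * g p) v * vert_val G w v)"
    by (rule form_eq[OF H1_graph_lincomb[OF f g] w L H1_graph_wder[OF w]])
  also have "\<dots> = (\<Sum>e\<in>E. r * (\<integral>x. (\<kappa> (e, x))\<^sup>2 * f (e, x) * w (e, x) \<partial>I e) +
        s * (\<integral>x. (\<kappa> (e, x))\<^sup>2 * g (e, x) * w (e, x) \<partial>I e)) +
     (\<Sum>e\<in>E. r * (\<integral>x. a (e, x) * wder G f e x * wder G w e x \<partial>I e) +
        s * (\<integral>x. a (e, x) * wder G g e x * wder G w e x \<partial>I e)) +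
     (\<Sum>v\<in>verts G. r * (\<alpha> * vert_val G f v * vert_val G w v) + s * (\<alpha> * vert_val G g v * vert_val G w v))"
    by (intro arg_cong2[where f = "(+)"] sum.cong refl 1 2) (simp_all add: 3 algebra_simps)
  also have "\<dots> = r * form f w + s * form g w"
    unfolding form_wder[OF f w] form_wder[OF g w]
    by (simp only: sum.distrib sum_distrib_left[symmetric] distrib_left add_ac)
  finally show ?thesis .
qed

section \<open>Coercivity of the energy form\<close>

definition mass :: "('e \<times> real \<Rightarrow> real) \<Rightarrow> real" where
  "mass f = (\<Sum>e\<in>E. \<integral>x. (f (e, x))\<^sup>2 \<partial>I e)"

definition energy :: "('e \<times> real \<Rightarrow> real) \<Rightarrow> real" where
  "energy f = (\<Sum>e\<in>E. \<integral>x. (wder G f e x)\<^sup>2 \<partial>I e)"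

lemma mass_nonneg: "0 \<le> mass f" and energy_nonneg: "0 \<le> energy f"
  unfolding mass_def energy_def by (auto intro!: sum_nonneg integral_nonneg_AE)

lemma H_l2: "f \<in> H \<Longrightarrow> f \<in> l2_space M"
  by (intro graph_l2I fin_E H1_graph_slice_l2)

lemma H_inner: "f \<in> H \<Longrightarrow> g \<in> H \<Longrightarrow> l2_inner M f g = (\<Sum>e\<in>E. \<integral>x. f (e, x) * g (e, x) \<partial>I e)"
  by (intro graph_l2_inner fin_E H1_graph_slice_l2)

lemma mass_eq: "f \<in> H \<Longrightarrow> mass f = l2_inner M f f"
  by (simp add: H_inner mass_def power2_eq_square)

lemma energy_eq:
  assumes "\<And>e. e \<in> E \<Longrightarrow> has_weak_deriv (len G e) (\<lambda>x. f (e, x)) (F e)"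
  shows "energy f = (\<Sum>e\<in>E. \<integral>x. (F e x)\<^sup>2 \<partial>I e)"
  unfolding energy_def
proof (intro sum.cong refl integral_cong_AE)
  fix e assume e: "e \<in> E"
  show "(\<lambda>x. (wder G f e x)\<^sup>2) \<in> borel_measurable (I e)" "(\<lambda>x. (F e x)\<^sup>2) \<in> borel_measurable (I e)"
    using has_weak_deriv_l2[OF weak_deriv_AE(1)[OF assms[OF e]]] has_weak_deriv_l2[OF assms[OF e]]
    unfolding l2_space_def by auto
  show "AE x in I e. (wder G f e x)\<^sup>2 = (F e x)\<^sup>2"
    using weak_deriv_AE(2)[OF assms[OF e]] by eventually_elim simp
qed

lemma degree_pos:
  assumes "v \<in> verts G"
  shows "0 < degree G v"
proof -
  obtain e where e: "e \<in> E" using edges_ne by blast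
  have "inc G v \<noteq> {}"
  proof (cases "src G e = v")
    case True
    then have "(e, False) \<in> inc G v" using e by (simp add: inc_def end_vert_def)
    then show ?thesis by blast
  next
    case False
    have "src G e \<in> verts G" using graph e unfolding compact_metric_graph_def by blast
    then obtain hs where "walk G v hs (src G e)" using conn assms unfolding connected_graph_def by blast
    then show ?thesis using False by (cases hs) auto
  qed
  moreover have "finite (inc G v)"
    by (rule finite_subset[of _ "E \<times> UNIV"]) (auto simp: inc_def fin_E)
  ultimately show ?thesis unfolding degree_def by (simp add: card_gt_0_iff)
qed

lemma d0_pos: "0 < d\<^sub>0" and d0_le: "v \<in> verts G \<Longrightarrow> d\<^sub>0 \<le> degree G v"
proof -
  have "verts G \<noteq> {}" using conn unfolding connected_graph_def by blast
  then show "0 < d\<^sub>0" unfolding d0 using fin_V degree_pos by (subst Min_gr_iff) auto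
  show "v \<in> verts G \<Longrightarrow> d\<^sub>0 \<le> degree G v" unfolding d0 using fin_V by simp
qed

abbreviation "lmin \<equiv> Min (len G ` E)"
abbreviation "lmax \<equiv> Max (len G ` E)"

lemma lmin_pos: "0 < lmin" and lmin_le: "e \<in> E \<Longrightarrow> lmin \<le> len G e" and le_lmax: "e \<in> E \<Longrightarrow> len G e \<le> lmax"
  using fin_E edges_ne len_pos by auto

text \<open>Replacing the minimal degree by the degree of each vertex distributes the vertex values
  over the incident ends. Every edge then carries two endpoint values, each estimated on a window
  that takes the share t of the edge. The two ends account for the factors 4 and 2.\<close>

lemma vertex_sum_bound:
  assumes f: "f \<in> H" and t: "0 < t" "t \<le> 1"
  shows "\<bar>\<alpha>\<bar> * (\<Sum>v\<in>verts G. (vert_val G f v)\<^sup>2) \<le> S * (4 / (t * lmin) * mass f + 2 * t * lmax * energy f)"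
proof -
  have gc: "graph_continuous G f" using f unfolding H1_graph_def by blast
  have S0: "0 \<le> S" unfolding S by simp
  have aS: "\<bar>\<alpha>\<bar> = S * real d\<^sub>0" using d0_pos unfolding S by simp
  have "\<bar>\<alpha>\<bar> * (\<Sum>v\<in>verts G. (vert_val G f v)\<^sup>2) = S * (\<Sum>v\<in>verts G. real d\<^sub>0 * (vert_val G f v)\<^sup>2)"
    by (simp add: aS sum_distrib_left mult.assoc)
  also have "\<dots> \<le> S * (\<Sum>v\<in>verts G. real (degree G v) * (vert_val G f v)\<^sup>2)"
    using S0 d0_le by (intro mult_left_mono sum_mono mult_right_mono) auto
  also have "(\<Sum>v\<in>verts G. real (degree G v) * (vert_val G f v)\<^sup>2) =
      (\<Sum>v\<in>verts G. \<Sum>h\<in>inc G v. (f (fst h, end_pos G h))\<^sup>2)"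
  proof (intro sum.cong refl)
    fix v assume v: "v \<in> verts G"
    have "(\<Sum>h\<in>inc G v. (f (fst h, end_pos G h))\<^sup>2) = (\<Sum>h\<in>inc G v. (vert_val G f v)\<^sup>2)"
      by (intro sum.cong refl) (simp only: vert_val_eq[OF gc v])
    then show "real (degree G v) * (vert_val G f v)\<^sup>2 = (\<Sum>h\<in>inc G v. (f (fst h, end_pos G h))\<^sup>2)"
      by (simp add: degree_def)
  qed
  also have "\<dots> = (\<Sum>e\<in>E. (f (e, 0))\<^sup>2 + (f (e, len G e))\<^sup>2)"
    by (subst sum_inc[OF graph]) (simp add: end_pos_def)
  also have "S * \<dots> \<le> S * (\<Sum>e\<in>E. 4 / (t * lmin) * (\<integral>x. (f (e, x))\<^sup>2 \<partial>I e) + 2 * t * lmax * (\<integral>x. (wder G f e x)\<^sup>2 \<partial>I e))"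
  proof (intro mult_left_mono S0 sum_mono)
    fix e assume e: "e \<in> E"
    let ?l = "len G e" and ?\<delta> = "t * len G e"
    define A where "A = (\<integral>x. (f (e, x))\<^sup>2 \<partial>I e)"
    define B where "B = (\<integral>x. (wder G f e x)\<^sup>2 \<partial>I e)"
    have AB: "0 \<le> A" "0 \<le> B" unfolding A_def B_def by (auto intro!: integral_nonneg_AE)
    note W = H1_graph_wder[OF f e]
    have \<delta>: "0 < ?\<delta>" "?\<delta> \<le> ?l" using t len_pos[OF e] by (auto simp: mult_le_cancel_right1)
    have i1: "integrable (I e) (\<lambda>x. (f (e, x))\<^sup>2)" and i2: "integrable (I e) (\<lambda>x. (wder G f e x)\<^sup>2)"
      using H1_graph_slice_l2[OF f e] has_weak_deriv_l2[OF W] unfolding l2_space_def by auto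
    have tr: "(f (e, x))\<^sup>2 \<le> 2 / ?\<delta> * A + ?\<delta> * B"
      if cd: "0 \<le> c" "d \<le> ?l" "d - c = ?\<delta>" and x: "x = c \<or> x = d" for c d x
    proof -
      have "(f (e, x))\<^sup>2 \<le> 2 / (d - c) * (\<integral>y. (f (e, y))\<^sup>2 \<partial>ivl c d) + (d - c) * (\<integral>y. (wder G f e y)\<^sup>2 \<partial>ivl c d)"
        using cd x \<delta> by (intro trace_bound[OF W]) auto
      also have "\<dots> \<le> 2 / (d - c) * A + (d - c) * B"
        unfolding A_def B_def using cd \<delta> i1 i2
        by (intro add_mono mult_left_mono integral_ivl_mono_set) auto
      finally show ?thesis using cd by simp
    qed
    have "4 / ?\<delta> * A + 2 * ?\<delta> * B = 2 * (2 / ?\<delta> * A + ?\<delta> * B)" by (simp add: algebra_simps)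
    moreover have "(f (e, 0))\<^sup>2 \<le> 2 / ?\<delta> * A + ?\<delta> * B" using \<delta> by (intro tr[of 0 ?\<delta>]) auto
    moreover have "(f (e, ?l))\<^sup>2 \<le> 2 / ?\<delta> * A + ?\<delta> * B" using \<delta> by (intro tr[of "?l - ?\<delta>" ?l]) auto
    ultimately have "(f (e, 0))\<^sup>2 + (f (e, ?l))\<^sup>2 \<le> 4 / ?\<delta> * A + 2 * ?\<delta> * B" by linarith
    also have "4 / ?\<delta> * A + 2 * ?\<delta> * B \<le> 4 / (t * lmin) * A + 2 * t * lmax * B"
    proof (rule add_mono)
      show "4 / ?\<delta> * A \<le> 4 / (t * lmin) * A"
        using AB t lmin_pos lmin_le[OF e] \<delta> by (intro mult_right_mono divide_left_mono mult_left_mono) auto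
      show "2 * ?\<delta> * B \<le> 2 * t * lmax * B"
        using AB t le_lmax[OF e] by (simp add: mult_right_mono mult_left_mono mult.assoc)
    qed
    finally show "(f (e, 0))\<^sup>2 + (f (e, ?l))\<^sup>2 \<le> 4 / (t * lmin) * (\<integral>x. (f (e, x))\<^sup>2 \<partial>I e) + 2 * t * lmax * (\<integral>x. (wder G f e x)\<^sup>2 \<partial>I e)"
      unfolding A_def B_def .
  qed
  also have "\<dots> = S * (4 / (t * lmin) * mass f + 2 * t * lmax * energy f)"
    by (simp add: mass_def energy_def sum.distrib sum_distrib_left)
  finally show ?thesis .
qed

lemma form_lower:
  assumes f: "f \<in> H"
  shows "\<kappa>\<^sub>0\<^sup>2 * mass f + a\<^sub>0 * energy f + \<alpha> * (\<Sum>v\<in>verts G. (vert_val G f v)\<^sup>2) \<le> form f f"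
proof -
  have "(\<kappa>\<^sub>0\<^sup>2 * (\<integral>x. (f (e, x))\<^sup>2 \<partial>I e)) \<le> (\<integral>x. (\<kappa> (e, x))\<^sup>2 * f (e, x) * f (e, x) \<partial>I e)" if e: "e \<in> E" for e
  proof -
    have "(\<integral>x. \<kappa>\<^sub>0\<^sup>2 * (f (e, x))\<^sup>2 \<partial>I e) \<le> (\<integral>x. (\<kappa> (e, x))\<^sup>2 * f (e, x) * f (e, x) \<partial>I e)"
    proof (rule integral_mono_AE)
      show "integrable (I e) (\<lambda>x. \<kappa>\<^sub>0\<^sup>2 * (f (e, x))\<^sup>2)"
        using H1_graph_slice_l2[OF f e] unfolding l2_space_def by auto
      show "integrable (I e) (\<lambda>x. (\<kappa> (e, x))\<^sup>2 * f (e, x) * f (e, x))"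
        by (intro mult_integrable_of_squares kappa_mult_l2 H1_graph_slice_l2 f e)
      show "AE x in I e. \<kappa>\<^sub>0\<^sup>2 * (f (e, x))\<^sup>2 \<le> (\<kappa> (e, x))\<^sup>2 * f (e, x) * f (e, x)"
        using graph_AE[OF fin_E kappa_ge e]
      proof eventually_elim
        case (elim x)
        then have "\<kappa>\<^sub>0\<^sup>2 \<le> (\<kappa> (e, x))\<^sup>2" using kappa0 by (intro power_mono) auto
        then have "\<kappa>\<^sub>0\<^sup>2 * (f (e, x))\<^sup>2 \<le> (\<kappa> (e, x))\<^sup>2 * (f (e, x))\<^sup>2" by (rule mult_right_mono) simp
        then show ?case by (simp add: power2_eq_square mult.assoc)
      qed
    qed
    then show ?thesis by simp
  qed
  moreover have "a\<^sub>0 * (\<integral>x. (wder G f e x)\<^sup>2 \<partial>I e) \<le> (\<integral>x. a (e, x) * wder G f e x * wder G f e x \<partial>I e)"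
    if e: "e \<in> E" for e
  proof -
    note W = has_weak_deriv_l2[OF H1_graph_wder[OF f e]]
    have "(\<integral>x. a\<^sub>0 * (wder G f e x)\<^sup>2 \<partial>I e) \<le> (\<integral>x. a (e, x) * wder G f e x * wder G f e x \<partial>I e)"
    proof (rule integral_mono_AE)
      show "integrable (I e) (\<lambda>x. a\<^sub>0 * (wder G f e x)\<^sup>2)" using W unfolding l2_space_def by auto
      show "integrable (I e) (\<lambda>x. a (e, x) * wder G f e x * wder G f e x)"
        by (intro mult_integrable_of_squares a_mult_l2 W e)
      show "AE x in I e. a\<^sub>0 * (wder G f e x)\<^sup>2 \<le> a (e, x) * wder G f e x * wder G f e x"
      proof (rule AE_I2)
        fix x assume "x \<in> space (I e)"
        then have "a\<^sub>0 \<le> a (e, x)" using e by (intro a_ge) (simp add: points_def)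
        then have "a\<^sub>0 * (wder G f e x)\<^sup>2 \<le> a (e, x) * (wder G f e x)\<^sup>2" by (rule mult_right_mono) simp
        then show "a\<^sub>0 * (wder G f e x)\<^sup>2 \<le> a (e, x) * wder G f e x * wder G f e x"
          by (simp add: power2_eq_square mult.assoc)
      qed
    qed
    then show ?thesis by simp
  qed
  ultimately show ?thesis
    unfolding form_wder[OF f f] mass_def energy_def sum_distrib_left
    by (intro add_mono sum_mono) (auto simp: power2_eq_square mult.assoc)
qed

lemma form_coercive:
  obtains c where "0 < c" "\<And>f. f \<in> H \<Longrightarrow> c * (mass f + energy f) \<le> form f f"
proof (cases "0 \<le> \<alpha>")
  case True
  define c where "c = min (\<kappa>\<^sub>0\<^sup>2) a\<^sub>0"
  show ?thesis
  proof (rule that[of c])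
    show "0 < c" using kappa0 a0_pos unfolding c_def by simp
    fix f assume f: "f \<in> H"
    have "c * mass f \<le> \<kappa>\<^sub>0\<^sup>2 * mass f" "c * energy f \<le> a\<^sub>0 * energy f"
      unfolding c_def using mass_nonneg energy_nonneg by (auto intro!: mult_right_mono)
    moreover have "0 \<le> \<alpha> * (\<Sum>v\<in>verts G. (vert_val G f v)\<^sup>2)"
      using True by (intro mult_nonneg_nonneg sum_nonneg) auto
    ultimately show "c * (mass f + energy f) \<le> form f f"
      using form_lower[OF f] by (simp add: distrib_left)
  qed
next
  case False
  \<comment> \<open>The vertex terms consume at most the fraction q/t of the mass and the fraction t
    of the energy. The strict half of the smallness condition gives q < 1, so the midpoint t of q
    and 1 leaves a positive part of both; t = 1 would not, since the other half of the condition is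
    not strict.\<close>
  define q where "q = 4 * S / lmin / \<kappa>\<^sub>0\<^sup>2"
  define t where "t = (1 + q) / 2"
  have S0: "0 \<le> S" unfolding S by simp
  have cond: "4 * S / lmin < \<kappa>\<^sub>0\<^sup>2" "2 * S * lmax \<le> a\<^sub>0" using alpha False by auto
  have q: "0 \<le> q" "q < 1" using S0 lmin_pos kappa0 cond(1) unfolding q_def by (auto simp: divide_less_eq mult.commute)
  have t: "0 < t" "t < 1" "q < t" using q unfolding t_def by auto
  define c1 where "c1 = \<kappa>\<^sub>0\<^sup>2 * (1 - q / t)"
  define c2 where "c2 = a\<^sub>0 * (1 - t)"
  define c where "c = min c1 c2"
  have c: "0 < c" using t kappa0 a0_pos unfolding c_def c1_def c2_def by (auto simp: divide_less_eq)
  show ?thesis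
  proof (rule that[OF c])
    fix f assume f: "f \<in> H"
    have q4: "S * (4 / (t * lmin)) = \<kappa>\<^sub>0\<^sup>2 * (q / t)"
      using kappa0 unfolding q_def by (simp add: field_simps)
    have "S * (2 * t * lmax) = t * (2 * S * lmax)" by simp
    also have "\<dots> \<le> t * a\<^sub>0" using t cond by (intro mult_left_mono) auto
    finally have e: "S * (2 * t * lmax) * energy f \<le> t * a\<^sub>0 * energy f"
      by (intro mult_right_mono energy_nonneg)
    have "\<bar>\<alpha>\<bar> * (\<Sum>v\<in>verts G. (vert_val G f v)\<^sup>2) \<le> S * (4 / (t * lmin)) * mass f + S * (2 * t * lmax) * energy f"
      using vertex_sum_bound[OF f, of t] t by (simp only: distrib_left mult.assoc)
    also have "\<dots> \<le> \<kappa>\<^sub>0\<^sup>2 * (q / t) * mass f + t * a\<^sub>0 * energy f" using e unfolding q4 by simp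
    finally have "c1 * mass f + c2 * energy f \<le> form f f"
      using form_lower[OF f] False unfolding c1_def c2_def by (simp add: algebra_simps)
    moreover have "c * mass f \<le> c1 * mass f" "c * energy f \<le> c2 * energy f"
      unfolding c_def using mass_nonneg energy_nonneg by (auto intro!: mult_right_mono)
    ultimately show "c * (mass f + energy f) \<le> form f f" by (simp add: distrib_left)
  qed
qed

text \<open>For negative \<alpha> nonnegativity is not visible in the form itself; it comes from
  coercivity.\<close>

lemma form_semi_inner: "semi_inner H form"
proof
  obtain c where c: "0 < c" "\<And>f. f \<in> H \<Longrightarrow> c * (mass f + energy f) \<le> form f f" by (rule form_coercive) blast
  fix f g k :: "'e \<times> real \<Rightarrow> real" and r :: real
  show z: "(\<lambda>_. 0) \<in> H"
    using has_weak_deriv_const[of _ 0] unfolding H1_graph_def graph_continuous_def H1_interval_def by auto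
  show "(\<lambda>x. f x + g x) \<in> H" if "f \<in> H" "g \<in> H"
    using H1_graph_lincomb[OF that, of 1 1] by simp
  show "(\<lambda>x. r * f x) \<in> H" if "f \<in> H"
    using H1_graph_lincomb[OF that that, of r 0] by simp
  show "form f g = form g f" if "f \<in> H" "g \<in> H" using that by (rule form_sym)
  show "form (\<lambda>x. f x + g x) k = form f k + form g k" if "f \<in> H" "g \<in> H" "k \<in> H"
    using form_lincomb[OF that, of 1 1] by simp
  show "form (\<lambda>x. r * f x) k = r * form f k" if "f \<in> H" "k \<in> H"
    using form_lincomb[OF that(1) that(1) that(2), of r 0] by simp
  show "0 \<le> form f f" if "f \<in> H"
    using c(2)[OF that] c(1) mass_nonneg[of f] energy_nonneg[of f]
    by (meson add_nonneg_nonneg less_imp_le mult_nonneg_nonneg order_trans)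
qed

text \<open>A window of length 1/\<tau> with the given point at one end fits into the edge on one
  side or the other, because it is at most half the edge. The two coefficients are those that
  combine to t^2 + \<nu> in a resolvent when \<tau> = t.\<close>

lemma H_point_bound:
  assumes f: "f \<in> H" and p: "p \<in> points G" and \<tau>: "2 / lmin \<le> \<tau>"
  shows "(f p)\<^sup>2 \<le> 2 * \<tau> * mass f + energy f / \<tau>"
proof -
  obtain e x where px: "p = (e, x)" and e: "e \<in> E" and x: "x \<in> {0..len G e}"
    using p unfolding points_def by auto
  define \<delta> where "\<delta> = 1 / \<tau>"
  have \<tau>0: "0 < \<tau>" using \<tau> lmin_pos by (smt (verit) divide_pos_pos)
  have \<delta>: "0 < \<delta>" "\<delta> \<le> len G e / 2"
  proof -
    have "2 \<le> \<tau> * lmin" using \<tau> lmin_pos by (simp add: divide_le_eq)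
    also have "\<dots> \<le> \<tau> * len G e" using \<tau>0 lmin_le[OF e] by (intro mult_left_mono) auto
    finally show "0 < \<delta>" "\<delta> \<le> len G e / 2" using \<tau>0 unfolding \<delta>_def by (auto simp: field_simps)
  qed
  obtain c d where cd: "0 \<le> c" "d \<le> len G e" "d - c = \<delta>" "x = c \<or> x = d"
  proof (cases "x + \<delta> \<le> len G e")
    case True
    then show ?thesis using that[of x "x + \<delta>"] x by auto
  next
    case False
    then show ?thesis using that[of "x - \<delta>" x] x \<delta> by auto
  qed
  note W = H1_graph_wder[OF f e]
  have i1: "integrable (I e) (\<lambda>x. (f (e, x))\<^sup>2)" and i2: "integrable (I e) (\<lambda>x. (wder G f e x)\<^sup>2)"
    using H1_graph_slice_l2[OF f e] has_weak_deriv_l2[OF W] unfolding l2_space_def by auto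
  have "(f (e, x))\<^sup>2 \<le> 2 / (d - c) * (\<integral>y. (f (e, y))\<^sup>2 \<partial>ivl c d) + (d - c) * (\<integral>y. (wder G f e y)\<^sup>2 \<partial>ivl c d)"
    using cd \<delta> by (intro trace_bound[OF W]) auto
  also have "\<dots> \<le> 2 / (d - c) * (\<integral>y. (f (e, y))\<^sup>2 \<partial>I e) + (d - c) * (\<integral>y. (wder G f e y)\<^sup>2 \<partial>I e)"
    using cd \<delta> i1 i2 by (intro add_mono mult_left_mono integral_ivl_mono_set) auto
  also have "\<dots> \<le> 2 / (d - c) * mass f + (d - c) * energy f"
    unfolding mass_def energy_def using cd \<delta> e fin_E
    by (intro add_mono mult_left_mono member_le_sum[of e E]) (auto intro!: integral_nonneg_AE)
  finally show ?thesis using cd(3) \<tau>0 unfolding px \<delta>_def by simp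
qed

end

section \<open>Regularity and nodal interpolation\<close>

lemma mesh_pieces_cover:
  fixes l h :: real and N :: nat
  assumes "0 < N" "0 < h" "real N * h = l" "x \<in> {0..l}"
  obtains i where "i < N" "x \<in> {real i * h..real (Suc i) * h}"
proof (cases "x = l")
  case True
  have "real (N - 1) * h \<le> l" using assms by (auto simp: of_nat_diff algebra_simps)
  then show ?thesis using that[of "N - 1"] assms True by auto
next
  case False
  define i where "i = nat \<lfloor>x / h\<rfloor>"
  have q: "0 \<le> x / h" using assms by simp
  have i: "real i \<le> x / h" "x / h < real i + 1"
    unfolding i_def using q by (auto simp: of_nat_nat)
  then have ix: "real i * h \<le> x" "x \<le> real (Suc i) * h" using assms by (auto simp: field_simps)
  have "real i * h < real N * h" using ix assms False by auto
  then have "i < N" using mult_less_cancel_right_pos[OF assms(2)] by simp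
  then show ?thesis using that ix by auto
qed

lemma integral_ivl_pieces:
  fixes F :: "real \<Rightarrow> real"
  assumes "integrable (ivl 0 (real N * h)) F" "0 \<le> h"
  shows "(\<integral>x. F x \<partial>ivl 0 (real N * h)) = (\<Sum>i<N. \<integral>x. F x \<partial>ivl (real i * h) (real (Suc i) * h))"
  using assms
proof (induction N)
  case 0
  then show ?case using integral_ivl_singleton[of 0 F] by simp
next
  case (Suc N)
  have le: "real N * h \<le> real (Suc N) * h" using Suc.prems(2) by (simp add: distrib_right)
  have "integrable (ivl 0 (real N * h)) F"
    using integrable_ivl_sub[OF Suc.prems(1) order_refl le] .
  with Suc.IH Suc.prems(2) integral_ivl_split[OF Suc.prems(1) _ le] show ?case by simp
qed

text \<open>The largest slope is a Lipschitz constant, as the cells are closed and cover the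
  interval. Finite element functions become Sobolev functions this way, without gluing derivatives
  across nodes.\<close>

lemma piecewise_affine_lipschitz:
  fixes f :: "real \<Rightarrow> real"
  assumes N: "0 < N" and h: "0 < h" and l: "real N * h = l"
    and aff: "\<And>i. i < N \<Longrightarrow> \<exists>c d. \<forall>x\<in>{real i * h..real (Suc i) * h}. f x = c + d * x"
  obtains L where "L-lipschitz_on {0..l} f"
proof -
  obtain c d where cd: "\<And>i x. i < N \<Longrightarrow> x \<in> {real i * h..real (Suc i) * h} \<Longrightarrow> f x = c i + d i * x"
    using aff by metis
  define L where "L = Max ((\<lambda>i. \<bar>d i\<bar>) ` {..<N})"
  have dL: "\<bar>d i\<bar> \<le> L" if "i < N" for i unfolding L_def using that by (intro Max_ge) auto
  have "L-lipschitz_on {0..l} f"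
  proof (rule lipschitz_on_closed_Union[where I = "{..<N}" and U = "\<lambda>i. {real i * h..real (Suc i) * h}"])
    show "0 \<le> L" using dL[OF N] by linarith
    then show "L-lipschitz_on {real i * h..real (Suc i) * h} f" if "i \<in> {..<N}" for i
    proof (rule lipschitz_onI[rotated])
      fix x y assume xy: "x \<in> {real i * h..real (Suc i) * h}" "y \<in> {real i * h..real (Suc i) * h}"
      have "f x - f y = d i * (x - y)" using cd[of i x] cd[of i y] xy that by (simp add: algebra_simps)
      then show "dist (f x) (f y) \<le> L * dist x y"
        using dL[of i] that by (simp add: dist_real_def abs_mult mult_right_mono)
    qed
    show "{0..l} \<subseteq> (\<Union>i\<in>{..<N}. {real i * h..real (Suc i) * h})"
    proof
      fix x assume "x \<in> {0..l}"
      then obtain i where "i < N" "x \<in> {real i * h..real (Suc i) * h}"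
        using mesh_pieces_cover[OF N h l] by blast
      then show "x \<in> (\<Union>i\<in>{..<N}. {real i * h..real (Suc i) * h})" by blast
    qed
  qed auto
  with that show ?thesis .
qed

lemma affine_weak_deriv_AE:
  assumes g: "has_weak_deriv l f g" and cd: "0 \<le> c" "c \<le> d" "d \<le> l"
    and aff: "\<And>x. x \<in> {c..d} \<Longrightarrow> f x = f c + (x - c) * m"
  shows "AE x in ivl c d. g x = m"
proof -
  have "AE x in ivl c d. g x - m = 0"
  proof (rule integral_ivl_eq_zero_imp_AE)
    interpret finite_measure "ivl c d" by (rule finite_measure_ivl)
    show "integrable (ivl c d) (\<lambda>x. g x - m)" using has_weak_deriv_integrable[OF g] cd by simp
    fix x assume x: "x \<in> {c..d}"
    interpret x: finite_measure "ivl c x" by (rule finite_measure_ivl)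
    have "(\<integral>y. g y - m \<partial>ivl c x) = (f x - f c) - (x - c) * m"
      using has_weak_deriv_integrable[OF g, of c x] has_weak_deriv_diff_eq[OF g, of c x] x cd
      by (simp add: measure_ivl)
    then show "(\<integral>y. g y - m \<partial>ivl c x) = 0" using aff[OF x] by simp
  qed
  then show ?thesis by eventually_elim simp
qed

text \<open>The floor assigns a node to the cell on its right, where the affine factor is 0. At the
  far end of an edge this cell lies outside the edge; the value of \<open>u\<close> that it mentions
  is multiplied by 0.\<close>

definition nodal_interp ::
    "('v, 'e) metric_graph \<Rightarrow> ('e \<Rightarrow> nat) \<Rightarrow> ('e \<times> real \<Rightarrow> real) \<Rightarrow> 'e \<times> real \<Rightarrow> real" where
  "nodal_interp G n u = (\<lambda>(e, x).
     let h = mesh_width G n e; i = real (nat \<lfloor>x / h\<rfloor>)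
     in u (e, i * h) + (x - i * h) * ((u (e, (i + 1) * h) - u (e, i * h)) / h))"

lemma nodal_interp_piece:
  assumes h: "0 < mesh_width G n e"
    and x: "x \<in> {real i * mesh_width G n e..real (Suc i) * mesh_width G n e}"
  shows "nodal_interp G n u (e, x) = u (e, real i * mesh_width G n e) + (x - real i * mesh_width G n e) *
     ((u (e, real (Suc i) * mesh_width G n e) - u (e, real i * mesh_width G n e)) / mesh_width G n e)"
proof -
  let ?h = "mesh_width G n e"
  show ?thesis
  proof (cases "x = real (Suc i) * ?h")
    case True
    have "nat \<lfloor>x / ?h\<rfloor> = Suc i" unfolding True using h by (simp add: nat_add_distrib)
    then have "nodal_interp G n u (e, x) = u (e, real (Suc i) * ?h)"
      using True by (simp add: nodal_interp_def Let_def)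
    moreover have "x - real i * ?h = ?h" using True by (simp add: algebra_simps)
    ultimately show ?thesis using h by simp
  next
    case False
    have "\<lfloor>x / ?h\<rfloor> = int i"
      using x False h by (intro floor_unique) (auto simp: field_simps)
    then show ?thesis by (simp add: nodal_interp_def Let_def algebra_simps)
  qed
qed

context graph_problem
begin

sublocale form: semi_inner H form
  by (rule form_semi_inner)

sublocale L: semi_inner "l2_space M" "l2_inner M"
  by (rule l2_semi_inner)

text \<open>A weak derivative of the coefficient allows the flux a u' to be expanded by the product
  rule, as the second-order bound requires.\<close>

lemma a_H: "a \<in> H"
proof -
  have "(\<lambda>x. a (e, x)) \<in> H1_interval (len G e)" if "e \<in> E" for e
  proof -
    obtain K where "\<And>e. e \<in> E \<Longrightarrow> K-lipschitz_on {0..len G e} (\<lambda>x. a (e, x))"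
      using a_edge_lipschitz by metis
    then show ?thesis
      using that lipschitz_has_weak_deriv[of K "len G e" "\<lambda>x. a (e, x)"] unfolding H1_interval_def by blast
  qed
  then show ?thesis using a_continuous unfolding H1_graph_def by simp
qed

lemma a_wder_bounded:
  obtains K where "0 \<le> K" "\<And>e. e \<in> E \<Longrightarrow> AE x in I e. \<bar>wder G a e x\<bar> \<le> K"
proof -
  obtain K where K: "0 \<le> K" "\<And>e. e \<in> E \<Longrightarrow> K-lipschitz_on {0..len G e} (\<lambda>x. a (e, x))"
    using a_edge_lipschitz by metis
  show ?thesis
  proof (rule that[of "K + 1"])
    fix e assume e: "e \<in> E"
    obtain g where g: "has_weak_deriv (len G e) (\<lambda>x. a (e, x)) g" "\<And>x. \<bar>g x\<bar> \<le> K + 1"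
      using lipschitz_has_weak_deriv[OF K(2)[OF e]] by metis
    show "AE x in I e. \<bar>wder G a e x\<bar> \<le> K + 1"
      using weak_deriv_AE(2)[OF g(1)] by eventually_elim (simp add: g(2))
  qed (use K in simp)
qed

lemma a_bounded:
  obtains K where "0 \<le> K" "\<And>p. p \<in> points G \<Longrightarrow> a p \<le> K"
proof -
  have "\<exists>K. \<forall>x\<in>{0..len G e}. a (e, x) \<le> K" if "e \<in> E" for e
  proof -
    have "continuous_on {0..len G e} (\<lambda>x. a (e, x))"
      using a_continuous that unfolding graph_continuous_def by blast
    then obtain K where "\<And>x. x \<in> {0..len G e} \<Longrightarrow> \<bar>a (e, x)\<bar> \<le> K"
      by (rule continuous_ivl_bounded_measurable) blast
    then show ?thesis by (meson abs_le_D1)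
  qed
  then obtain K where K: "\<And>e x. e \<in> E \<Longrightarrow> x \<in> {0..len G e} \<Longrightarrow> a (e, x) \<le> K e" by metis
  show ?thesis
  proof (rule that[of "\<Sum>e\<in>E. \<bar>K e\<bar>"])
    fix p assume "p \<in> points G"
    then obtain e x where p: "p = (e, x)" "e \<in> E" "x \<in> {0..len G e}" unfolding points_def by auto
    have "a p \<le> \<bar>K e\<bar>" using K[OF p(2,3)] p(1) by simp
    also have "\<dots> \<le> (\<Sum>e\<in>E. \<bar>K e\<bar>)" using p fin_E by (intro member_le_sum) auto
    finally show "a p \<le> (\<Sum>e\<in>E. \<bar>K e\<bar>)" .
  qed (auto intro: sum_nonneg)
qed

text \<open>The equation in nondivergence form, from which u'' can be isolated. \<open>u1\<close>
  and \<open>u2\<close> are the first and second derivatives, edge by edge.\<close>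

definition strong_solution where
  "strong_solution u f u1 u2 \<longleftrightarrow> (\<forall>e\<in>E. has_weak_deriv (len G e) (\<lambda>x. u (e, x)) (u1 e) \<and>
     has_weak_deriv (len G e) (u1 e) (u2 e) \<and>
     (AE x in I e. a (e, x) * u2 e x + wder G a e x * u1 e x = (\<kappa> (e, x))\<^sup>2 * u (e, x) - f (e, x)))"

lemma strong_solutionD:
  assumes "strong_solution u f u1 u2" "e \<in> E"
  shows "has_weak_deriv (len G e) (\<lambda>x. u (e, x)) (u1 e)" "has_weak_deriv (len G e) (u1 e) (u2 e)"
    "AE x in I e. a (e, x) * u2 e x + wder G a e x * u1 e x = (\<kappa> (e, x))\<^sup>2 * u (e, x) - f (e, x)"
  using assms unfolding strong_solution_def by auto

text \<open>The weak equation encodes the vertex conditions, the strong one gives access to u''. The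
  data lie in \<open>H\<close> because they will be finite combinations of eigenfunctions; the
  notion is linear in the pair, so it passes from eigenfunctions to such combinations.\<close>

definition regular_solution :: "('e \<times> real \<Rightarrow> real) \<Rightarrow> ('e \<times> real \<Rightarrow> real) \<Rightarrow> bool" where
  "regular_solution u f \<longleftrightarrow> u \<in> H \<and> f \<in> H \<and> (\<forall>w\<in>H. form u w = l2_inner M f w) \<and>
     (\<exists>u1 u2. strong_solution u f u1 u2)"

lemma regular_solution_lincomb:
  assumes "regular_solution u f" "regular_solution v g"
  shows "regular_solution (\<lambda>p. r * u p + s * v p) (\<lambda>p. r * f p + s * g p)"
proof -
  from assms obtain u1 u2 v1 v2
    where u: "u \<in> H" "f \<in> H" "\<And>w. w \<in> H \<Longrightarrow> form u w = l2_inner M f w" and us: "strong_solution u f u1 u2"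
      and v: "v \<in> H" "g \<in> H" "\<And>w. w \<in> H \<Longrightarrow> form v w = l2_inner M g w" and vs: "strong_solution v g v1 v2"
    unfolding regular_solution_def by blast
  note U = strong_solutionD[OF us] and V = strong_solutionD[OF vs]
  show ?thesis
    unfolding regular_solution_def
  proof (intro conjI ballI exI)
    show "(\<lambda>p. r * u p + s * v p) \<in> H" "(\<lambda>p. r * f p + s * g p) \<in> H"
      using u v by (auto intro: H1_graph_lincomb)
    show "form (\<lambda>p. r * u p + s * v p) w = l2_inner M (\<lambda>p. r * f p + s * g p) w" if "w \<in> H" for w
      using u v that form_lincomb[OF u(1) v(1) that]
      by (simp add: L.add_left L.scale_left L.scale_mem H_l2)
    show "strong_solution (\<lambda>p. r * u p + s * v p) (\<lambda>p. r * f p + s * g p)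
        (\<lambda>e x. r * u1 e x + s * v1 e x) (\<lambda>e x. r * u2 e x + s * v2 e x)"
      unfolding strong_solution_def
    proof (intro ballI conjI)
      fix e assume e: "e \<in> E"
      show "has_weak_deriv (len G e) (\<lambda>x. r * u (e, x) + s * v (e, x)) (\<lambda>x. r * u1 e x + s * v1 e x)"
        "has_weak_deriv (len G e) (\<lambda>x. r * u1 e x + s * v1 e x) (\<lambda>x. r * u2 e x + s * v2 e x)"
        by (intro has_weak_deriv_lincomb U V e)+
      show "AE x in I e. a (e, x) * (r * u2 e x + s * v2 e x) + wder G a e x * (r * u1 e x + s * v1 e x) =
           (\<kappa> (e, x))\<^sup>2 * (r * u (e, x) + s * v (e, x)) - (r * f (e, x) + s * g (e, x))"
        using U(3)[OF e] V(3)[OF e]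
      proof eventually_elim
        case (elim x)
        have "a (e, x) * (r * u2 e x + s * v2 e x) + wder G a e x * (r * u1 e x + s * v1 e x) =
          r * (a (e, x) * u2 e x + wder G a e x * u1 e x) + s * (a (e, x) * v2 e x + wder G a e x * v1 e x)"
          by (simp add: algebra_simps)
        then show ?case unfolding elim by (simp add: algebra_simps)
      qed
    qed
  qed
qed

lemma regular_solution_zero: "regular_solution (\<lambda>_. 0) (\<lambda>_. 0)"
proof -
  show ?thesis
    unfolding regular_solution_def strong_solution_def
    using form.zero_mem has_weak_deriv_const[of _ 0]
    by (auto simp: form.zero_left L.zero_left H_l2 intro!: exI[of _ "\<lambda>_ _. 0"])
qed

lemma regular_solution_sum:
  assumes "finite J" "\<And>j. j \<in> J \<Longrightarrow> regular_solution (u j) (f j)"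
  shows "regular_solution (\<lambda>p. \<Sum>j\<in>J. b j * u j p) (\<lambda>p. \<Sum>j\<in>J. b j * f j p)"
  using assms
proof (induction J rule: finite_induct)
  case (insert i J)
  then show ?case using regular_solution_lincomb[of "u i" "f i" _ _ "b i" 1] by simp
qed (simp add: regular_solution_zero)

text \<open>Integration by parts on each edge leaves boundary fluxes. Grouped by vertices, they are
  evaluated by the generalized Kirchhoff condition and cancel the vertex terms of the form.\<close>

lemma eigenfunction_regular:
  assumes dom: "u \<in> op_domain G a \<alpha>" and eig: "AE p in M. graph_op G a \<kappa> u p = \<mu> * u p"
  shows "regular_solution u (\<lambda>p. \<mu> * u p)"
proof -
  have gc: "graph_continuous G u"
    and kir: "\<And>v. v \<in> verts G \<Longrightarrow> vert_val G a v * (\<Sum>h\<in>inc G v. outgoing_deriv G u h) = \<alpha> * vert_val G u v"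
    using dom unfolding op_domain_def by auto
  have "\<forall>e\<in>E. \<exists>g k. has_weak_deriv (len G e) (\<lambda>x. u (e, x)) g \<and> has_weak_deriv (len G e) g k"
    using dom unfolding op_domain_def H2_interval_def H1_interval_def by blast
  then obtain u1 u2 where u1: "\<And>e. e \<in> E \<Longrightarrow> has_weak_deriv (len G e) (\<lambda>x. u (e, x)) (u1 e)"
    and u2: "\<And>e. e \<in> E \<Longrightarrow> has_weak_deriv (len G e) (u1 e) (u2 e)"
    by metis
  have uH: "u \<in> H" using gc u1 unfolding H1_graph_def H1_interval_def by blast
  \<comment> \<open>The first derivative is itself Sobolev, hence continuous, so it coincides with
    the classical derivative everywhere, including the ends where the vertex condition reads
    it.\<close>
  have ed: "edge_deriv G u (e, x) = u1 e x" if "e \<in> E" "x \<in> {0..len G e}" for e x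
    unfolding edge_deriv_def using that len_pos[of e]
      has_weak_deriv_vector_derivative[OF u1[OF that(1)] has_weak_deriv_continuous[OF u2[OF that(1)]] that(2)]
    by (auto intro!: vector_derivative_within_closed_interval)
  define q where "q e x = a (e, x) * u2 e x + wder G a e x * u1 e x" for e x
  have q: "has_weak_deriv (len G e) (\<lambda>x. a (e, x) * u1 e x) (q e)" if "e \<in> E" for e
    unfolding q_def using has_weak_deriv_mult[OF H1_graph_wder[OF a_H that] u2[OF that]] .
  have eq: "AE x in I e. q e x = (\<kappa> (e, x))\<^sup>2 * u (e, x) - \<mu> * u (e, x)" if e: "e \<in> E" for e
  proof -
    have "has_weak_deriv (len G e) (\<lambda>y. a (e, y) * edge_deriv G u (e, y)) (q e)"
      using len_pos[OF e] ed[OF e] by (intro has_weak_deriv_cong[OF q[OF e]]) auto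
    from weak_deriv_AE(2)[OF this] graph_AE[OF fin_E eig e] show ?thesis
      by eventually_elim (simp add: graph_op_def)
  qed
  have weak: "form u w = l2_inner M (\<lambda>p. \<mu> * u p) w" if w: "w \<in> H" for w
  proof -
    note W = H1_graph_wder[OF w]
    have gw: "graph_continuous G w" using w unfolding H1_graph_def by blast
    define b where "b e x = a (e, x) * u1 e x * w (e, x)" for e x
    have part: "(\<integral>x. (\<kappa> (e, x))\<^sup>2 * u (e, x) * w (e, x) \<partial>I e) + (\<integral>x. a (e, x) * u1 e x * wder G w e x \<partial>I e)
        = b e (len G e) - b e 0 + \<mu> * (\<integral>x. u (e, x) * w (e, x) \<partial>I e)" if e: "e \<in> E" for e
    proof -
      have i1: "integrable (I e) (\<lambda>x. a (e, x) * u1 e x * wder G w e x)"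
        by (intro mult_integrable_of_squares a_mult_l2 e has_weak_deriv_l2[OF u1] has_weak_deriv_l2[OF W])
      have i2: "integrable (I e) (\<lambda>x. q e x * w (e, x))"
        by (intro mult_integrable_of_squares has_weak_deriv_l2[OF q] H1_graph_slice_l2 w e)
      have i3: "integrable (I e) (\<lambda>x. (\<kappa> (e, x))\<^sup>2 * u (e, x) * w (e, x))"
        by (intro mult_integrable_of_squares kappa_mult_l2 H1_graph_slice_l2 w uH e)
      have i4: "integrable (I e) (\<lambda>x. u (e, x) * w (e, x))"
        by (intro mult_integrable_of_squares H1_graph_slice_l2 w uH e)
      have "(\<integral>x. a (e, x) * u1 e x * wder G w e x \<partial>I e) + (\<integral>x. q e x * w (e, x) \<partial>I e) = b e (len G e) - b e 0"
        using integration_by_parts_ivl[OF q[OF e] W[OF e]] len_pos[OF e] i1 i2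
        by (simp add: b_def)
      moreover have "(\<integral>x. q e x * w (e, x) \<partial>I e) =
          (\<integral>x. (\<kappa> (e, x))\<^sup>2 * u (e, x) * w (e, x) - \<mu> * (u (e, x) * w (e, x)) \<partial>I e)"
      proof (rule integral_cong_AE)
        show "AE x in I e. q e x * w (e, x) = (\<kappa> (e, x))\<^sup>2 * u (e, x) * w (e, x) - \<mu> * (u (e, x) * w (e, x))"
          using eq[OF e]
        proof eventually_elim
          case (elim x)
          show ?case unfolding elim by (simp add: algebra_simps)
        qed
      qed (use i2 i3 i4 in auto)
      moreover have "\<dots> = (\<integral>x. (\<kappa> (e, x))\<^sup>2 * u (e, x) * w (e, x) \<partial>I e) - \<mu> * (\<integral>x. u (e, x) * w (e, x) \<partial>I e)"
        using i3 i4 by simp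
      ultimately show ?thesis by simp
    qed
    have bd: "(\<Sum>e\<in>E. b e (len G e) - b e 0) = - (\<Sum>v\<in>verts G. \<alpha> * vert_val G u v * vert_val G w v)"
    proof -
      \<comment> \<open>The flux leaving the vertex of the end h, times the test function. The sign
        in \<open>outgoing_deriv\<close> makes b(len) - b(0) the negative of the sum over both
        ends.\<close>
      define F where "F h = a (fst h, end_pos G h) * outgoing_deriv G u h * w (fst h, end_pos G h)" for h
      have "(\<Sum>e\<in>E. b e (len G e) - b e 0) = - (\<Sum>e\<in>E. F (e, False) + F (e, True))"
        unfolding sum_negf[symmetric]
      proof (intro sum.cong refl)
        fix e assume e: "e \<in> E"
        then show "b e (len G e) - b e 0 = - (F (e, False) + F (e, True))"
          using ed[OF e] len_pos[OF e] by (simp add: F_def b_def outgoing_deriv_def end_pos_def)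
      qed
      also have "(\<Sum>e\<in>E. F (e, False) + F (e, True)) = (\<Sum>v\<in>verts G. \<Sum>h\<in>inc G v. F h)"
        by (rule sum_inc[OF graph, symmetric])
      also have "\<dots> = (\<Sum>v\<in>verts G. \<alpha> * vert_val G u v * vert_val G w v)"
      proof (intro sum.cong refl)
        fix v assume v: "v \<in> verts G"
        have "(\<Sum>h\<in>inc G v. F h) = (\<Sum>h\<in>inc G v. vert_val G a v * outgoing_deriv G u h * vert_val G w v)"
          unfolding F_def
          by (intro sum.cong refl) (simp only: vert_val_eq[OF a_continuous v] vert_val_eq[OF gw v])
        also have "\<dots> = (vert_val G a v * (\<Sum>h\<in>inc G v. outgoing_deriv G u h)) * vert_val G w v"
          by (simp add: sum_distrib_left sum_distrib_right)
        finally show "(\<Sum>h\<in>inc G v. F h) = \<alpha> * vert_val G u v * vert_val G w v"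
          using kir[OF v] by simp
      qed
      finally show ?thesis .
    qed
    have "form u w = (\<Sum>e\<in>E. (\<integral>x. (\<kappa> (e, x))\<^sup>2 * u (e, x) * w (e, x) \<partial>I e) +
        (\<integral>x. a (e, x) * u1 e x * wder G w e x \<partial>I e)) + (\<Sum>v\<in>verts G. \<alpha> * vert_val G u v * vert_val G w v)"
      using form_eq[OF uH w u1 W] by (simp add: sum.distrib)
    also have "\<dots> = (\<Sum>e\<in>E. b e (len G e) - b e 0 + \<mu> * (\<integral>x. u (e, x) * w (e, x) \<partial>I e)) +
        (\<Sum>v\<in>verts G. \<alpha> * vert_val G u v * vert_val G w v)"
      by (simp add: part cong: sum.cong)
    also have "\<dots> = \<mu> * (\<Sum>e\<in>E. \<integral>x. u (e, x) * w (e, x) \<partial>I e)"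
      unfolding sum.distrib bd by (simp add: sum_distrib_left)
    also have "\<dots> = l2_inner M (\<lambda>p. \<mu> * u p) w"
      using H_inner[OF uH w] by (simp add: l2_inner_def mult.assoc)
    finally show ?thesis .
  qed
  show ?thesis
    unfolding regular_solution_def strong_solution_def
    using uH form.scale_mem[OF uH] weak u1 u2 eq[unfolded q_def] by blast
qed

text \<open>Testing the weak equation with u itself and using coercivity bounds u and u' by f. The
  strong equation then expresses a u'' through u, u' and f, and a is bounded below.\<close>

lemma regular_solution_bound:
  obtains C where "0 \<le> C"
    "\<And>u f u1 u2. \<lbrakk>regular_solution u f; strong_solution u f u1 u2\<rbrakk> \<Longrightarrow>
      (\<Sum>e\<in>E. \<integral>x. (u2 e x)\<^sup>2 \<partial>I e) \<le> C * mass f"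
proof -
  obtain c where c: "0 < c" "\<And>f. f \<in> H \<Longrightarrow> c * (mass f + energy f) \<le> form f f" by (rule form_coercive) blast
  obtain K where K: "0 \<le> K" "AE p in M. \<bar>\<kappa> p\<bar> \<le> K" by (rule kappa_bounded)
  obtain A where A: "0 \<le> A" "\<And>e. e \<in> E \<Longrightarrow> AE x in I e. \<bar>wder G a e x\<bar> \<le> A" by (rule a_wder_bounded) blast
  \<comment> \<open>The 3 comes from squaring three summands, the denominator from dividing by a,
    \<open>K ^ 4\<close> and \<open>A\<^sup>2\<close> from the terms with \<kappa>^2 u and a'
    u'.\<close>
  define B where "B = 3 / a\<^sub>0\<^sup>2 * max 1 (max (K ^ 4) (A\<^sup>2))"
  have B: "0 \<le> B" unfolding B_def by simp
  show ?thesis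
  proof (rule that[of "B * (1 / c\<^sup>2 + 1)"])
    show "0 \<le> B * (1 / c\<^sup>2 + 1)" using B by simp
    fix u f u1 u2
    assume reg: "regular_solution u f"
      and sol: "strong_solution u f u1 u2"
    note u1 = strong_solutionD(1)[OF sol] and u2 = strong_solutionD(2)[OF sol] and eq = strong_solutionD(3)[OF sol]
    from reg have uH: "u \<in> H" and fH: "f \<in> H" and weak: "form u u = l2_inner M f u"
      unfolding regular_solution_def by auto
    have en: "mass u + energy u \<le> mass f / c\<^sup>2"
    proof -
      define t where "t = mass u + energy u"
      have t0: "0 \<le> t" unfolding t_def using mass_nonneg energy_nonneg by simp
      have "(c * t)\<^sup>2 \<le> (form u u)\<^sup>2"
        using c(1) c(2)[OF uH] t0 unfolding t_def by (intro power_mono) auto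
      also have "\<dots> \<le> mass f * mass u"
        unfolding weak mass_eq[OF uH] mass_eq[OF fH] by (intro L.cauchy_schwarz H_l2 uH fH)
      also have "\<dots> \<le> mass f * t" unfolding t_def using mass_nonneg energy_nonneg by (intro mult_left_mono) auto
      finally have "t * (c\<^sup>2 * t) \<le> t * mass f" by (simp add: power2_eq_square mult_ac)
      then have "c\<^sup>2 * t \<le> mass f" using t0 mass_nonneg[of f] by (cases "t = 0") auto
      then show ?thesis unfolding t_def[symmetric] using c(1) by (simp add: field_simps)
    qed
    have eu: "energy u = (\<Sum>e\<in>E. \<integral>x. (u1 e x)\<^sup>2 \<partial>I e)" by (rule energy_eq) (rule u1)
    have "(\<integral>x. (u2 e x)\<^sup>2 \<partial>I e) \<le>
        B * ((\<integral>x. (u (e, x))\<^sup>2 \<partial>I e) + (\<integral>x. (f (e, x))\<^sup>2 \<partial>I e) + (\<integral>x. (u1 e x)\<^sup>2 \<partial>I e))"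
      if e: "e \<in> E" for e
    proof -
      have i: "integrable (I e) (\<lambda>x. (u (e, x))\<^sup>2)" "integrable (I e) (\<lambda>x. (f (e, x))\<^sup>2)"
        "integrable (I e) (\<lambda>x. (u1 e x)\<^sup>2)" "integrable (I e) (\<lambda>x. (u2 e x)\<^sup>2)"
        using H1_graph_slice_l2[OF uH e] H1_graph_slice_l2[OF fH e] has_weak_deriv_l2[OF u1[OF e]]
          has_weak_deriv_l2[OF u2[OF e]] unfolding l2_space_def by auto
      have "(\<integral>x. (u2 e x)\<^sup>2 \<partial>I e) \<le> (\<integral>x. B * ((u (e, x))\<^sup>2 + (f (e, x))\<^sup>2 + (u1 e x)\<^sup>2) \<partial>I e)"
      proof (rule integral_mono_AE)
        have "AE x in I e. x \<in> {0..len G e}" using AE_space[of "I e"] by simp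
        then show "AE x in I e. (u2 e x)\<^sup>2 \<le> B * ((u (e, x))\<^sup>2 + (f (e, x))\<^sup>2 + (u1 e x)\<^sup>2)"
          using eq[OF e] A(2)[OF e] graph_AE[OF fin_E K(2) e]
        proof eventually_elim
          case (elim x)
          define z where "z = (\<kappa> (e, x))\<^sup>2 * u (e, x)"
          define y where "y = wder G a e x * u1 e x"
          define m where "m = max 1 (max (K ^ 4) (A\<^sup>2))"
          have ax: "a\<^sub>0 \<le> a (e, x)" using elim e by (intro a_ge) (simp add: points_def)
          have k4: "((\<kappa> (e, x))\<^sup>2)\<^sup>2 \<le> K ^ 4"
            using power_mono[OF elim(4), of 4] by (simp add: power_even_abs flip: power_mult)
          have z: "z\<^sup>2 \<le> m * (u (e, x))\<^sup>2"
            unfolding z_def power_mult_distrib using k4 by (intro mult_right_mono) (auto simp: m_def)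
          have "\<bar>wder G a e x\<bar>\<^sup>2 \<le> A\<^sup>2" using elim(3) by (intro power_mono) auto
          then have y: "y\<^sup>2 \<le> m * (u1 e x)\<^sup>2"
            unfolding y_def power_mult_distrib by (intro mult_right_mono) (auto simp: m_def)
          have ff: "(f (e, x))\<^sup>2 \<le> m * (f (e, x))\<^sup>2"
            using mult_right_mono[of 1 m "(f (e, x))\<^sup>2"] by (simp add: m_def)
          have "a\<^sub>0\<^sup>2 * (u2 e x)\<^sup>2 \<le> (a (e, x))\<^sup>2 * (u2 e x)\<^sup>2"
            using ax a0_pos by (intro mult_right_mono power_mono) auto
          also have "\<dots> = (z - f (e, x) - y)\<^sup>2"
          proof -
            have "a (e, x) * u2 e x = z - f (e, x) - y" using elim(2) unfolding z_def y_def by simp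
            then show ?thesis by (metis power_mult_distrib)
          qed
          \<comment> \<open>The difference of the two sides is (z + f)^2 + (z + y)^2 + (f -
            y)^2.\<close>
          also have "\<dots> \<le> 3 * (z\<^sup>2 + (f (e, x))\<^sup>2 + y\<^sup>2)"
            using zero_le_power2[of "z + f (e, x)"] zero_le_power2[of "z + y"] zero_le_power2[of "f (e, x) - y"]
            by (simp add: power2_eq_square algebra_simps)
          also have "\<dots> \<le> 3 * (m * ((u (e, x))\<^sup>2 + (f (e, x))\<^sup>2 + (u1 e x)\<^sup>2))"
            using z y ff by (simp add: algebra_simps)
          finally show ?case using a0_pos unfolding B_def m_def[symmetric] by (simp add: field_simps)
        qed
      qed (use i in auto)
      also have "\<dots> = B * ((\<integral>x. (u (e, x))\<^sup>2 \<partial>I e) + (\<integral>x. (f (e, x))\<^sup>2 \<partial>I e) + (\<integral>x. (u1 e x)\<^sup>2 \<partial>I e))"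
        using i by simp
      finally show ?thesis .
    qed
    then have "(\<Sum>e\<in>E. \<integral>x. (u2 e x)\<^sup>2 \<partial>I e) \<le>
        (\<Sum>e\<in>E. B * ((\<integral>x. (u (e, x))\<^sup>2 \<partial>I e) + (\<integral>x. (f (e, x))\<^sup>2 \<partial>I e) + (\<integral>x. (u1 e x)\<^sup>2 \<partial>I e)))"
      by (rule sum_mono)
    also have "\<dots> = B * (mass u + mass f + energy u)"
      unfolding mass_def eu by (simp add: sum.distrib sum_distrib_left[symmetric])
    also have "\<dots> \<le> B * ((1 / c\<^sup>2 + 1) * mass f)"
      using en B by (intro mult_left_mono) (auto simp: distrib_right)
    finally show "(\<Sum>e\<in>E. \<integral>x. (u2 e x)\<^sup>2 \<partial>I e) \<le> B * (1 / c\<^sup>2 + 1) * mass f" by (simp add: mult.assoc)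
  qed
qed

section \<open>Finite element functions and the interpolation error\<close>

lemma mesh_width_pos: "is_mesh G n \<Longrightarrow> e \<in> E \<Longrightarrow> 0 < mesh_width G n e"
  and mesh_width_mult: "is_mesh G n \<Longrightarrow> e \<in> E \<Longrightarrow> real (n e) * mesh_width G n e = len G e"
  and mesh_pos: "is_mesh G n \<Longrightarrow> e \<in> E \<Longrightarrow> 0 < n e"
  using len_pos[of e] unfolding mesh_width_def is_mesh_def by (fastforce intro: divide_pos_pos)+

lemma max_mesh_width_bounds:
  assumes "is_mesh G n"
  shows "e \<in> E \<Longrightarrow> mesh_width G n e \<le> max_mesh_width G n" "0 < max_mesh_width G n" "max_mesh_width G n \<le> lmax"
proof -
  show 1: "mesh_width G n e \<le> max_mesh_width G n" if "e \<in> E" for e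
    unfolding max_mesh_width_def using fin_E that by simp
  obtain e where "e \<in> E" using edges_ne by blast
  with 1 mesh_width_pos[OF assms] show "0 < max_mesh_width G n" by (meson less_le_trans)
  show "max_mesh_width G n \<le> lmax"
    unfolding max_mesh_width_def
  proof (subst Max_le_iff)
    show "\<forall>x\<in>mesh_width G n ` E. x \<le> lmax"
    proof safe
      fix e assume e: "e \<in> E"
      have "1 * mesh_width G n e \<le> real (n e) * mesh_width G n e"
        using mesh_width_pos[OF assms e] mesh_pos[OF assms e] by (intro mult_right_mono) auto
      then show "mesh_width G n e \<le> lmax" using mesh_width_mult[OF assms e] le_lmax[OF e] by simp
    qed
  qed (use fin_E edges_ne in auto)
qed

lemma fem_space_H:
  assumes n: "is_mesh G n" and u: "u \<in> fem_space G n"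
  shows "u \<in> H"
proof -
  have "(\<lambda>x. u (e, x)) \<in> H1_interval (len G e)" if e: "e \<in> E" for e
  proof -
    obtain L where "L-lipschitz_on {0..len G e} (\<lambda>x. u (e, x))"
      using piecewise_affine_lipschitz[OF mesh_pos[OF n e] mesh_width_pos[OF n e] mesh_width_mult[OF n e],
          of "\<lambda>x. u (e, x)"] u e
      unfolding fem_space_def by blast
    from lipschitz_has_weak_deriv[OF this] show ?thesis unfolding H1_interval_def by blast
  qed
  then show ?thesis using u unfolding fem_space_def H1_graph_def by blast
qed

lemma nodal_interp_ends:
  assumes n: "is_mesh G n" and e: "fst h \<in> E"
  shows "nodal_interp G n u (fst h, end_pos G h) = u (fst h, end_pos G h)"
proof -
  let ?e = "fst h"
  note hp = mesh_width_pos[OF n e]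
  have "nodal_interp G n u (?e, 0) = u (?e, 0)"
    using nodal_interp_piece[OF hp, of 0 0 u] hp by simp
  moreover have "nodal_interp G n u (?e, len G ?e) = u (?e, len G ?e)"
    using nodal_interp_piece[OF hp, of "len G ?e" "n ?e" u] hp mesh_width_mult[OF n e]
    by (simp add: distrib_right)
  ultimately show ?thesis by (simp add: end_pos_def)
qed

lemma nodal_interp_fem:
  assumes n: "is_mesh G n" and gc: "graph_continuous G u"
  shows "nodal_interp G n u \<in> fem_space G n"
proof -
  have aff: "\<exists>c d. \<forall>x\<in>{real i * mesh_width G n e..real (Suc i) * mesh_width G n e}.
      nodal_interp G n u (e, x) = c + d * x" if e: "e \<in> E" for e i
  proof -
    let ?h = "mesh_width G n e"
    let ?m = "(u (e, real (Suc i) * ?h) - u (e, real i * ?h)) / ?h"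
    have "p + (x - q) * m = (p - q * m) + m * x" for p q m x :: real by (simp add: algebra_simps)
    then show ?thesis
      using nodal_interp_piece[OF mesh_width_pos[OF n e], of _ i u] by metis
  qed
  have "continuous_on {0..len G e} (\<lambda>x. nodal_interp G n u (e, x))" if e: "e \<in> E" for e
  proof -
    obtain L where "L-lipschitz_on {0..len G e} (\<lambda>x. nodal_interp G n u (e, x))"
      using piecewise_affine_lipschitz[OF mesh_pos[OF n e] mesh_width_pos[OF n e] mesh_width_mult[OF n e],
          of "\<lambda>x. nodal_interp G n u (e, x)"] aff[OF e] by blast
    then show ?thesis by (rule lipschitz_on_continuous_on)
  qed
  moreover have "nodal_interp G n u (fst h, end_pos G h) = nodal_interp G n u (fst h', end_pos G h')"
    if v: "v \<in> verts G" "h \<in> inc G v" "h' \<in> inc G v" for v h h'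
  proof -
    have "fst h \<in> E" "fst h' \<in> E" using v by (auto simp: inc_def)
    then show ?thesis using nodal_interp_ends[OF n] gc v unfolding graph_continuous_def by metis
  qed
  ultimately show ?thesis using aff unfolding fem_space_def graph_continuous_def by blast
qed

text \<open>On each cell the interpolant has the mean slope of u, which gives one factor h for the
  derivative. The error itself vanishes at the left node of the cell, and integrating its derivative
  gains another factor h.\<close>

lemma nodal_interp_error:
  assumes n: "is_mesh G n" and e: "e \<in> E" and gc: "graph_continuous G u"
    and u1: "has_weak_deriv (len G e) (\<lambda>x. u (e, x)) u1" and u2: "has_weak_deriv (len G e) u1 u2"
  defines "g \<equiv> wder G (nodal_interp G n u) e" and "h \<equiv> mesh_width G n e"
  shows "(\<integral>x. (u1 x - g x)\<^sup>2 \<partial>I e) \<le> h\<^sup>2 * (\<integral>x. (u2 x)\<^sup>2 \<partial>I e)"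
    and "(\<integral>x. (u (e, x) - nodal_interp G n u (e, x))\<^sup>2 \<partial>I e) \<le> h\<^sup>2 * (h\<^sup>2 * (\<integral>x. (u2 x)\<^sup>2 \<partial>I e))"
proof -
  let ?v = "nodal_interp G n u" and ?w = "\<lambda>x. u (e, x) - nodal_interp G n u (e, x)"
  have h: "0 < h" "real (n e) * h = len G e"
    using mesh_width_pos[OF n e] mesh_width_mult[OF n e] unfolding h_def by auto
  have g: "has_weak_deriv (len G e) (\<lambda>x. ?v (e, x)) g"
    unfolding g_def by (intro H1_graph_wder fem_space_H[OF n] nodal_interp_fem[OF n gc] e)
  have w: "has_weak_deriv (len G e) ?w (\<lambda>x. u1 x - g x)"
    using has_weak_deriv_lincomb[OF u1 g, of 1 "-1"] by simp
  have iw: "integrable (I e) (\<lambda>x. (?w x)\<^sup>2)" "integrable (I e) (\<lambda>x. (u1 x - g x)\<^sup>2)" "integrable (I e) (\<lambda>x. (u2 x)\<^sup>2)"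
    using continuous_ivl_l2[OF has_weak_deriv_continuous[OF w]] has_weak_deriv_l2[OF w] has_weak_deriv_l2[OF u2]
    unfolding l2_space_def by auto
  have piece: "(\<integral>x. (u1 x - g x)\<^sup>2 \<partial>ivl (real i * h) (real (Suc i) * h)) \<le>
      h\<^sup>2 * (\<integral>x. (u2 x)\<^sup>2 \<partial>ivl (real i * h) (real (Suc i) * h))" (is ?A)
    "(\<integral>x. (?w x)\<^sup>2 \<partial>ivl (real i * h) (real (Suc i) * h)) \<le>
      h\<^sup>2 * (h\<^sup>2 * (\<integral>x. (u2 x)\<^sup>2 \<partial>ivl (real i * h) (real (Suc i) * h)))" (is ?B)
    if i: "i < n e" for i
  proof -
    let ?c = "real i * h" and ?d = "real (Suc i) * h"
    have cd: "0 \<le> ?c" "?c < ?d" "?d - ?c = h" using h by (auto simp: algebra_simps)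
    have "?d \<le> real (n e) * h" using i h by (intro mult_right_mono) auto
    then have dl: "?d \<le> len G e" using h by simp
    define m where "m = (u (e, ?d) - u (e, ?c)) / h"
    have vx: "?v (e, x) = u (e, ?c) + (x - ?c) * m" if "x \<in> {?c..?d}" for x
      unfolding m_def h_def using nodal_interp_piece[OF mesh_width_pos[OF n e], of x i u] that
      unfolding h_def by simp
    have vc: "?v (e, ?c) = u (e, ?c)" using vx[of ?c] cd by simp
    have "AE x in ivl ?c ?d. g x = m"
      using cd dl vx vc by (intro affine_weak_deriv_AE[OF g]) auto
    then have "(\<integral>x. (u1 x - g x)\<^sup>2 \<partial>ivl ?c ?d) = (\<integral>x. (u1 x - m)\<^sup>2 \<partial>ivl ?c ?d)"
    proof (intro integral_cong_AE)
      have "integrable (ivl ?c ?d) u1" "integrable (ivl ?c ?d) g"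
        using has_weak_deriv_integrable[OF u1] has_weak_deriv_integrable[OF g] cd dl by auto
      then show "(\<lambda>x. (u1 x - g x)\<^sup>2) \<in> borel_measurable (ivl ?c ?d)" "(\<lambda>x. (u1 x - m)\<^sup>2) \<in> borel_measurable (ivl ?c ?d)"
        by auto
    qed (auto elim!: eventually_mono)
    also have "\<dots> \<le> h\<^sup>2 * (\<integral>x. (u2 x)\<^sup>2 \<partial>ivl ?c ?d)"
      using mean_slope_bound[OF u1 u2 cd(1,2) dl] unfolding cd(3) m_def by simp
    finally show A: ?A .
    have "(\<integral>x. (?w x)\<^sup>2 \<partial>ivl ?c ?d) \<le> (?d - ?c)\<^sup>2 * (\<integral>x. (u1 x - g x)\<^sup>2 \<partial>ivl ?c ?d)"
      using cd dl vc by (intro vanishing_endpoint_bound[OF w]) auto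
    also have "\<dots> \<le> h\<^sup>2 * (h\<^sup>2 * (\<integral>x. (u2 x)\<^sup>2 \<partial>ivl ?c ?d))"
      unfolding cd(3) using A by (intro mult_left_mono) auto
    finally show ?B .
  qed
  have split: "(\<integral>x. F x \<partial>I e) = (\<Sum>i<n e. \<integral>x. F x \<partial>ivl (real i * h) (real (Suc i) * h))"
    if "integrable (I e) F" for F :: "real \<Rightarrow> real"
    using integral_ivl_pieces[of "n e" h F] that h by simp
  show "(\<integral>x. (u1 x - g x)\<^sup>2 \<partial>I e) \<le> h\<^sup>2 * (\<integral>x. (u2 x)\<^sup>2 \<partial>I e)"
    unfolding split[OF iw(2)] split[OF iw(3)] sum_distrib_left by (intro sum_mono piece) auto
  show "(\<integral>x. (?w x)\<^sup>2 \<partial>I e) \<le> h\<^sup>2 * (h\<^sup>2 * (\<integral>x. (u2 x)\<^sup>2 \<partial>I e))"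
    unfolding split[OF iw(1)] split[OF iw(3)] sum_distrib_left by (intro sum_mono piece(2)[unfolded sum_distrib_left]) auto
qed

text \<open>Vanishing at the vertices removes the \<alpha>-terms. Interpolation errors have this
  property, since every vertex is a node of each incident edge.\<close>

lemma form_upper:
  obtains C where "0 \<le> C"
    "\<And>w. \<lbrakk>w \<in> H; \<And>v. v \<in> verts G \<Longrightarrow> vert_val G w v = 0\<rbrakk> \<Longrightarrow> form w w \<le> C * (mass w + energy w)"
proof -
  obtain K where K: "0 \<le> K" "AE p in M. \<bar>\<kappa> p\<bar> \<le> K" by (rule kappa_bounded)
  obtain A where A: "0 \<le> A" "\<And>p. p \<in> points G \<Longrightarrow> a p \<le> A" by (rule a_bounded) blast
  show ?thesis
  proof (rule that[of "K\<^sup>2 + A"])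
    fix w assume w: "w \<in> H" and z: "\<And>v. v \<in> verts G \<Longrightarrow> vert_val G w v = 0"
    have 1: "(\<integral>x. (\<kappa> (e, x))\<^sup>2 * w (e, x) * w (e, x) \<partial>I e) \<le> K\<^sup>2 * (\<integral>x. (w (e, x))\<^sup>2 \<partial>I e)" if e: "e \<in> E" for e
    proof -
      have "(\<integral>x. (\<kappa> (e, x))\<^sup>2 * w (e, x) * w (e, x) \<partial>I e) \<le> (\<integral>x. K\<^sup>2 * (w (e, x))\<^sup>2 \<partial>I e)"
      proof (rule integral_mono_AE)
        show "integrable (I e) (\<lambda>x. (\<kappa> (e, x))\<^sup>2 * w (e, x) * w (e, x))"
          by (intro mult_integrable_of_squares kappa_mult_l2 H1_graph_slice_l2 w e)
        show "integrable (I e) (\<lambda>x. K\<^sup>2 * (w (e, x))\<^sup>2)"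
          using H1_graph_slice_l2[OF w e] unfolding l2_space_def by auto
        show "AE x in I e. (\<kappa> (e, x))\<^sup>2 * w (e, x) * w (e, x) \<le> K\<^sup>2 * (w (e, x))\<^sup>2"
          using graph_AE[OF fin_E K(2) e]
        proof eventually_elim
          case (elim x)
          then have "(\<kappa> (e, x))\<^sup>2 \<le> K\<^sup>2" by (metis abs_ge_zero power2_abs power_mono)
          then have "(\<kappa> (e, x))\<^sup>2 * (w (e, x))\<^sup>2 \<le> K\<^sup>2 * (w (e, x))\<^sup>2" by (rule mult_right_mono) simp
          then show ?case by (simp add: power2_eq_square mult.assoc)
        qed
      qed
      then show ?thesis by simp
    qed
    have 2: "(\<integral>x. a (e, x) * wder G w e x * wder G w e x \<partial>I e) \<le> A * (\<integral>x. (wder G w e x)\<^sup>2 \<partial>I e)" if e: "e \<in> E" for e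
    proof -
      note W = has_weak_deriv_l2[OF H1_graph_wder[OF w e]]
      have "(\<integral>x. a (e, x) * wder G w e x * wder G w e x \<partial>I e) \<le> (\<integral>x. A * (wder G w e x)\<^sup>2 \<partial>I e)"
      proof (rule integral_mono_AE)
        show "integrable (I e) (\<lambda>x. a (e, x) * wder G w e x * wder G w e x)"
          by (intro mult_integrable_of_squares a_mult_l2 W e)
        show "integrable (I e) (\<lambda>x. A * (wder G w e x)\<^sup>2)" using W unfolding l2_space_def by auto
        show "AE x in I e. a (e, x) * wder G w e x * wder G w e x \<le> A * (wder G w e x)\<^sup>2"
        proof (rule AE_I2)
          fix x assume "x \<in> space (I e)"
          then have "a (e, x) \<le> A" using e by (intro A) (simp add: points_def)
          then have "a (e, x) * (wder G w e x)\<^sup>2 \<le> A * (wder G w e x)\<^sup>2" by (rule mult_right_mono) simp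
          then show "a (e, x) * wder G w e x * wder G w e x \<le> A * (wder G w e x)\<^sup>2"
            by (simp add: power2_eq_square mult.assoc)
        qed
      qed
      then show ?thesis by simp
    qed
    have "form w w \<le> K\<^sup>2 * mass w + A * energy w + 0"
      unfolding form_wder[OF w w] mass_def energy_def sum_distrib_left
      using z by (intro add_mono sum_mono 1 2) (auto simp: sum.neutral)
    also have "\<dots> \<le> (K\<^sup>2 + A) * (mass w + energy w)"
      using A K mass_nonneg[of w] energy_nonneg[of w] by (simp add: algebra_simps)
    finally show "form w w \<le> (K\<^sup>2 + A) * (mass w + energy w)" .
  qed (use A in simp)
qed

text \<open>The energy part of the squared error is of order h^2. The mass part is of order h^4, and
  one factor h^2 is traded for the constant \<open>lmax\<^sup>2\<close>.\<close>

lemma regular_solution_approximation: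
  obtains C where "0 \<le> C"
    "\<And>u f n. \<lbrakk>regular_solution u f; is_mesh G n\<rbrakk> \<Longrightarrow>
       \<exists>v\<in>fem_space G n. form (\<lambda>p. u p - v p) (\<lambda>p. u p - v p) \<le> C * (max_mesh_width G n)\<^sup>2 * mass f"
proof -
  obtain C1 where C1: "0 \<le> C1"
    "\<And>u f u1 u2. \<lbrakk>regular_solution u f; strong_solution u f u1 u2\<rbrakk> \<Longrightarrow>
      (\<Sum>e\<in>E. \<integral>x. (u2 e x)\<^sup>2 \<partial>I e) \<le> C1 * mass f"
    by (rule regular_solution_bound) blast
  obtain C2 where C2: "0 \<le> C2"
    "\<And>w. \<lbrakk>w \<in> H; \<And>v. v \<in> verts G \<Longrightarrow> vert_val G w v = 0\<rbrakk> \<Longrightarrow> form w w \<le> C2 * (mass w + energy w)"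
    by (rule form_upper) blast
  show ?thesis
  proof (rule that[of "C2 * (lmax\<^sup>2 + 1) * C1"])
    show "0 \<le> C2 * (lmax\<^sup>2 + 1) * C1" using C1 C2 by simp
    fix u f n assume reg: "regular_solution u f" and n: "is_mesh G n"
    let ?h = "max_mesh_width G n" and ?v = "nodal_interp G n u"
    define w where "w p = u p - ?v p" for p
    from reg obtain u1 u2 where uH: "u \<in> H"
      and sol: "strong_solution u f u1 u2"
      unfolding regular_solution_def by blast
    note u1 = strong_solutionD(1)[OF sol] and u2 = strong_solutionD(2)[OF sol]
    have gc: "graph_continuous G u" using uH unfolding H1_graph_def by blast
    have v: "?v \<in> fem_space G n" by (rule nodal_interp_fem[OF n gc])
    have vH: "?v \<in> H" by (rule fem_space_H[OF n v])
    have wH: "w \<in> H" unfolding w_def using form.diff_mem[OF uH vH] .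
    have gw: "graph_continuous G w" using wH unfolding H1_graph_def by blast
    define U where "U = (\<Sum>e\<in>E. \<integral>x. (u2 e x)\<^sup>2 \<partial>I e)"
    have U: "U \<le> C1 * mass f" unfolding U_def by (rule C1(2)[OF reg sol])
    have U0: "0 \<le> (\<integral>x. (u2 e x)\<^sup>2 \<partial>I e)" for e by (intro integral_nonneg_AE) auto
    have UU: "0 \<le> U" unfolding U_def by (intro sum_nonneg U0)
    have wd: "has_weak_deriv (len G e) (\<lambda>x. w (e, x)) (\<lambda>x. u1 e x - wder G ?v e x)" if e: "e \<in> E" for e
      unfolding w_def using has_weak_deriv_lincomb[OF u1[OF e] H1_graph_wder[OF vH e], of 1 "-1"] by simp
    have hle: "(mesh_width G n e)\<^sup>2 \<le> ?h\<^sup>2" if "e \<in> E" for e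
      using mesh_width_pos[OF n that] max_mesh_width_bounds(1)[OF n that] by (intro power_mono) auto
    have h2: "?h\<^sup>2 \<le> lmax\<^sup>2" using max_mesh_width_bounds(2,3)[OF n] by (intro power_mono) auto
    have ew: "energy w = (\<Sum>e\<in>E. \<integral>x. (u1 e x - wder G ?v e x)\<^sup>2 \<partial>I e)"
      by (rule energy_eq) (rule wd)
    have en: "energy w \<le> ?h\<^sup>2 * U"
      unfolding ew U_def sum_distrib_left
    proof (intro sum_mono)
      fix e assume e: "e \<in> E"
      have "(\<integral>x. (u1 e x - wder G ?v e x)\<^sup>2 \<partial>I e) \<le> (mesh_width G n e)\<^sup>2 * (\<integral>x. (u2 e x)\<^sup>2 \<partial>I e)"
        by (rule nodal_interp_error(1)[OF n e gc u1[OF e] u2[OF e]])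
      also have "\<dots> \<le> ?h\<^sup>2 * (\<integral>x. (u2 e x)\<^sup>2 \<partial>I e)" by (intro mult_right_mono hle e U0)
      finally show "(\<integral>x. (u1 e x - wder G ?v e x)\<^sup>2 \<partial>I e) \<le> ?h\<^sup>2 * (\<integral>x. (u2 e x)\<^sup>2 \<partial>I e)" .
    qed
    have ma: "mass w \<le> ?h\<^sup>2 * (lmax\<^sup>2 * U)"
      unfolding mass_def U_def sum_distrib_left w_def
    proof (intro sum_mono)
      fix e assume e: "e \<in> E"
      have "(\<integral>x. (u (e, x) - ?v (e, x))\<^sup>2 \<partial>I e) \<le> (mesh_width G n e)\<^sup>2 * ((mesh_width G n e)\<^sup>2 * (\<integral>x. (u2 e x)\<^sup>2 \<partial>I e))"
        by (rule nodal_interp_error(2)[OF n e gc u1[OF e] u2[OF e]])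
      also have "\<dots> \<le> ?h\<^sup>2 * (lmax\<^sup>2 * (\<integral>x. (u2 e x)\<^sup>2 \<partial>I e))"
        using hle[OF e] h2 U0 by (intro mult_mono mult_right_mono) auto
      finally show "(\<integral>x. (u (e, x) - ?v (e, x))\<^sup>2 \<partial>I e) \<le> ?h\<^sup>2 * (lmax\<^sup>2 * (\<integral>x. (u2 e x)\<^sup>2 \<partial>I e))" .
    qed
    have vz: "vert_val G w v = 0" if v: "v \<in> verts G" for v
    proof -
      have "inc G v \<noteq> {}" using degree_pos[OF v] unfolding degree_def by auto
      then obtain h where h: "h \<in> inc G v" by blast
      then have "fst h \<in> E" by (simp add: inc_def)
      then show ?thesis
        using vert_val_eq[OF gw v h] nodal_interp_ends[OF n, of h u] by (simp add: w_def)
    qed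
    have "form w w \<le> C2 * (mass w + energy w)" by (rule C2(2)[OF wH vz])
    also have "\<dots> \<le> C2 * (?h\<^sup>2 * (lmax\<^sup>2 * U) + ?h\<^sup>2 * U)" using ma en C2 by (intro mult_left_mono add_mono)
    also have "\<dots> = C2 * ((lmax\<^sup>2 + 1) * ?h\<^sup>2) * U" by (simp add: algebra_simps)
    also have "\<dots> \<le> C2 * ((lmax\<^sup>2 + 1) * ?h\<^sup>2) * (C1 * mass f)" using U C2 by (intro mult_left_mono) auto
    finally have "form w w \<le> C2 * (lmax\<^sup>2 + 1) * C1 * ?h\<^sup>2 * mass f" by (simp add: mult_ac)
    then show "\<exists>v\<in>fem_space G n. form (\<lambda>p. u p - v p) (\<lambda>p. u p - v p) \<le> C2 * (lmax\<^sup>2 + 1) * C1 * ?h\<^sup>2 * mass f"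
      using v unfolding w_def by blast
  qed
qed

end

section \<open>Weak eigenfunctions and resolvent traces\<close>

text \<open>By orthonormality the squared norm of the remainder after n terms is the squared norm of
  f minus the n-th partial sum, and completeness sends it to 0.\<close>

lemma graph_eigenbasis_parseval:
  assumes "graph_eigenbasis G a \<kappa> \<alpha> \<phi> lam" and \<phi>: "\<And>j. \<phi> j \<in> l2_space (graph_measure G)"
    and f: "f \<in> l2_space (graph_measure G)"
  shows "(\<lambda>j. (l2_inner (graph_measure G) f (\<phi> j))\<^sup>2) sums l2_inner (graph_measure G) f f"
proof -
  let ?M = "graph_measure G"
  interpret L: semi_inner "l2_space ?M" "l2_inner ?M" by (rule l2_semi_inner)
  have on: "l2_inner ?M (\<phi> i) (\<phi> j) = (if i = j then 1 else 0)" for i j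
    using assms(1) unfolding graph_eigenbasis_def by blast
  define b where "b j = l2_inner ?M f (\<phi> j)" for j
  define P where "P n p = (\<Sum>j<n. b j * \<phi> j p)" for n p
  have P: "P n \<in> l2_space ?M" for n unfolding P_def by (intro L.sum_mem \<phi>) auto
  have fP: "l2_inner ?M f (P n) = (\<Sum>j<n. (b j)\<^sup>2)" for n
    unfolding P_def using L.sum_right[of "{..<n}" \<phi> f b] \<phi> f by (simp add: b_def power2_eq_square)
  have PP: "l2_inner ?M (P n) (P n) = (\<Sum>j<n. (b j)\<^sup>2)" for n
  proof -
    have "l2_inner ?M (P n) (P n) = (\<Sum>i<n. b i * l2_inner ?M (\<phi> i) (P n))"
      using L.sum_left[of "{..<n}" \<phi> "P n" b] \<phi> P[of n] unfolding P_def by simp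
    also have "\<dots> = (\<Sum>i<n. b i * (\<Sum>j<n. b j * l2_inner ?M (\<phi> i) (\<phi> j)))"
      unfolding P_def using \<phi> by (subst L.sum_right) auto
    also have "\<dots> = (\<Sum>j<n. (b j)\<^sup>2)"
      by (intro sum.cong refl) (simp add: on power2_eq_square if_distrib[of "\<lambda>x. _ * x"] cong: if_cong)
    finally show ?thesis .
  qed
  have "(\<lambda>n. l2_norm ?M (\<lambda>p. f p - P n p)) \<longlonglongrightarrow> 0"
    using assms(1) f unfolding graph_eigenbasis_def P_def b_def by blast
  then have "(\<lambda>n. (l2_norm ?M (\<lambda>p. f p - P n p))\<^sup>2) \<longlonglongrightarrow> 0\<^sup>2" by (rule tendsto_power)
  moreover have "(l2_norm ?M (\<lambda>p. f p - P n p))\<^sup>2 = l2_inner ?M f f - (\<Sum>j<n. (b j)\<^sup>2)" for n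
  proof -
    have "(l2_norm ?M (\<lambda>p. f p - P n p))\<^sup>2 = l2_inner ?M (\<lambda>p. f p - P n p) (\<lambda>p. f p - P n p)"
      unfolding l2_norm_eq by (intro real_sqrt_pow2 L.nonneg L.diff_mem f P)
    also have "\<dots> = l2_inner ?M f f - (\<Sum>j<n. (b j)\<^sup>2)"
      using f P[of n] L.sym[OF P[of n] f]
      by (simp add: L.diff_left L.diff_right L.diff_mem fP PP)
    finally show ?thesis .
  qed
  ultimately have "(\<lambda>n. l2_inner ?M f f - (\<Sum>j<n. (b j)\<^sup>2)) \<longlonglongrightarrow> 0" by simp
  from tendsto_diff[OF tendsto_const[of "l2_inner ?M f f"] this] show ?thesis
    unfolding sums_def b_def by simp
qed

lemma tensor_integral:
  fixes F K :: "'a \<Rightarrow> real"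
  assumes "sigma_finite_measure M" "integrable M F" "integrable M K"
  shows "integrable (M \<Otimes>\<^sub>M M) (\<lambda>(p, q). F p * K q)"
    and "(\<integral>z. (case z of (p, q) \<Rightarrow> F p * K q) \<partial>(M \<Otimes>\<^sub>M M)) = (\<integral>p. F p \<partial>M) * (\<integral>q. K q \<partial>M)"
proof -
  interpret sigma_finite_measure M by fact
  interpret pair_sigma_finite M M ..
  have [measurable]: "F \<in> borel_measurable M" "K \<in> borel_measurable M" using assms by auto
  show int: "integrable (M \<Otimes>\<^sub>M M) (\<lambda>(p, q). F p * K q)"
    using assms(2,3) by (intro Fubini_integrable) (auto simp: abs_mult)
  show "(\<integral>z. (case z of (p, q) \<Rightarrow> F p * K q) \<partial>(M \<Otimes>\<^sub>M M)) = (\<integral>p. F p \<partial>M) * (\<integral>q. K q \<partial>M)"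
    using integral_fst'[OF int] by simp
qed

text \<open>The inner product of two squares f(p) f(q) and g(p) g(q) is the square of the inner
  product. This is why overlaps of eigenfunctions enter the covariance error only through their
  squares.\<close>

lemma tensor_l2:
  assumes M: "sigma_finite_measure M" and f: "f \<in> l2_space M" and g: "g \<in> l2_space M"
  shows "(\<lambda>(p, q). f p * f q) \<in> l2_space (M \<Otimes>\<^sub>M M)"
    and "l2_inner (M \<Otimes>\<^sub>M M) (\<lambda>(p, q). f p * f q) (\<lambda>(p, q). g p * g q) = (l2_inner M f g)\<^sup>2"
proof -
  have [measurable]: "f \<in> borel_measurable M" and "integrable M (\<lambda>x. (f x)\<^sup>2)"
    using f unfolding l2_space_def by auto
  then have "integrable (M \<Otimes>\<^sub>M M) (\<lambda>(p, q). (f p)\<^sup>2 * (f q)\<^sup>2)"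
    by (intro tensor_integral M)
  moreover have "(\<lambda>(p, q). f p * f q) \<in> borel_measurable (M \<Otimes>\<^sub>M M)" by measurable
  ultimately show "(\<lambda>(p, q). f p * f q) \<in> l2_space (M \<Otimes>\<^sub>M M)"
    unfolding l2_space_def by (simp add: case_prod_beta' power_mult_distrib)
  note i = mult_integrable_of_squares[OF f g]
  show "l2_inner (M \<Otimes>\<^sub>M M) (\<lambda>(p, q). f p * f q) (\<lambda>(p, q). g p * g q) = (l2_inner M f g)\<^sup>2"
    using tensor_integral(2)[OF M i i]
    by (simp add: l2_inner_def case_prod_beta' power2_eq_square mult_ac)
qed

lemma l2_inner_cong:
  assumes "\<And>p. p \<in> space M \<Longrightarrow> f p = f' p" "\<And>p. p \<in> space M \<Longrightarrow> g p = g' p"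
  shows "l2_inner M f g = l2_inner M f' g'"
  unfolding l2_inner_def by (intro Bochner_Integration.integral_cong) (auto simp: assms)

lemma fem_space_sum:
  assumes J: "finite J" and f: "\<And>j. j \<in> J \<Longrightarrow> f j \<in> fem_space G n"
  shows "(\<lambda>p. \<Sum>j\<in>J. b j * f j p) \<in> fem_space G n"
proof -
  have "graph_continuous G (\<lambda>p. \<Sum>j\<in>J. b j * f j p)"
    unfolding graph_continuous_def
  proof (intro conjI ballI)
    show "continuous_on {0..len G e} (\<lambda>x. \<Sum>j\<in>J. b j * f j (e, x))" if "e \<in> edges G" for e
      using f that unfolding fem_space_def graph_continuous_def by (auto intro!: continuous_intros)
    fix v h h' assume "v \<in> verts G" "h \<in> inc G v" "h' \<in> inc G v"
    then have "f j (fst h, end_pos G h) = f j (fst h', end_pos G h')" if "j \<in> J" for j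
      using f[OF that] unfolding fem_space_def graph_continuous_def by blast
    then show "(\<Sum>j\<in>J. b j * f j (fst h, end_pos G h)) = (\<Sum>j\<in>J. b j * f j (fst h', end_pos G h'))" by simp
  qed
  moreover have "\<exists>c d. \<forall>x\<in>{real i * mesh_width G n e..real (Suc i) * mesh_width G n e}.
      (\<Sum>j\<in>J. b j * f j (e, x)) = c + d * x" if "e \<in> edges G" "i < n e" for e i
  proof -
    have "\<exists>c d. \<forall>x\<in>{real i * mesh_width G n e..real (Suc i) * mesh_width G n e}. f j (e, x) = c + d * x"
      if "j \<in> J" for j
      using f[OF that] \<open>e \<in> edges G\<close> \<open>i < n e\<close> unfolding fem_space_def by blast
    then obtain c d where cd: "\<And>j x. j \<in> J \<Longrightarrow> x \<in> {real i * mesh_width G n e..real (Suc i) * mesh_width G n e} \<Longrightarrow>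
        f j (e, x) = c j + d j * x" by metis
    show ?thesis
      by (rule exI[of _ "\<Sum>j\<in>J. b j * c j"], rule exI[of _ "\<Sum>j\<in>J. b j * d j"])
        (auto simp: cd sum_distrib_left sum.distrib algebra_simps)
  qed
  ultimately show ?thesis unfolding fem_space_def by blast
qed

context graph_problem
begin

sublocale finite_measure M
  by (rule finite_measure_graph[OF fin_E])

text \<open>The difference of the two arguments has zero mass, zero energy and zero vertex values,
  so its energy form is 0, and Cauchy-Schwarz annihilates it against any \<open>f\<close>.
  Expansions in the discrete basis hold on \<open>points G\<close> only, so this transfer is needed
  wherever they enter the form.\<close>

lemma form_cong:
  assumes f: "f \<in> H" and g: "g \<in> H" and g': "g' \<in> H" and eq: "\<And>p. p \<in> points G \<Longrightarrow> g p = g' p"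
  shows "form f g = form f g'"
proof -
  define d where "d p = g p - g' p" for p
  have dH: "d \<in> H" unfolding d_def by (intro form.diff_mem g g')
  have d0: "d (e, x) = 0" if "e \<in> E" "x \<in> {0..len G e}" for e x
    using eq that by (simp add: d_def points_def)
  have wd: "has_weak_deriv (len G e) (\<lambda>x. d (e, x)) (\<lambda>_. 0)" if e: "e \<in> E" for e
    using d0[OF e] len_pos[OF e] by (intro has_weak_deriv_cong[OF has_weak_deriv_const[of _ 0]]) auto
  have "vert_val G d v = 0" if v: "v \<in> verts G" for v
  proof -
    have "inc G v \<noteq> {}" using degree_pos[OF v] unfolding degree_def by auto
    then obtain h where h: "h \<in> inc G v" by blast
    then have "fst h \<in> E" by (simp add: inc_def)
    then show ?thesis
      using vert_val_eq[OF _ v h, of d] dH d0 end_pos_mem unfolding H1_graph_def by auto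
  qed
  moreover have "mass d = 0"
    unfolding mass_def by (intro sum.neutral ballI integral_eq_zero_AE AE_I2) (auto simp: d0)
  moreover have "energy d = (\<Sum>e\<in>E. \<integral>x. 0\<^sup>2 \<partial>I e)" by (rule energy_eq) (rule wd)
  moreover obtain C where "\<And>w. \<lbrakk>w \<in> H; \<And>v. v \<in> verts G \<Longrightarrow> vert_val G w v = 0\<rbrakk> \<Longrightarrow> form w w \<le> C * (mass w + energy w)"
    by (rule form_upper) blast
  ultimately have "form d d \<le> 0" using dH by fastforce
  then have "(form f d)\<^sup>2 \<le> 0"
    using form.cauchy_schwarz[OF f dH] form.nonneg[OF dH] by simp
  then have "form f d = 0" by simp
  then show ?thesis unfolding d_def using form.diff_right[OF g g' f] by simp
qed

text \<open>\<open>fem_op\<close> is a choice, so a function with the required property must be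
  exhibited before anything can be concluded about it. The Riesz representative is written down
  explicitly in the orthonormal basis.\<close>

lemma fem_eigenbasis_weak:
  assumes n: "is_mesh G n" and eb: "fem_eigenbasis G a \<kappa> \<alpha> n N \<phi> lam" and k: "k < N"
    and w: "w \<in> fem_space G n"
  shows "form (\<phi> k) w = lam k * l2_inner M (\<phi> k) w"
proof -
  have V: "\<phi> j \<in> fem_space G n" if "j < N" for j using eb that unfolding fem_eigenbasis_def by blast
  then have \<phi>H: "\<phi> j \<in> H" if "j < N" for j using fem_space_H[OF n] that by blast
  have on: "l2_inner M (\<phi> i) (\<phi> j) = (if i = j then 1 else 0)" if "i < N" "j < N" for i j
    using eb that unfolding fem_eigenbasis_def by blast
  have span: "\<exists>c. \<forall>p\<in>points G. f p = (\<Sum>j<N. c j * \<phi> j p)" if "f \<in> fem_space G n" for f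
    using eb that unfolding fem_eigenbasis_def by blast
  define r where "r p = (\<Sum>j<N. form (\<phi> k) (\<phi> j) * \<phi> j p)" for p
  have rV: "r \<in> fem_space G n" unfolding r_def by (intro fem_space_sum V) auto
  have riesz: "l2_inner M r w = form (\<phi> k) w" if w: "w \<in> fem_space G n" for w
  proof -
    obtain c where c: "\<And>p. p \<in> points G \<Longrightarrow> w p = (\<Sum>j<N. c j * \<phi> j p)" using span[OF w] by blast
    let ?w = "\<lambda>p. \<Sum>j<N. c j * \<phi> j p"
    have wH: "?w \<in> H" by (intro form.sum_mem \<phi>H) auto
    have "l2_inner M r w = l2_inner M r ?w" by (intro l2_inner_cong) (auto simp: space_graph_measure c)
    also have "\<dots> = (\<Sum>j<N. c j * l2_inner M r (\<phi> j))"
      using \<phi>H fem_space_H[OF n rV] by (intro L.sum_right H_l2) auto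
    also have "\<dots> = (\<Sum>j<N. c j * form (\<phi> k) (\<phi> j))"
    proof (intro sum.cong refl)
      fix j assume j: "j \<in> {..<N}"
      have "l2_inner M r (\<phi> j) = (\<Sum>i<N. form (\<phi> k) (\<phi> i) * l2_inner M (\<phi> i) (\<phi> j))"
        unfolding r_def using \<phi>H j by (intro L.sum_left H_l2) auto
      also have "\<dots> = (\<Sum>i<N. if i = j then form (\<phi> k) (\<phi> j) else 0)"
        using on j by (intro sum.cong) auto
      also have "\<dots> = form (\<phi> k) (\<phi> j)" using j by simp
      finally show "c j * l2_inner M r (\<phi> j) = c j * form (\<phi> k) (\<phi> j)" by simp
    qed
    also have "\<dots> = form (\<phi> k) ?w" using \<phi>H k by (intro form.sum_right[symmetric]) auto
    also have "\<dots> = form (\<phi> k) w"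
      using c by (intro form_cong \<phi>H k wH fem_space_H[OF n w]) auto
    finally show ?thesis .
  qed
  have "fem_op G a \<kappa> \<alpha> n (\<phi> k) \<in> fem_space G n \<and>
     (\<forall>w\<in>fem_space G n. l2_inner M (fem_op G a \<kappa> \<alpha> n (\<phi> k)) w = form (\<phi> k) w)"
    unfolding fem_op_def
    by (rule someI[where P = "\<lambda>f. f \<in> fem_space G n \<and> (\<forall>w\<in>fem_space G n. l2_inner M f w = form (\<phi> k) w)", of r])
      (use rV riesz in blast)
  then have "form (\<phi> k) w = l2_inner M (fem_op G a \<kappa> \<alpha> n (\<phi> k)) w" using w by simp
  also have "\<dots> = l2_inner M (\<lambda>p. lam k * \<phi> k p) w"
    using eb k unfolding fem_eigenbasis_def by (intro l2_inner_cong) (auto simp: space_graph_measure)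
  also have "\<dots> = lam k * l2_inner M (\<phi> k) w"
    using \<phi>H[OF k] fem_space_H[OF n w] by (intro L.scale_left H_l2)
  finally show ?thesis .
qed

text \<open>What the eigenfunctions and the discrete eigenfunctions have in common: both diagonalise
  the L2 product and the energy form. One trace bound then covers both, with constants that do not
  see the mesh.\<close>

definition form_orthonormal :: "nat set \<Rightarrow> (nat \<Rightarrow> 'e \<times> real \<Rightarrow> real) \<Rightarrow> (nat \<Rightarrow> real) \<Rightarrow> bool" where
  "form_orthonormal J f \<nu> \<longleftrightarrow> finite J \<and> (\<forall>j\<in>J. f j \<in> H \<and> 0 < \<nu> j) \<and>
     (\<forall>i\<in>J. \<forall>j\<in>J. l2_inner M (f i) (f j) = (if i = j then 1 else 0) \<and>
        form (f i) (f j) = (if i = j then \<nu> j else 0))"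

text \<open>
  Testing the pointwise bound with \<open>\<Sum>\<^sub>j f\<^sub>j(p) / (t\<^sup>2 + \<nu>\<^sub>j) f\<^sub>j\<close> bounds the diagonal of the resolvent
  kernel; its integral over the graph is the trace.
\<close>

lemma resolvent_trace_bound:
  obtains C t\<^sub>0 where "0 \<le> C" "0 < t\<^sub>0"
    "\<And>J f \<nu> t. \<lbrakk>form_orthonormal J f \<nu>; t\<^sub>0 \<le> t\<rbrakk> \<Longrightarrow> (\<Sum>j\<in>J. 1 / (t\<^sup>2 + \<nu> j)) \<le> C / t"
proof -
  obtain c where c: "0 < c" "\<And>f. f \<in> H \<Longrightarrow> c * (mass f + energy f) \<le> form f f" by (rule form_coercive) blast
  \<comment> \<open>2 is the mass coefficient of the pointwise bound; 1/c converts the energy into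
    the form.\<close>
  define K where "K = max 2 (1 / c)"
  have K: "2 \<le> K" "1 / c \<le> K" unfolding K_def by auto
  show ?thesis
  proof (rule that[of "measure M (space M) * K" "2 / lmin"])
    show "0 \<le> measure M (space M) * K" using K by simp
    show "0 < 2 / lmin" using lmin_pos by simp
    fix J :: "nat set" and f and \<nu> :: "nat \<Rightarrow> real" and t :: real
    assume fo': "form_orthonormal J f \<nu>" and t: "2 / lmin \<le> t"
    from fo' have J: "finite J" and f: "\<And>j. j \<in> J \<Longrightarrow> f j \<in> H" and \<nu>: "\<And>j. j \<in> J \<Longrightarrow> 0 < \<nu> j"
      and on: "\<And>i j. \<lbrakk>i \<in> J; j \<in> J\<rbrakk> \<Longrightarrow> l2_inner M (f i) (f j) = (if i = j then 1 else 0)"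
      and fo: "\<And>i j. \<lbrakk>i \<in> J; j \<in> J\<rbrakk> \<Longrightarrow> form (f i) (f j) = (if i = j then \<nu> j else 0)"
      unfolding form_orthonormal_def by auto
    have t0: "0 < t" using t lmin_pos by (smt (verit) divide_pos_pos)
    have pos: "0 < t\<^sup>2 + \<nu> j" if "j \<in> J" for j using \<nu>[OF that] by (simp add: add_nonneg_pos)
    define s where "s p = (\<Sum>j\<in>J. (f j p)\<^sup>2 / (t\<^sup>2 + \<nu> j))" for p
    have s: "s p \<le> K / t" if p: "p \<in> points G" for p
    proof -
      \<comment> \<open>With these coefficients \<open>F\<close> is the resolvent kernel with one
        argument frozen at p, so its value at p is the diagonal value \<open>s p\<close>.\<close>
      define b where "b j = f j p / (t\<^sup>2 + \<nu> j)" for j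
      define F where "F q = (\<Sum>j\<in>J. b j * f j q)" for q
      have FH: "F \<in> H" unfolding F_def by (intro form.sum_mem J f)
      have Fp: "F p = s p" unfolding F_def s_def b_def by (simp add: power2_eq_square)
      have mF: "mass F = (\<Sum>j\<in>J. (b j)\<^sup>2)"
      proof -
        have "mass F = (\<Sum>i\<in>J. b i * l2_inner M (f i) F)"
          unfolding mass_eq[OF FH] using L.sum_left[OF J, of f F b] f FH H_l2 unfolding F_def by blast
        also have "\<dots> = (\<Sum>i\<in>J. b i * (\<Sum>j\<in>J. b j * l2_inner M (f i) (f j)))"
          unfolding F_def using f H_l2 J by (intro sum.cong refl arg_cong2[where f = "(*)"] L.sum_right) auto
        also have "\<dots> = (\<Sum>i\<in>J. b i * (\<Sum>j\<in>J. if j = i then b i else 0))"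
          using on by (intro sum.cong refl arg_cong2[where f = "(*)"]) auto
        also have "\<dots> = (\<Sum>j\<in>J. (b j)\<^sup>2)" using J by (simp add: power2_eq_square)
        finally show ?thesis .
      qed
      have fF: "form F F = (\<Sum>j\<in>J. (b j)\<^sup>2 * \<nu> j)"
      proof -
        have "form F F = (\<Sum>i\<in>J. b i * form (f i) F)"
          using form.sum_left[OF J, of f F b] f FH unfolding F_def by blast
        also have "\<dots> = (\<Sum>i\<in>J. b i * (\<Sum>j\<in>J. b j * form (f i) (f j)))"
          unfolding F_def using f J by (intro sum.cong refl arg_cong2[where f = "(*)"] form.sum_right) auto
        also have "\<dots> = (\<Sum>i\<in>J. b i * (\<Sum>j\<in>J. if j = i then b i * \<nu> i else 0))"
          using fo by (intro sum.cong refl arg_cong2[where f = "(*)"]) auto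
        also have "\<dots> = (\<Sum>j\<in>J. (b j)\<^sup>2 * \<nu> j)" using J by (simp add: power2_eq_square mult_ac)
        finally show ?thesis .
      qed
      have "c * energy F \<le> form F F"
        using c(2)[OF FH] mult_nonneg_nonneg[OF less_imp_le[OF c(1)] mass_nonneg[of F]] by (simp add: distrib_left)
      then have "energy F \<le> 1 / c * form F F" using c(1) by (simp add: field_simps)
      also have "\<dots> \<le> K * form F F" using K form.nonneg[OF FH] by (intro mult_right_mono)
      finally have eF: "energy F / t \<le> K * form F F / t" using t0 by (intro divide_right_mono) auto
      have "(s p)\<^sup>2 \<le> 2 * t * mass F + energy F / t"
        unfolding Fp[symmetric] by (rule H_point_bound[OF FH p t])
      also have "\<dots> \<le> K * t * mass F + K * form F F / t"
        using eF K t0 mass_nonneg by (intro add_mono mult_right_mono) auto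
      also have "\<dots> = K / t * (\<Sum>j\<in>J. (b j)\<^sup>2 * (t\<^sup>2 + \<nu> j))"
      proof -
        have "(\<Sum>j\<in>J. (b j)\<^sup>2 * (t\<^sup>2 + \<nu> j)) = t\<^sup>2 * (\<Sum>j\<in>J. (b j)\<^sup>2) + (\<Sum>j\<in>J. (b j)\<^sup>2 * \<nu> j)"
          by (simp add: distrib_left sum.distrib sum_distrib_left mult.commute)
        then show ?thesis unfolding mF fF using t0 by (simp add: field_simps power2_eq_square)
      qed
      \<comment> \<open>The right-hand side reproduces \<open>s p\<close>, so the estimate reads s^2
        \<le> (K/t) s and bounds s by K/t.\<close>
      also have "(\<Sum>j\<in>J. (b j)\<^sup>2 * (t\<^sup>2 + \<nu> j)) = s p"
        unfolding s_def b_def using pos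
        by (intro sum.cong refl) (simp add: power_divide power2_eq_square less_imp_neq[symmetric])
      finally have *: "s p * s p \<le> K / t * s p" by (simp add: power2_eq_square)
      have "0 \<le> s p" unfolding s_def using pos by (intro sum_nonneg divide_nonneg_pos) auto
      show ?thesis
      proof (cases "s p = 0")
        case False
        with \<open>0 \<le> s p\<close> show ?thesis using mult_right_le_imp_le[OF *] by simp
      qed (use K t0 in simp)
    qed
    have fi: "integrable M (\<lambda>p. (f j p)\<^sup>2)" and f1: "(\<integral>p. (f j p)\<^sup>2 \<partial>M) = 1" if "j \<in> J" for j
      using H_l2[OF f[OF that]] on[OF that that] unfolding l2_space_def l2_inner_def
      by (auto simp: power2_eq_square)
    have "(\<Sum>j\<in>J. 1 / (t\<^sup>2 + \<nu> j)) = (\<Sum>j\<in>J. \<integral>p. (f j p)\<^sup>2 / (t\<^sup>2 + \<nu> j) \<partial>M)"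
      by (intro sum.cong refl) (simp add: f1)
    also have "\<dots> = (\<integral>p. s p \<partial>M)"
      unfolding s_def using fi by (intro Bochner_Integration.integral_sum[symmetric]) auto
    also have "\<dots> \<le> (\<integral>p. K / t \<partial>M)"
    proof (rule integral_mono)
      show "integrable M s" unfolding s_def using fi by (intro Bochner_Integration.integrable_sum) auto
    qed (use s in \<open>auto simp: space_graph_measure\<close>)
    finally show "(\<Sum>j\<in>J. 1 / (t\<^sup>2 + \<nu> j)) \<le> measure M (space M) * K / t" by simp
  qed
qed

end

section \<open>The Galerkin error and the covariance\<close>

text \<open>The bases and the mesh are fixed here. Constants are produced in
  \<open>graph_problem\<close>, before these parameters are chosen, which is what makes them
  independent of the mesh.\<close>

locale discretised_problem = graph_problem G a \<kappa> \<alpha> \<kappa>\<^sub>0 a\<^sub>0 S d\<^sub>0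
  for G :: "('v, 'e) metric_graph" and a \<kappa> \<alpha> \<kappa>\<^sub>0 a\<^sub>0 S d\<^sub>0 +
  fixes \<phi> :: "nat \<Rightarrow> 'e \<times> real \<Rightarrow> real" and lam :: "nat \<Rightarrow> real"
    and n :: "'e \<Rightarrow> nat" and N :: nat
    and \<phi>h :: "nat \<Rightarrow> 'e \<times> real \<Rightarrow> real" and lamh :: "nat \<Rightarrow> real"
  assumes eigenbasis: "graph_eigenbasis G a \<kappa> \<alpha> \<phi> lam"
    and mesh: "is_mesh G n"
    and fem_basis: "fem_eigenbasis G a \<kappa> \<alpha> n N \<phi>h lamh"
begin

lemma regular_eigenfunction: "regular_solution (\<phi> j) (\<lambda>p. lam j * \<phi> j p)"
  using eigenbasis by (intro eigenfunction_regular) (auto simp: graph_eigenbasis_def)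

lemma \<phi>_H: "\<phi> j \<in> H"
  using regular_eigenfunction unfolding regular_solution_def by blast

lemma \<phi>_orthonormal: "l2_inner M (\<phi> i) (\<phi> j) = (if i = j then 1 else 0)"
  using eigenbasis unfolding graph_eigenbasis_def by blast

lemma \<phi>_form: "w \<in> H \<Longrightarrow> form (\<phi> j) w = lam j * l2_inner M (\<phi> j) w"
  using regular_eigenfunction[of j] L.scale_left[OF H_l2[OF \<phi>_H] H_l2, of w "lam j" j]
  unfolding regular_solution_def by simp

lemma \<phi>h_fem: "k < N \<Longrightarrow> \<phi>h k \<in> fem_space G n"
  using fem_basis unfolding fem_eigenbasis_def by blast

lemma \<phi>h_H: "k < N \<Longrightarrow> \<phi>h k \<in> H"
  using fem_space_H[OF mesh \<phi>h_fem] .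

lemma \<phi>h_orthonormal: "\<lbrakk>i < N; j < N\<rbrakk> \<Longrightarrow> l2_inner M (\<phi>h i) (\<phi>h j) = (if i = j then 1 else 0)"
  using fem_basis unfolding fem_eigenbasis_def by blast

lemma \<phi>h_form: "\<lbrakk>k < N; w \<in> fem_space G n\<rbrakk> \<Longrightarrow> form (\<phi>h k) w = lamh k * l2_inner M (\<phi>h k) w"
  using fem_eigenbasis_weak[OF mesh fem_basis] .

text \<open>An eigenvalue is the value of the form at a normalised eigenfunction, so the coercivity
  constant bounds both spectra from below. The discrete one inherits the bound because the discrete
  space lies in \<open>H\<close>.\<close>

lemma eigenvalue_bounds:
  assumes "\<And>f. f \<in> H \<Longrightarrow> c * (mass f + energy f) \<le> form f f" "0 < c"
  shows "c \<le> lam j" "k < N \<Longrightarrow> c \<le> lamh k"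
proof -
  have *: "c \<le> form f f" if "f \<in> H" "l2_inner M f f = 1" for f
    using assms(1)[OF that(1)] mult_nonneg_nonneg[OF less_imp_le[OF assms(2)] energy_nonneg[of f]]
      mass_eq[OF that(1)] that(2) by (simp add: distrib_left)
  show "c \<le> lam j" using *[OF \<phi>_H, of j] \<phi>_form[OF \<phi>_H, of j j] by (simp add: \<phi>_orthonormal)
  show "c \<le> lamh k" if "k < N"
    using *[OF \<phi>h_H[OF that]] \<phi>h_form[OF that \<phi>h_fem[OF that]] \<phi>h_orthonormal[OF that that] by simp
qed

lemma lam_pos: "0 < lam j" and lamh_pos: "k < N \<Longrightarrow> 0 < lamh k"
proof -
  obtain c where c: "0 < c" "\<And>f. f \<in> H \<Longrightarrow> c * (mass f + energy f) \<le> form f f" by (rule form_coercive) blast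
  show "0 < lam j" using eigenvalue_bounds(1)[OF c(2,1), of j] c(1) by linarith
  show "0 < lamh k" if "k < N" using eigenvalue_bounds(2)[OF c(2,1) that] c(1) by linarith
qed

definition \<mu> :: "nat \<Rightarrow> real" where "\<mu> j = 1 / lam j"
definition \<mu>h :: "nat \<Rightarrow> real" where "\<mu>h k = 1 / lamh k"
definition overlap :: "nat \<Rightarrow> nat \<Rightarrow> real" where "overlap j k = l2_inner M (\<phi> j) (\<phi>h k)"

lemma parseval: "f \<in> H \<Longrightarrow> (\<lambda>j. (l2_inner M f (\<phi> j))\<^sup>2) sums l2_inner M f f"
  by (intro graph_eigenbasis_parseval[OF eigenbasis] H_l2 \<phi>_H)

lemma overlap_sums: "k < N \<Longrightarrow> (\<lambda>j. (overlap j k)\<^sup>2) sums 1"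
  using parseval[OF \<phi>h_H, of k] \<phi>h_orthonormal[of k k] L.sym[OF H_l2[OF \<phi>h_H] H_l2[OF \<phi>_H]]
  by (simp add: overlap_def)

lemma overlap_sum_le: "k < N \<Longrightarrow> (\<Sum>j<m. (overlap j k)\<^sup>2) \<le> 1"
  using sum_le_suminf[OF sums_summable[OF overlap_sums], of k "{..<m}"] sums_unique[OF overlap_sums, of k] by simp

section \<open>Solutions, Galerkin solutions and their errors\<close>

definition u :: "nat \<Rightarrow> (nat \<Rightarrow> real) \<Rightarrow> 'e \<times> real \<Rightarrow> real" where
  "u m g p = (\<Sum>j<m. (g j * \<mu> j) * \<phi> j p)"

definition rhs :: "nat \<Rightarrow> (nat \<Rightarrow> real) \<Rightarrow> 'e \<times> real \<Rightarrow> real" where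
  "rhs m g p = (\<Sum>j<m. g j * \<phi> j p)"

text \<open>This is the inverse of \<open>L\<^sub>h\<close> applied to the L2 projection of
  \<open>rhs m g\<close>, written in the discrete eigenbasis.\<close>

definition uh :: "nat \<Rightarrow> (nat \<Rightarrow> real) \<Rightarrow> 'e \<times> real \<Rightarrow> real" where
  "uh m g p = (\<Sum>k<N. (\<mu>h k * (\<Sum>j<m. g j * overlap j k)) * \<phi>h k p)"

definition err :: "nat \<Rightarrow> (nat \<Rightarrow> real) \<Rightarrow> 'e \<times> real \<Rightarrow> real" where
  "err m g p = u m g p - uh m g p"

lemma u_regular: "regular_solution (u m g) (rhs m g)"
proof -
  have "regular_solution (\<lambda>p. \<Sum>j<m. (g j * \<mu> j) * \<phi> j p) (\<lambda>p. \<Sum>j<m. (g j * \<mu> j) * (lam j * \<phi> j p))"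
    by (intro regular_solution_sum regular_eigenfunction) simp
  moreover have "(g j * \<mu> j) * (lam j * \<phi> j p) = g j * \<phi> j p" for j p
    using lam_pos[of j] by (simp add: \<mu>_def)
  ultimately show ?thesis unfolding u_def[abs_def] rhs_def[abs_def] by simp
qed

lemma u_H: "u m g \<in> H" and rhs_H: "rhs m g \<in> H"
  and u_form: "w \<in> H \<Longrightarrow> form (u m g) w = l2_inner M (rhs m g) w"
  using u_regular[of m g] unfolding regular_solution_def by auto

lemma uh_H: "uh m g \<in> H"
  unfolding uh_def[abs_def] by (intro form.sum_mem \<phi>h_H) auto

lemma err_H: "err m g \<in> H"
  unfolding err_def[abs_def] by (intro form.diff_mem u_H uh_H)

lemma rhs_inner: "w \<in> H \<Longrightarrow> l2_inner M (rhs m g) w = (\<Sum>j<m. g j * l2_inner M (\<phi> j) w)"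
  unfolding rhs_def[abs_def] by (intro L.sum_left H_l2 \<phi>_H) auto

lemma mass_rhs: "mass (rhs m g) = (\<Sum>j<m. (g j)\<^sup>2)"
proof -
  have "l2_inner M (\<phi> j) (rhs m g) = g j" if "j < m" for j
  proof -
    have "l2_inner M (\<phi> j) (rhs m g) = (\<Sum>i<m. g i * l2_inner M (\<phi> i) (\<phi> j))"
      using rhs_inner[OF \<phi>_H] L.sym[OF H_l2[OF \<phi>_H] H_l2[OF rhs_H]] by simp
    also have "\<dots> = (\<Sum>i<m. if i = j then g j else 0)" by (intro sum.cong) (auto simp: \<phi>_orthonormal)
    finally show ?thesis using that by simp
  qed
  then show ?thesis using rhs_inner[OF rhs_H, of m g m g] mass_eq[OF rhs_H] by (simp add: power2_eq_square)
qed

text \<open>Galerkin orthogonality: expanding w in the discrete eigenbasis cancels the discrete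
  eigenvalues, so \<open>uh\<close> and \<open>u\<close> have the same form against w, namely the L2
  product of the data with w.\<close>

lemma err_galerkin:
  assumes w: "w \<in> fem_space G n"
  shows "form (err m g) w = 0"
proof -
  note wH = fem_space_H[OF mesh w]
  obtain d where d: "\<And>p. p \<in> points G \<Longrightarrow> w p = (\<Sum>k<N. d k * \<phi>h k p)"
    using fem_basis w unfolding fem_eigenbasis_def by blast
  let ?w = "\<lambda>p. \<Sum>k<N. d k * \<phi>h k p"
  have w'H: "?w \<in> H" by (intro form.sum_mem \<phi>h_H) auto
  have wd: "l2_inner M f w = (\<Sum>k<N. d k * l2_inner M f (\<phi>h k))" if "f \<in> H" for f
  proof -
    have "l2_inner M f w = l2_inner M f ?w" by (intro l2_inner_cong) (auto simp: space_graph_measure d)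
    also have "\<dots> = (\<Sum>k<N. d k * l2_inner M f (\<phi>h k))" by (intro L.sum_right H_l2 \<phi>h_H that) auto
    finally show ?thesis .
  qed
  have dk: "l2_inner M (\<phi>h k) w = d k" if k: "k < N" for k
  proof -
    have "l2_inner M (\<phi>h k) w = (\<Sum>i<N. if i = k then d k else 0)"
      unfolding wd[OF \<phi>h_H[OF k]] using k by (intro sum.cong) (auto simp: \<phi>h_orthonormal)
    then show ?thesis using k by simp
  qed
  have "form (uh m g) w = (\<Sum>k<N. (\<mu>h k * (\<Sum>j<m. g j * overlap j k)) * form (\<phi>h k) w)"
    unfolding uh_def[abs_def] by (intro form.sum_left \<phi>h_H wH) auto
  also have "\<dots> = (\<Sum>k<N. (\<Sum>j<m. g j * overlap j k) * d k)"
  proof (intro sum.cong refl)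
    fix k assume "k \<in> {..<N}"
    then have k: "k < N" by simp
    then show "(\<mu>h k * (\<Sum>j<m. g j * overlap j k)) * form (\<phi>h k) w = (\<Sum>j<m. g j * overlap j k) * d k"
      unfolding \<phi>h_form[OF k w] dk[OF k] \<mu>h_def using lamh_pos[OF k] by simp
  qed
  also have "\<dots> = (\<Sum>j<m. g j * (\<Sum>k<N. d k * overlap j k))"
    unfolding sum_distrib_left sum_distrib_right by (subst sum.swap) (simp add: mult_ac)
  also have "\<dots> = (\<Sum>j<m. g j * l2_inner M (\<phi> j) w)" unfolding wd[OF \<phi>_H] overlap_def ..
  also have "\<dots> = form (u m g) w" using u_form[OF wH] rhs_inner[OF wH] by simp
  finally show ?thesis unfolding err_def[abs_def] using form.diff_left[OF u_H uh_H wH] by simp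
qed

lemma err_uh: "form (err m g) (uh m' g') = 0"
proof -
  have "form (err m g) (uh m' g') = (\<Sum>k<N. (\<mu>h k * (\<Sum>j<m'. g' j * overlap j k)) * form (err m g) (\<phi>h k))"
    unfolding uh_def[abs_def] by (intro form.sum_right \<phi>h_H err_H) auto
  then show ?thesis by (simp add: err_galerkin \<phi>h_fem)
qed

text \<open>The dual problem with data \<open>rhs m' g'\<close> is solved by \<open>u m' g'\<close>,
  from which the Galerkin solution may be subtracted since it is orthogonal to the other
  error.\<close>

lemma rhs_err: "l2_inner M (rhs m' g') (err m g) = form (err m g) (err m' g')"
  using u_form[OF err_H, of m' g' m g] form.sym[OF u_H err_H, of m' g' m g]
    form.diff_right[OF u_H[of m' g'] uh_H[of m' g'] err_H[of m g]] err_uh[of m g m' g']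
  unfolding err_def[of m' g', abs_def] by simp

text \<open>\<open>\<epsilon>\<close> controls the squared energy distance and is of order h^2. The
  same \<open>\<epsilon>\<close> will bound the L2 norm of the error itself, so the squared L2 norm
  is of order h^4.\<close>

definition approximates :: "real \<Rightarrow> bool" where
  "approximates \<epsilon> \<longleftrightarrow> (\<forall>u f. regular_solution u f \<longrightarrow>
     (\<exists>v\<in>fem_space G n. form (\<lambda>p. u p - v p) (\<lambda>p. u p - v p) \<le> \<epsilon> * mass f))"

text \<open>
  The Aubin--Nitsche duality argument: by \<open>rhs_err\<close> the error operator is represented by the
  energy form of the errors, so its norm is the square of the energy-norm error.
\<close>

lemma err_l2_bound:
  assumes approx: "approximates \<epsilon>" and \<epsilon>: "0 \<le> \<epsilon>"
  shows "l2_inner M (err m g) (err m g) \<le> \<epsilon>\<^sup>2 * (\<Sum>j<m. (g j)\<^sup>2)"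
proof -
  \<comment> \<open>Cea's lemma with constant 1: the form is symmetric, so the Galerkin solution is
    a best approximation in energy.\<close>
  have en: "form (err m g) (err m g) \<le> \<epsilon> * (\<Sum>j<m. (g j)\<^sup>2)" for m g
  proof -
    obtain v where v: "v \<in> fem_space G n"
      and le: "form (\<lambda>p. u m g p - v p) (\<lambda>p. u m g p - v p) \<le> \<epsilon> * mass (rhs m g)"
      using approx u_regular unfolding approximates_def by blast
    note vH = fem_space_H[OF mesh v]
    let ?D = "err m g" and ?d = "\<lambda>p. u m g p - v p"
    have "form ?D ?D = form ?D (u m g)"
      using form.diff_right[OF u_H[of m g] uh_H[of m g] err_H[of m g]] err_uh[of m g m g]
      unfolding err_def[of m g, abs_def] by simp
    also have "\<dots> = form ?D ?d"
      using form.diff_right[OF u_H[of m g] vH err_H[of m g]] err_galerkin[OF v] by simp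
    finally have e: "form ?D ?D = form ?D ?d" .
    have "form ?D ?D * form ?D ?D \<le> form ?d ?d * form ?D ?D"
      using form.cauchy_schwarz[OF err_H[of m g] form.diff_mem[OF u_H[of m g] vH]]
      unfolding e[symmetric] by (simp add: power2_eq_square mult.commute)
    then have "form ?D ?D \<le> form ?d ?d"
      using form.nonneg[OF err_H[of m g]] form.nonneg[OF form.diff_mem[OF u_H[of m g] vH]]
      by (cases "form ?D ?D = 0") (auto simp: mult_le_cancel_right)
    with le show ?thesis unfolding mass_rhs by linarith
  qed
  define D where "D = err m g"
  have DH: "D \<in> H" unfolding D_def by (rule err_H)
  define d where "d i = l2_inner M D (\<phi> i)" for i
  \<comment> \<open>The dual data are the first m' Fourier coefficients of the error itself. The
    energy bound for both errors produces the sum on both sides, where one factor cancels; letting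
    m' grow recovers the full norm by Parseval.\<close>
  have part: "(\<Sum>i<m'. (d i)\<^sup>2) \<le> \<epsilon>\<^sup>2 * (\<Sum>j<m. (g j)\<^sup>2)" for m'
  proof -
    define A where "A = (\<Sum>i<m'. (d i)\<^sup>2)"
    have A0: "0 \<le> A" unfolding A_def by (intro sum_nonneg) auto
    have G0: "0 \<le> (\<Sum>j<m. (g j)\<^sup>2)" by (intro sum_nonneg) auto
    have "A = (\<Sum>i<m'. d i * l2_inner M (\<phi> i) D)"
      unfolding A_def d_def using L.sym[OF H_l2[OF DH] H_l2[OF \<phi>_H]] by (simp add: power2_eq_square)
    also have "\<dots> = l2_inner M (rhs m' d) D" by (rule rhs_inner[OF DH, symmetric])
    also have "\<dots> = form D (err m' d)" unfolding D_def by (rule rhs_err)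
    finally have "A\<^sup>2 \<le> form D D * form (err m' d) (err m' d)"
      using form.cauchy_schwarz[OF DH err_H] by simp
    also have "\<dots> \<le> (\<epsilon> * (\<Sum>j<m. (g j)\<^sup>2)) * (\<epsilon> * A)"
      unfolding A_def D_def using form.nonneg[OF err_H] \<epsilon> G0 by (intro mult_mono en) auto
    finally have "A * A \<le> (\<epsilon>\<^sup>2 * (\<Sum>j<m. (g j)\<^sup>2)) * A" by (simp add: power2_eq_square mult_ac)
    then have "A \<le> \<epsilon>\<^sup>2 * (\<Sum>j<m. (g j)\<^sup>2)"
      using A0 G0 by (cases "A = 0") (auto simp: mult_le_cancel_right)
    then show ?thesis unfolding A_def .
  qed
  have "(\<lambda>m'. \<Sum>i<m'. (d i)\<^sup>2) \<longlonglongrightarrow> l2_inner M D D"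
    using parseval[OF DH] unfolding sums_def d_def .
  then show ?thesis unfolding D_def[symmetric] by (rule LIMSEQ_le_const2) (use part in blast)
qed

lemma err_inner_\<phi>h:
  assumes k: "k < N"
  shows "l2_inner M (err m g) (\<phi>h k) = (\<Sum>j<m. g j * ((\<mu> j - \<mu>h k) * overlap j k))"
proof -
  have "l2_inner M (u m g) (\<phi>h k) = (\<Sum>j<m. (g j * \<mu> j) * overlap j k)"
    unfolding u_def[abs_def] overlap_def by (intro L.sum_left H_l2 \<phi>_H \<phi>h_H k) auto
  moreover have "l2_inner M (uh m g) (\<phi>h k) = \<mu>h k * (\<Sum>j<m. g j * overlap j k)"
  proof -
    have "l2_inner M (uh m g) (\<phi>h k) = (\<Sum>i<N. (\<mu>h i * (\<Sum>j<m. g j * overlap j i)) * l2_inner M (\<phi>h i) (\<phi>h k))"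
      unfolding uh_def[abs_def] by (intro L.sum_left H_l2 \<phi>h_H k) auto
    also have "\<dots> = (\<Sum>i<N. if i = k then \<mu>h k * (\<Sum>j<m. g j * overlap j k) else 0)"
      using k by (intro sum.cong) (auto simp: \<phi>h_orthonormal)
    finally show ?thesis using k by simp
  qed
  ultimately show ?thesis
    unfolding err_def[abs_def]
    using L.diff_left[OF H_l2[OF u_H] H_l2[OF uh_H] H_l2[OF \<phi>h_H[OF k]], of m g m g]
    by (simp add: sum_distrib_left sum_subtractf[symmetric] algebra_simps)
qed

text \<open>The data are chosen so that the product of the error with \<open>\<phi>h k\<close>
  becomes the sum A to be bounded. Since \<open>\<phi>h k\<close> is normalised, A is at most
  \<epsilon> times the root of A.\<close>

lemma spectral_error_columns:
  assumes approx: "approximates \<epsilon>" and \<epsilon>: "0 \<le> \<epsilon>" and k: "k < N"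
  shows "(\<Sum>j<m. (\<mu> j - \<mu>h k)\<^sup>2 * (overlap j k)\<^sup>2) \<le> \<epsilon>\<^sup>2"
proof -
  define g where "g j = (\<mu> j - \<mu>h k) * overlap j k" for j
  define A where "A = (\<Sum>j<m. (g j)\<^sup>2)"
  have A0: "0 \<le> A" unfolding A_def by (intro sum_nonneg) auto
  have "A = l2_inner M (err m g) (\<phi>h k)"
    unfolding err_inner_\<phi>h[OF k] A_def by (simp add: g_def power2_eq_square)
  then have "A\<^sup>2 \<le> l2_inner M (err m g) (err m g)"
    using L.cauchy_schwarz[OF H_l2[OF err_H] H_l2[OF \<phi>h_H[OF k]], of m g] \<phi>h_orthonormal[OF k k] by simp
  also have "\<dots> \<le> \<epsilon>\<^sup>2 * A" unfolding A_def by (rule err_l2_bound[OF approx \<epsilon>])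
  finally have "A * A \<le> \<epsilon>\<^sup>2 * A" by (simp add: power2_eq_square)
  then have "A \<le> \<epsilon>\<^sup>2" using A0 by (cases "A = 0") (auto simp: mult_le_cancel_right)
  then show ?thesis unfolding A_def g_def by (simp add: power_mult_distrib)
qed

lemma bessel: "(\<Sum>k<N. (overlap j k)\<^sup>2) \<le> 1"
proof -
  define P where "P p = (\<Sum>k<N. overlap j k * \<phi>h k p)" for p
  have PH: "P \<in> H" unfolding P_def[abs_def] by (intro form.sum_mem \<phi>h_H) auto
  have 1: "l2_inner M (\<phi> j) P = (\<Sum>k<N. (overlap j k)\<^sup>2)"
    unfolding P_def[abs_def] using L.sum_right[of "{..<N}" \<phi>h "\<phi> j" "overlap j"] \<phi>h_H H_l2 \<phi>_H
    by (simp add: overlap_def power2_eq_square)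
  have kP: "l2_inner M (\<phi>h k) P = overlap j k" if k: "k < N" for k
  proof -
    have "l2_inner M (\<phi>h k) P = (\<Sum>i<N. overlap j i * l2_inner M (\<phi>h k) (\<phi>h i))"
      unfolding P_def[abs_def] by (intro L.sum_right H_l2 \<phi>h_H k) auto
    also have "\<dots> = (\<Sum>i<N. if i = k then overlap j k else 0)" using k by (intro sum.cong) (auto simp: \<phi>h_orthonormal)
    finally show ?thesis using k by simp
  qed
  have "l2_inner M P P = (\<Sum>k<N. overlap j k * l2_inner M (\<phi>h k) P)"
    using L.sum_left[of "{..<N}" \<phi>h P "overlap j"] \<phi>h_H H_l2 PH unfolding P_def[abs_def] by simp
  then have 2: "l2_inner M P P = (\<Sum>k<N. (overlap j k)\<^sup>2)" using kP by (simp add: power2_eq_square)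
  define A where "A = (\<Sum>k<N. (overlap j k)\<^sup>2)"
  have "A * A \<le> 1 * A"
    using L.cauchy_schwarz[OF H_l2[OF \<phi>_H] H_l2[OF PH], of j] \<phi>_orthonormal[of j j]
    unfolding 1 2 A_def by (simp add: power2_eq_square)
  moreover have "0 \<le> A" unfolding A_def by (intro sum_nonneg) auto
  ultimately have "A \<le> 1" by (cases "A = 0") (auto simp: mult_le_cancel_right)
  then show ?thesis unfolding A_def .
qed

text \<open>The data are the single eigenfunction \<open>\<phi> j\<close>. Its error splits
  orthogonally into a component in the discrete space, which gives the sum over k, and the component
  of \<mu>\<phi> outside that space, where the discrete solution has nothing to offer.\<close>

lemma spectral_error_rows:
  assumes approx: "approximates \<epsilon>" and \<epsilon>: "0 \<le> \<epsilon>"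
  shows "(\<Sum>k<N. (\<mu> j - \<mu>h k)\<^sup>2 * (overlap j k)\<^sup>2) + (\<mu> j)\<^sup>2 * (1 - (\<Sum>k<N. (overlap j k)\<^sup>2)) \<le> \<epsilon>\<^sup>2"
proof -
  define g where "g i = (if i = j then 1 else 0 :: real)" for i
  define D where "D = err (Suc j) g"
  have DH: "D \<in> H" unfolding D_def by (rule err_H)
  have Dk: "l2_inner M D (\<phi>h k) = (\<mu> j - \<mu>h k) * overlap j k" if "k < N" for k
    unfolding D_def err_inner_\<phi>h[OF that] g_def by (simp add: if_distrib[of "\<lambda>t. t * _"] cong: if_cong)
  have gc: "(\<Sum>i<Suc j. g i * overlap i k) = overlap j k" for k
    unfolding g_def by (simp add: if_distrib[of "\<lambda>t. t * _"] cong: if_cong)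
  have Dp: "D p = \<mu> j * \<phi> j p - (\<Sum>k<N. (\<mu>h k * overlap j k) * \<phi>h k p)" for p
    unfolding D_def err_def u_def uh_def gc
    by (simp add: g_def if_distrib[of "\<lambda>t. t * _"] cong: if_cong)
  define P where "P p = (\<Sum>k<N. (\<mu>h k * overlap j k) * \<phi>h k p)" for p
  have PH: "P \<in> H" unfolding P_def[abs_def] by (intro form.sum_mem \<phi>h_H) auto
  have D_eq: "D = (\<lambda>p. \<mu> j * \<phi> j p - P p)" unfolding P_def using Dp by (intro ext)
  have DP: "l2_inner M D P = (\<Sum>k<N. (\<mu>h k * overlap j k) * ((\<mu> j - \<mu>h k) * overlap j k))"
  proof -
    have "l2_inner M D P = (\<Sum>k<N. (\<mu>h k * overlap j k) * l2_inner M D (\<phi>h k))"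
      unfolding P_def[abs_def] by (intro L.sum_right H_l2 \<phi>h_H DH) auto
    then show ?thesis by (simp add: Dk)
  qed
  have Dj: "l2_inner M D (\<phi> j) = \<mu> j - (\<Sum>k<N. \<mu>h k * (overlap j k)\<^sup>2)"
  proof -
    have "l2_inner M P (\<phi> j) = (\<Sum>k<N. (\<mu>h k * overlap j k) * l2_inner M (\<phi>h k) (\<phi> j))"
      unfolding P_def[abs_def] by (intro L.sum_left H_l2 \<phi>h_H \<phi>_H) auto
    also have "\<dots> = (\<Sum>k<N. \<mu>h k * (overlap j k)\<^sup>2)"
      unfolding overlap_def using L.sym[OF H_l2[OF \<phi>h_H] H_l2[OF \<phi>_H]] by (intro sum.cong) (auto simp: power2_eq_square)
    finally show ?thesis
      unfolding D_eq using H_l2[OF \<phi>_H, of j] H_l2[OF PH] \<phi>_orthonormal[of j j]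
      by (simp add: L.diff_left L.scale_left L.scale_mem)
  qed
  have "l2_inner M D D = \<mu> j * l2_inner M D (\<phi> j) - l2_inner M D P"
  proof -
    have "l2_inner M D D = l2_inner M D (\<lambda>p. \<mu> j * \<phi> j p) - l2_inner M D P"
      using L.diff_right[OF L.scale_mem[OF H_l2[OF \<phi>_H[of j]]] H_l2[OF PH] H_l2[OF DH], of "\<mu> j"]
      by (simp add: D_eq[symmetric])
    also have "l2_inner M D (\<lambda>p. \<mu> j * \<phi> j p) = \<mu> j * l2_inner M D (\<phi> j)"
      using L.sym[OF H_l2[OF DH] L.scale_mem[OF H_l2[OF \<phi>_H[of j]]], of "\<mu> j"]
        L.sym[OF H_l2[OF DH] H_l2[OF \<phi>_H[of j]]] L.scale_left[OF H_l2[OF \<phi>_H[of j]] H_l2[OF DH], of "\<mu> j"]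
      by simp
    finally show ?thesis .
  qed
  also have "\<dots> = (\<Sum>k<N. (\<mu> j - \<mu>h k)\<^sup>2 * (overlap j k)\<^sup>2) + (\<mu> j)\<^sup>2 * (1 - (\<Sum>k<N. (overlap j k)\<^sup>2))"
    unfolding Dj DP
    by (simp add: power2_eq_square algebra_simps sum.distrib sum_subtractf sum_distrib_left)
  finally have "l2_inner M D D = \<dots>" .
  moreover have "(\<Sum>i<Suc j. (g i)\<^sup>2) = 1" unfolding g_def by (simp add: if_distrib[of "\<lambda>t. t\<^sup>2"] cong: if_cong)
  ultimately show ?thesis
    using err_l2_bound[OF approx \<epsilon>, of "Suc j" g] unfolding D_def by simp
qed

lemma \<phi>_form_orthonormal: "form_orthonormal {..<m} \<phi> lam"
  and \<phi>h_form_orthonormal: "form_orthonormal {..<N} \<phi>h lamh"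
  unfolding form_orthonormal_def
  by (auto simp: \<phi>_H lam_pos \<phi>_orthonormal \<phi>_form \<phi>h_H lamh_pos \<phi>h_orthonormal \<phi>h_form \<phi>h_fem)

section \<open>Covariances in the L2 space of the square of the graph\<close>

definition partial_covariance :: "real \<Rightarrow> nat \<Rightarrow> ('e \<times> real) \<times> ('e \<times> real) \<Rightarrow> real" where
  "partial_covariance \<beta> m = (\<lambda>(p, q). \<Sum>j<m. lam j powr (- 2 * \<beta>) * \<phi> j p * \<phi> j q)"

lemma lam_powr: "lam j powr (- 2 * \<beta>) = \<mu> j powr (2 * \<beta>)"
  using lam_pos[of j] by (simp add: \<mu>_def powr_divide powr_minus_divide)

lemma lamh_powr: "k < N \<Longrightarrow> lamh k powr (- 2 * \<beta>) = \<mu>h k powr (2 * \<beta>)"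
  using lamh_pos[of k] by (simp add: \<mu>h_def powr_divide powr_minus_divide)

text \<open>All three inner products of the two finite tensor sums are explicit. The third sum
  records the truncation: it is the part of each discrete eigenfunction missed by the first m
  eigenfunctions, weighted by its discrete covariance eigenvalue.\<close>

lemma covariance_difference:
  defines "R \<equiv> M \<Otimes>\<^sub>M M"
  shows "partial_covariance \<beta> m \<in> l2_space R" "fem_covariance \<beta> N \<phi>h lamh \<in> l2_space R"
    "(l2_norm R (\<lambda>z. partial_covariance \<beta> m z - fem_covariance \<beta> N \<phi>h lamh z))\<^sup>2 =
      (\<Sum>j<m. \<mu> j powr (2 * (2 * \<beta>)) * (1 - (\<Sum>k<N. (overlap j k)\<^sup>2))) +
      (\<Sum>j<m. \<Sum>k<N. (\<mu> j powr (2 * \<beta>) - \<mu>h k powr (2 * \<beta>))\<^sup>2 * (overlap j k)\<^sup>2) +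
      (\<Sum>k<N. \<mu>h k powr (2 * (2 * \<beta>)) * (1 - (\<Sum>j<m. (overlap j k)\<^sup>2)))"
proof -
  interpret R: semi_inner "l2_space R" "l2_inner R" by (rule l2_semi_inner)
  define T where "T f = (\<lambda>(p, q). f p * f q :: real)" for f :: "'e \<times> real \<Rightarrow> real"
  have T: "T f \<in> l2_space R" if "f \<in> H" for f
    unfolding T_def R_def using that by (intro tensor_l2 H_l2) unfold_locales
  have TT: "l2_inner R (T f) (T g) = (l2_inner M f g)\<^sup>2" if "f \<in> H" "g \<in> H" for f g
    unfolding T_def R_def using that by (intro tensor_l2 H_l2) unfold_locales
  define X where "X j = \<mu> j powr (2 * \<beta>)" for j
  define Y where "Y k = \<mu>h k powr (2 * \<beta>)" for k
  have X2: "\<mu> j powr (2 * (2 * \<beta>)) = (X j)\<^sup>2" for j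
    by (simp add: X_def power2_eq_square powr_add[symmetric])
  have Y2: "\<mu>h k powr (2 * (2 * \<beta>)) = (Y k)\<^sup>2" for k
    by (simp add: Y_def power2_eq_square powr_add[symmetric])
  have p: "partial_covariance \<beta> m = (\<lambda>z. \<Sum>j<m. X j * T (\<phi> j) z)"
    unfolding partial_covariance_def T_def X_def lam_powr by (auto simp: mult.assoc)
  have f: "fem_covariance \<beta> N \<phi>h lamh = (\<lambda>z. \<Sum>k<N. Y k * T (\<phi>h k) z)"
    unfolding fem_covariance_def T_def Y_def using lamh_powr by (auto simp: mult.assoc intro!: ext sum.cong)
  define A where "A = (\<lambda>z. \<Sum>j<m. X j * T (\<phi> j) z)"
  define F where "F = (\<lambda>z. \<Sum>k<N. Y k * T (\<phi>h k) z)"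
  have AR: "A \<in> l2_space R" unfolding A_def by (intro R.sum_mem T \<phi>_H) auto
  have FR: "F \<in> l2_space R" unfolding F_def by (intro R.sum_mem T \<phi>h_H) auto
  show "partial_covariance \<beta> m \<in> l2_space R" "fem_covariance \<beta> N \<phi>h lamh \<in> l2_space R"
    unfolding p f using AR FR unfolding A_def F_def .
  have AA: "l2_inner R A A = (\<Sum>j<m. (X j)\<^sup>2)"
  proof -
    have "l2_inner R A A = (\<Sum>i<m. X i * l2_inner R (T (\<phi> i)) A)"
      using R.sum_left[of "{..<m}" "\<lambda>j. T (\<phi> j)" A X] T[OF \<phi>_H] AR unfolding A_def by simp
    also have "\<dots> = (\<Sum>i<m. X i * (\<Sum>j<m. X j * l2_inner R (T (\<phi> i)) (T (\<phi> j))))"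
      unfolding A_def using T[OF \<phi>_H] by (subst R.sum_right) auto
    also have "\<dots> = (\<Sum>i<m. X i * (\<Sum>j<m. if j = i then X i else 0))"
      by (intro sum.cong refl arg_cong2[where f = "(*)"]) (auto simp: TT \<phi>_H \<phi>_orthonormal)
    finally show ?thesis by (simp add: power2_eq_square)
  qed
  have FF: "l2_inner R F F = (\<Sum>k<N. (Y k)\<^sup>2)"
  proof -
    have "l2_inner R F F = (\<Sum>i<N. Y i * l2_inner R (T (\<phi>h i)) F)"
      using R.sum_left[of "{..<N}" "\<lambda>j. T (\<phi>h j)" F Y] T[OF \<phi>h_H] FR unfolding F_def by simp
    also have "\<dots> = (\<Sum>i<N. Y i * (\<Sum>j<N. Y j * l2_inner R (T (\<phi>h i)) (T (\<phi>h j))))"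
      unfolding F_def using T[OF \<phi>h_H] by (intro sum.cong refl arg_cong2[where f = "(*)"] R.sum_right) auto
    also have "\<dots> = (\<Sum>i<N. Y i * (\<Sum>j<N. if j = i then Y i else 0))"
      by (intro sum.cong refl arg_cong2[where f = "(*)"]) (auto simp: TT \<phi>h_H \<phi>h_orthonormal)
    finally show ?thesis by (simp add: power2_eq_square)
  qed
  have AF: "l2_inner R A F = (\<Sum>j<m. \<Sum>k<N. X j * Y k * (overlap j k)\<^sup>2)"
  proof -
    have "l2_inner R A F = (\<Sum>j<m. X j * l2_inner R (T (\<phi> j)) F)"
      unfolding A_def by (intro R.sum_left T \<phi>_H FR) auto
    also have "\<dots> = (\<Sum>j<m. X j * (\<Sum>k<N. Y k * l2_inner R (T (\<phi> j)) (T (\<phi>h k))))"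
      unfolding F_def using T[OF \<phi>h_H] T[OF \<phi>_H] by (intro sum.cong refl arg_cong2[where f = "(*)"] R.sum_right) auto
    also have "\<dots> = (\<Sum>j<m. X j * (\<Sum>k<N. Y k * (overlap j k)\<^sup>2))"
      by (intro sum.cong refl arg_cong2[where f = "(*)"]) (auto simp: TT \<phi>h_H \<phi>_H overlap_def)
    finally show ?thesis by (simp add: sum_distrib_left mult.assoc)
  qed
  have "(l2_norm R (\<lambda>z. A z - F z))\<^sup>2 = l2_inner R (\<lambda>z. A z - F z) (\<lambda>z. A z - F z)"
    unfolding l2_norm_eq by (intro real_sqrt_pow2 R.nonneg R.diff_mem AR FR)
  also have "\<dots> = l2_inner R A A - 2 * l2_inner R A F + l2_inner R F F"
    using AR FR R.sym[OF FR AR] by (simp add: R.diff_left R.diff_right R.diff_mem)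
  also have "\<dots> = (\<Sum>j<m. (X j)\<^sup>2 * (1 - (\<Sum>k<N. (overlap j k)\<^sup>2))) + (\<Sum>j<m. \<Sum>k<N. (X j - Y k)\<^sup>2 * (overlap j k)\<^sup>2) +
      (\<Sum>k<N. (Y k)\<^sup>2 * (1 - (\<Sum>j<m. (overlap j k)\<^sup>2)))"
  proof -
    have "(\<Sum>k<N. (Y k)\<^sup>2 * (1 - (\<Sum>j<m. (overlap j k)\<^sup>2))) = (\<Sum>k<N. (Y k)\<^sup>2) - (\<Sum>j<m. \<Sum>k<N. (Y k)\<^sup>2 * (overlap j k)\<^sup>2)"
      by (subst sum.swap) (simp add: right_diff_distrib sum_subtractf sum_distrib_left)
    moreover have "(\<Sum>j<m. (X j)\<^sup>2 * (1 - (\<Sum>k<N. (overlap j k)\<^sup>2))) = (\<Sum>j<m. (X j)\<^sup>2) - (\<Sum>j<m. \<Sum>k<N. (X j)\<^sup>2 * (overlap j k)\<^sup>2)"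
      by (simp add: right_diff_distrib sum_subtractf sum_distrib_left)
    moreover have "(\<Sum>j<m. \<Sum>k<N. (X j - Y k)\<^sup>2 * (overlap j k)\<^sup>2) = (\<Sum>j<m. \<Sum>k<N. (X j)\<^sup>2 * (overlap j k)\<^sup>2) -
        2 * (\<Sum>j<m. \<Sum>k<N. X j * Y k * (overlap j k)\<^sup>2) + (\<Sum>j<m. \<Sum>k<N. (Y k)\<^sup>2 * (overlap j k)\<^sup>2)"
      unfolding sum_distrib_left sum_subtractf[symmetric] sum.distrib[symmetric]
      by (intro sum.cong refl) (simp add: power2_eq_square algebra_simps)
    ultimately show ?thesis unfolding AA AF FF by simp
  qed
  finally show "(l2_norm R (\<lambda>z. partial_covariance \<beta> m z - fem_covariance \<beta> N \<phi>h lamh z))\<^sup>2 =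
      (\<Sum>j<m. \<mu> j powr (2 * (2 * \<beta>)) * (1 - (\<Sum>k<N. (overlap j k)\<^sup>2))) +
      (\<Sum>j<m. \<Sum>k<N. (\<mu> j powr (2 * \<beta>) - \<mu>h k powr (2 * \<beta>))\<^sup>2 * (overlap j k)\<^sup>2) +
      (\<Sum>k<N. \<mu>h k powr (2 * (2 * \<beta>)) * (1 - (\<Sum>j<m. (overlap j k)\<^sup>2)))"
    unfolding p f X2 Y2 unfolding A_def F_def X_def Y_def .
qed

text \<open>The hypothesis bounds two of the three sums uniformly in m. The third runs over finitely
  many k and tends to 0, since the squared overlaps with each discrete eigenfunction sum to 1; the
  series remainder vanishes by assumption.\<close>

lemma covariance_error:
  assumes \<rho>: "covariance_series_sums G \<beta> \<phi> lam \<rho>"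
    and bound: "\<And>m. (\<Sum>j<m. \<mu> j powr (2 * (2 * \<beta>)) * (1 - (\<Sum>k<N. (overlap j k)\<^sup>2))) +
      (\<Sum>j<m. \<Sum>k<N. (\<mu> j powr (2 * \<beta>) - \<mu>h k powr (2 * \<beta>))\<^sup>2 * (overlap j k)\<^sup>2) \<le> B"
  shows "l2_norm (M \<Otimes>\<^sub>M M) (\<lambda>z. \<rho> z - fem_covariance \<beta> N \<phi>h lamh z) \<le> sqrt B"
proof -
  let ?R = "M \<Otimes>\<^sub>M M" and ?F = "fem_covariance \<beta> N \<phi>h lamh" and ?P = "partial_covariance \<beta>"
  interpret R: semi_inner "l2_space ?R" "l2_inner ?R" by (rule l2_semi_inner)
  note PR = covariance_difference(1)[of \<beta>] and FR = covariance_difference(2)[of \<beta>]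
  have \<rho>R: "\<rho> \<in> l2_space ?R" using \<rho> unfolding covariance_series_sums_def by blast
  have "(\<lambda>(p, q). \<rho> (p, q) - (\<Sum>j<m. lam j powr (- 2 * \<beta>) * \<phi> j p * \<phi> j q)) = (\<lambda>z. \<rho> z - ?P m z)" for m
    unfolding partial_covariance_def by auto
  then have lim: "(\<lambda>m. l2_norm ?R (\<lambda>z. \<rho> z - ?P m z)) \<longlonglongrightarrow> 0"
    using \<rho> unfolding covariance_series_sums_def by simp
  define E where "E m = (\<Sum>k<N. \<mu>h k powr (2 * (2 * \<beta>)) * (1 - (\<Sum>j<m. (overlap j k)\<^sup>2)))" for m
  have "E \<longlonglongrightarrow> (\<Sum>k<N. \<mu>h k powr (2 * (2 * \<beta>)) * (1 - 1))"
    unfolding E_def using overlap_sums by (intro tendsto_intros) (auto simp: sums_def)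
  then have E: "E \<longlonglongrightarrow> 0" by simp
  have "l2_norm ?R (\<lambda>z. \<rho> z - ?F z) \<le> l2_norm ?R (\<lambda>z. \<rho> z - ?P m z) + sqrt (B + E m)" for m
  proof -
    have "(l2_norm ?R (\<lambda>z. ?P m z - ?F z))\<^sup>2 \<le> B + E m"
      unfolding covariance_difference(3) E_def using bound[of m] by simp
    then have "l2_norm ?R (\<lambda>z. ?P m z - ?F z) \<le> sqrt (B + E m)" by (rule real_le_rsqrt)
    moreover have "l2_norm ?R (\<lambda>z. \<rho> z - ?F z) \<le>
        l2_norm ?R (\<lambda>z. \<rho> z - ?P m z) + l2_norm ?R (\<lambda>z. ?P m z - ?F z)"
      using R.triangle[OF R.diff_mem[OF \<rho>R PR] R.diff_mem[OF PR FR], of m m] by (simp add: l2_norm_eq)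
    ultimately show ?thesis by linarith
  qed
  moreover have "(\<lambda>m. l2_norm ?R (\<lambda>z. \<rho> z - ?P m z) + sqrt (B + E m)) \<longlonglongrightarrow> 0 + sqrt (B + 0)"
    by (intro tendsto_intros lim E)
  ultimately show ?thesis by (intro LIMSEQ_le_const[where x = "sqrt B"]) auto
qed

end

theorem theorem6p9:
  fixes G :: "('v, 'e) metric_graph"
    and a \<kappa> :: "'e \<times> real \<Rightarrow> real"
    and \<alpha> \<kappa>\<^sub>0 a\<^sub>0 S \<beta> \<sigma> :: real
    and d\<^sub>0 :: nat
  assumes "compact_metric_graph G" and "connected_graph G"
    and "\<kappa> \<in> linf_space (graph_measure G)"
    and "0 < \<kappa>\<^sub>0" and "AE p in graph_measure G. \<kappa>\<^sub>0 \<le> \<kappa> p"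
    and "graph_lipschitz G a" and "\<forall>p\<in>points G. 0 < a p"
    and "a\<^sub>0 = (INF p\<in>points G. a p)" and "0 < a\<^sub>0"
    and "d\<^sub>0 = Min (degree G ` verts G)"
    and "S = \<bar>\<alpha>\<bar> / real d\<^sub>0"
    and "0 \<le> \<alpha> \<or>
         (4 * S / Min (len G ` edges G) < \<kappa>\<^sub>0\<^sup>2 \<and> 2 * S * Max (len G ` edges G) \<le> a\<^sub>0)"
    and "1/4 < \<beta>"
    and "\<sigma> < min (4 * \<beta> - 1/2) 2"
  shows "\<exists>C. \<forall>\<phi> lam \<rho> n N \<phi>h lamh.
           graph_eigenbasis G a \<kappa> \<alpha> \<phi> lam \<longrightarrow>
           covariance_series_sums G \<beta> \<phi> lam \<rho> \<longrightarrow>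
           is_mesh G n \<longrightarrow>
           fem_eigenbasis G a \<kappa> \<alpha> n N \<phi>h lamh \<longrightarrow>
           l2_norm (graph_measure G \<Otimes>\<^sub>M graph_measure G)
             (\<lambda>z. \<rho> z - fem_covariance \<beta> N \<phi>h lamh z)
           \<le> C * max_mesh_width G n powr \<sigma>"
proof (cases "edges G = {}")
  case True
  \<comment> \<open>Without edges the underlying space is empty, so no function has norm 1 and there
    is nothing to bound.\<close>
  have "\<not> graph_eigenbasis G a \<kappa> \<alpha> \<phi> lam" for \<phi> lam
  proof
    assume "graph_eigenbasis G a \<kappa> \<alpha> \<phi> lam"
    then have "l2_inner (graph_measure G) (\<phi> 0) (\<phi> 0) = 1" unfolding graph_eigenbasis_def by simp
    moreover have "l2_inner (graph_measure G) (\<phi> 0) (\<phi> 0) = l2_inner (graph_measure G) (\<lambda>_. 0) (\<lambda>_. 0)"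
      using True by (intro l2_inner_cong) (auto simp: space_graph_measure points_def)
    ultimately show False by (simp add: l2_inner_def)
  qed
  then show ?thesis by blast
next
  case False
  interpret graph_problem G a \<kappa> \<alpha> \<kappa>\<^sub>0 a\<^sub>0 S d\<^sub>0
    using assms False by unfold_locales auto
  define s where "s = 2 * \<beta>"
  \<comment> \<open>The largest exponent compatible with the rate \<sigma>. The bound \<sigma> <
    4\<beta> - 1/2 puts 2s - \<sigma> above 1/2. The minimum with 2s matters for negative \<sigma>,
    and 2s = 4\<beta> > 1 is also large enough.\<close>
  define p where "p = min (2 * s - \<sigma>) (2 * s)"
  have sp: "0 < s" "1 / 2 < p" "0 \<le> p" "p \<le> 2 * s" "\<sigma> \<le> 2 * s - p" "\<sigma> \<le> 2"
    using assms(13,14) unfolding s_def p_def by auto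
  \<comment> \<open>Every constant is fixed from here on before any basis or mesh is
    introduced.\<close>
  obtain c where c: "0 < c" "\<And>f. f \<in> H \<Longrightarrow> c * (mass f + energy f) \<le> form f f" by (rule form_coercive) blast
  obtain A where A: "0 \<le> A"
    "\<And>u f n. \<lbrakk>regular_solution u f; is_mesh G n\<rbrakk> \<Longrightarrow>
       \<exists>v\<in>fem_space G n. form (\<lambda>p. u p - v p) (\<lambda>p. u p - v p) \<le> A * (max_mesh_width G n)\<^sup>2 * mass f"
    by (rule regular_solution_approximation) blast
  obtain K t\<^sub>0 where K: "0 \<le> K" and t0: "0 < t\<^sub>0"
    and res: "\<And>J f \<nu> t. \<lbrakk>form_orthonormal J f \<nu>; t\<^sub>0 \<le> t\<rbrakk> \<Longrightarrow> (\<Sum>j\<in>J. 1 / (t\<^sup>2 + \<nu> j)) \<le> K / t"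
    by (rule resolvent_trace_bound) blast
  obtain Q where Q: "\<And>(J :: nat set) \<nu>. \<lbrakk>finite J; \<And>j. j \<in> J \<Longrightarrow> c \<le> \<nu> j;
      \<And>t. t\<^sub>0 \<le> t \<Longrightarrow> (\<Sum>j\<in>J. 1 / (t\<^sup>2 + \<nu> j)) \<le> K / t\<rbrakk> \<Longrightarrow> (\<Sum>j\<in>J. \<nu> j powr (- p)) \<le> Q"
    using sum_powr_bound[OF sp(2) c(1) t0 K] by metis
  have lmax0: "0 < lmax" using lmin_pos lmin_le le_lmax edges_ne by (meson all_not_in_conv less_le_trans)
  have X: "0 < 1 / c" using c(1) by simp
  obtain C where C: "\<And>h n N x y c'. \<lbrakk>0 < h; h \<le> lmax; spectrally_close (A * h\<^sup>2) (1 / c) p Q n N x y c'\<rbrakk> \<Longrightarrow>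
      (\<Sum>j<n. x j powr (2 * s) * (1 - (\<Sum>k<N. (c' j k)\<^sup>2))) +
      (\<Sum>j<n. \<Sum>k<N. (x j powr s - y k powr s)\<^sup>2 * (c' j k)\<^sup>2) \<le> C * h powr (2 * \<sigma>)"
    by (rule spectral_sum_rate[OF sp(1,3,4,5,6) lmax0 X]) blast
  have "l2_norm (M \<Otimes>\<^sub>M M) (\<lambda>z. \<rho> z - fem_covariance \<beta> N \<phi>h lamh z) \<le> sqrt C * max_mesh_width G n powr \<sigma>"
    if eb: "graph_eigenbasis G a \<kappa> \<alpha> \<phi> lam" and \<rho>: "covariance_series_sums G \<beta> \<phi> lam \<rho>"
      and n: "is_mesh G n" and fb: "fem_eigenbasis G a \<kappa> \<alpha> n N \<phi>h lamh"
    for \<phi> lam \<rho> n N \<phi>h lamh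
  proof -
    interpret D: discretised_problem G a \<kappa> \<alpha> \<kappa>\<^sub>0 a\<^sub>0 S d\<^sub>0 \<phi> lam n N \<phi>h lamh
      by unfold_locales (rule eb n fb)+
    let ?h = "max_mesh_width G n"
    note h = max_mesh_width_bounds(2,3)[OF n]
    have \<epsilon>: "D.approximates (A * ?h\<^sup>2)" "0 \<le> A * ?h\<^sup>2"
      using A n unfolding D.approximates_def by auto
    have lam_ge: "c \<le> lam j" for j by (rule D.eigenvalue_bounds(1)[OF c(2) c(1)])
    have lamh_ge: "c \<le> lamh k" if "k < N" for k by (rule D.eigenvalue_bounds(2)[OF c(2) c(1) that])
    have "(\<Sum>j<m. lam j powr (- p)) \<le> Q" for m
      using lam_ge res[OF D.\<phi>_form_orthonormal] by (intro Q) auto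
    moreover have "(\<Sum>k<N. lamh k powr (- p)) \<le> Q"
      using lamh_ge res[OF D.\<phi>h_form_orthonormal] by (intro Q) auto
    moreover have "D.\<mu> j powr p = lam j powr (- p)" for j
      using D.lam_pos[of j] by (simp add: D.\<mu>_def powr_divide powr_minus_divide)
    moreover have "D.\<mu>h k powr p = lamh k powr (- p)" if "k < N" for k
      using D.lamh_pos[OF that] by (simp add: D.\<mu>h_def powr_divide powr_minus_divide)
    moreover have "0 < D.\<mu> j \<and> D.\<mu> j \<le> 1 / c" for j
      unfolding D.\<mu>_def using lam_ge[of j] c(1) D.lam_pos[of j] by (auto intro: divide_left_mono)
    moreover have "0 < D.\<mu>h k \<and> D.\<mu>h k \<le> 1 / c" if "k < N" for k
      unfolding D.\<mu>h_def using lamh_ge[OF that] c(1) D.lamh_pos[OF that] by (auto intro: divide_left_mono)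
    ultimately have "spectrally_close (A * ?h\<^sup>2) (1 / c) p Q m N D.\<mu> D.\<mu>h D.overlap" for m
      unfolding spectrally_close_def
      using D.spectral_error_rows[OF \<epsilon>] D.spectral_error_columns[OF \<epsilon>] D.bessel D.overlap_sum_le by simp
    then have "(\<Sum>j<m. D.\<mu> j powr (2 * s) * (1 - (\<Sum>k<N. (D.overlap j k)\<^sup>2))) +
        (\<Sum>j<m. \<Sum>k<N. (D.\<mu> j powr s - D.\<mu>h k powr s)\<^sup>2 * (D.overlap j k)\<^sup>2) \<le> C * ?h powr (2 * \<sigma>)" for m
      by (rule C[OF h])
    then have "l2_norm (M \<Otimes>\<^sub>M M) (\<lambda>z. \<rho> z - fem_covariance \<beta> N \<phi>h lamh z) \<le> sqrt (C * ?h powr (2 * \<sigma>))"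
      unfolding s_def by (rule D.covariance_error[OF \<rho>])
    also have "\<dots> = sqrt C * ?h powr \<sigma>"
    proof -
      have "?h powr (2 * \<sigma>) = (?h powr \<sigma>)\<^sup>2" by (simp add: power2_eq_square powr_add[symmetric])
      then show ?thesis by (simp add: real_sqrt_mult)
    qed
    finally show ?thesis .
  qed
  then show ?thesis by blast
qed

end
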